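(* Let $\lambda>1$, and let $\mathrm{FAS}(\varphi;\{\Psi_j\}_{j=0}^\infty)$ be the frequency-based affine shear system generated by $\varphi$ and $\Psi_j$, $j\ge 0$, where all generators $\{\varphi\}\cup\bigcup_{j\ge0}\Psi_j$ belong to $L_2^{loc}(\mathbb{R}^2)$. Define $\Lambda:=\bigcup_{j=0}^{\infty}\big([A_\lambda^{j}\mathbb{Z}^2]\cup[E A_\lambda^{j}\mathbb{Z}^2]\big)$. Then $\mathrm{FAS}(\varphi;\{\Psi_j\}_{j=0}^\infty)$ is a frequency-based affine shear tight frame for $L_2(\mathbb{R}^2)$ if and only if $$\mathcal{I}_{\varphi}^{0}(\xi)+\sum_{j=0}^{\infty}\big[\mathcal{I}_{\Psi_j}^{0}(B_\lambda^j\xi)+\mathcal{I}_{\Psi_j}^{0}(B_\lambda^jE\xi)\big]=1\quad\text{for a.e. }\xi\in\mathbb{R}^2$$ and, for every $k\in\Lambda\setminus\{0\}$, $$\mathcal{I}_{\varphi}^{k}(\xi)+\sum_{j=0}^{\infty}\big[\mathcal{I}_{\Psi_j}^{B_\lambda^jk}(B_\lambda^j\xi)+\mathcal{I}_{\Psi_j}^{B_\lambda^jEk}(B_\lambda^jE\xi)\big]=0\quad\text{for a.e. }\xi\in\mathbb{R}^2,$$ where the sum in the first identity converges absolutely and the infinite sum in the second identity is finite for almost every $\xi\in\mathbb{R}^2$.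
   Context: Matrices: $E=\begin{bmatrix}0&1\\1&0\end{bmatrix}$, $S_\tau=\begin{bmatrix}1&0\\ \tau&1\end{bmatrix}$, $A_\lambda=\mathrm{diag}(\lambda^2,\lambda)$, $B_\lambda=A_\lambda^{-1}=\mathrm{diag}(\lambda^{-2},\lambda^{-1})$. For a function $f$ on $\mathbb{R}^2$, an invertible real $2\times2$ matrix $U$ and $k\in\mathbb{R}^2$: $f_{U;0,k}(\xi):=|\det U|^{1/2}f(U\xi)e^{-ik\cdot U\xi}$ and $f_{0,k}:=f_{I_2;0,k}$. Inner product: $\langle f,g\rangle=\int_{\mathbb{R}^2} f\overline{g}$. $L_2^{loc}(\mathbb{R}^2)$ is the space of measurable functions that are square integrable on every compact set. Generators: for each $j\ge0$ let $0\le r_j\le s_j$ be integers; $\varphi$, $\psi$, and $\psi^{j,\ell}$ ($r_j+1\le|\ell|\le s_j$) are functions on $\mathbb{R}^2$; put $\psi^{j,\ell}:=\psi$ for $|\ell|\le r_j$. Define $$\Psi_j:=\{\psi(S_\ell\cdot):\ |\ell|\le r_j\}\cup\{\psi^{j,\ell}(S_\ell\cdot):\ r_j+1\le|\ell|\le s_j\}$$ (a family indexed by $\ell=-s_j,\dots,s_j$). Frequency-based affine shear system: $$\mathrm{FAS}(\varphi;\{\Psi_j\}_{j=0}^\infty)=\{\varphi_{0,k}:k\in\mathbb{Z}^2\}\cup\{h_{B_\lambda^j;0,k},\ h_{B_\lambda^jE;0,k}:\ k\in\mathbb{Z}^2,\ h\in\Psi_j\}_{j=0}^\infty .$$ It is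 a frequency-based affine shear tight frame for $L_2(\mathbb{R}^2)$ if all generators $\{\varphi\}\cup\bigcup_j\Psi_j$ are in $L_2(\mathbb{R}^2)$ and for all $f\in L_2(\mathbb{R}^2)$ $$(2\pi)^2\|f\|_2^2=\sum_{k\in\mathbb{Z}^2}|\langle f,\varphi_{0,k}\rangle|^2+\sum_{j=0}^\infty\sum_{h\in\Psi_j}\sum_{k\in\mathbb{Z}^2}\big(|\langle f,h_{B_\lambda^j;0,k}\rangle|^2+|\langle f,h_{B_\lambda^jE;0,k}\rangle|^2\big).$$ For $k\in\mathbb{Z}^2$: $\mathcal{I}_\varphi^k(\xi):=\overline{\varphi(\xi)}\varphi(\xi+2\pi k)$ and $\mathcal{I}_{\Psi_j}^k(\xi):=\sum_{\ell=-s_j}^{s_j}\overline{\psi^{j,\ell}(S_\ell\xi)}\,\psi^{j,\ell}(S_\ell(\xi+2\pi k))$. For $k\in\mathbb{R}^2\setminus\mathbb{Z}^2$: $\mathcal{I}_\varphi^k:=0$ and $\mathcal{I}_{\Psi_j}^k:=0$. *)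

theory Defs
  imports "HOL-Analysis.Analysis"
begin

definition mat_E :: "real^2^2" where
  "mat_E = vector [vector [0, 1], vector [1, 0]]"

definition mat_S :: "real \<Rightarrow> real^2^2" where
  "mat_S \<tau> = vector [vector [1, 0], vector [\<tau>, 1]]"

definition mat_A :: "real \<Rightarrow> real^2^2" where
  "mat_A lam = vector [vector [lam\<^sup>2, 0], vector [0, lam]]"

definition mat_B :: "real \<Rightarrow> real^2^2" where
  "mat_B lam = vector [vector [inverse (lam\<^sup>2), 0], vector [0, inverse lam]]"

lemma mat_A_mult_mat_B:
  assumes "lam \<noteq> 0"
  shows "mat_A lam ** mat_B lam = mat 1" "mat_B lam ** mat_A lam = mat 1"
  using assms
  by (simp_all add: mat_A_def mat_B_def vec_eq_iff forall_2 matrix_matrix_mult_def sum_2 mat_def)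

lemma mat_B_eq_matrix_inv:
  assumes "lam \<noteq> 0"
  shows "mat_B lam = matrix_inv (mat_A lam)"
proof -
  have "mat_A lam ** matrix_inv (mat_A lam) = mat 1 \<and> matrix_inv (mat_A lam) ** mat_A lam = mat 1"
    unfolding matrix_inv_def by (rule someI[where x = "mat_B lam"]) (simp add: mat_A_mult_mat_B[OF assms])
  then show ?thesis
    by (metis mat_A_mult_mat_B(1)[OF assms] matrix_mul_assoc matrix_mul_lid matrix_mul_rid)
qed

text \<open>The overloaded power on the type \<open>real^2^2\<close> is componentwise, hence a separate
  power with respect to the matrix product.\<close>

primrec mat_pow :: "real^2^2 \<Rightarrow> nat \<Rightarrow> real^2^2" where
  "mat_pow M 0 = mat 1"
| "mat_pow M (Suc n) = M ** mat_pow M n"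

definition int_lattice :: "(real^2) set" where
  "int_lattice = {k. \<forall>i. k $ i \<in> \<int>}"

definition L2_fun :: "(real^2 \<Rightarrow> complex) \<Rightarrow> bool" where
  "L2_fun f \<longleftrightarrow>
     f \<in> borel_measurable lebesgue \<and> integrable lebesgue (\<lambda>x. (cmod (f x))\<^sup>2)"

definition L2_loc :: "(real^2 \<Rightarrow> complex) \<Rightarrow> bool" where
  "L2_loc f \<longleftrightarrow>
     f \<in> borel_measurable lebesgue \<and>
     (\<forall>K. compact K \<longrightarrow> set_integrable lebesgue K (\<lambda>x. (cmod (f x))\<^sup>2))"

definition L2_inner :: "(real^2 \<Rightarrow> complex) \<Rightarrow> (real^2 \<Rightarrow> complex) \<Rightarrow> complex" where
  "L2_inner f g = (LINT x|lebesgue. f x * cnj (g x))"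

text \<open>The function \<open>f\<^bsub>U;0,k\<^esub>\<close>.\<close>

definition dil_mod ::
    "(real^2 \<Rightarrow> complex) \<Rightarrow> real^2^2 \<Rightarrow> real^2 \<Rightarrow> (real^2 \<Rightarrow> complex)" where
  "dil_mod f U k = (\<lambda>\<xi>. complex_of_real (sqrt \<bar>det U\<bar>) * f (U *v \<xi>) *
     exp (- (\<i> * complex_of_real (k \<bullet> (U *v \<xi>)))))"

text \<open>The family \<open>\<psi>\<^sup>j\<^sup>,\<^sup>l\<close>, extended by \<open>\<psi>\<close> to the indices \<open>\<bar>l\<bar> \<le> r\<^sub>j\<close>;
  the values of \<open>\<psi>'\<close> at those indices are ignored.\<close>

definition psi_ext ::
    "(nat \<Rightarrow> nat) \<Rightarrow> (real^2 \<Rightarrow> complex) \<Rightarrow> (nat \<Rightarrow> int \<Rightarrow> real^2 \<Rightarrow> complex) \<Rightarrow>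
     nat \<Rightarrow> int \<Rightarrow> (real^2 \<Rightarrow> complex)" where
  "psi_ext r \<psi> \<psi>' j l = (if \<bar>l\<bar> \<le> int (r j) then \<psi> else \<psi>' j l)"

text \<open>The set \<open>\<Psi>\<^sub>j\<close> is treated as a family indexed by \<open>l \<in> {-s\<^sub>j..s\<^sub>j}\<close>, so that
  coinciding members are counted with multiplicity.\<close>

definition shear_gen ::
    "(nat \<Rightarrow> nat) \<Rightarrow> (real^2 \<Rightarrow> complex) \<Rightarrow> (nat \<Rightarrow> int \<Rightarrow> real^2 \<Rightarrow> complex) \<Rightarrow>
     nat \<Rightarrow> int \<Rightarrow> (real^2 \<Rightarrow> complex)" where
  "shear_gen r \<psi> \<psi>' j l = (\<lambda>\<xi>. psi_ext r \<psi> \<psi>' j l (mat_S (of_int l) *v \<xi>))"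

text \<open>The sums of squares are taken in \<open>ennreal\<close>, so the frame identity includes the
  convergence of the series to a finite value.\<close>

definition FAS_tight_frame ::
    "real \<Rightarrow> (nat \<Rightarrow> nat) \<Rightarrow> (nat \<Rightarrow> nat) \<Rightarrow> (real^2 \<Rightarrow> complex) \<Rightarrow>
     (real^2 \<Rightarrow> complex) \<Rightarrow> (nat \<Rightarrow> int \<Rightarrow> real^2 \<Rightarrow> complex) \<Rightarrow> bool" where
  "FAS_tight_frame lam r s \<phi> \<psi> \<psi>' \<longleftrightarrow>
     L2_fun \<phi> \<and>
     (\<forall>j. \<forall>l\<in>{- int (s j)..int (s j)}. L2_fun (shear_gen r \<psi> \<psi>' j l)) \<and>
     (\<forall>f. L2_fun f \<longrightarrow>
        ennreal ((2 * pi)\<^sup>2 * (LINT x|lebesgue. (cmod (f x))\<^sup>2)) =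
        (\<Sum>\<^sub>\<infinity>k\<in>int_lattice. ennreal ((cmod (L2_inner f (dil_mod \<phi> (mat 1) k)))\<^sup>2)) +
        (\<Sum>j. \<Sum>l = - int (s j)..int (s j). \<Sum>\<^sub>\<infinity>k\<in>int_lattice.
           ennreal ((cmod (L2_inner f
              (dil_mod (shear_gen r \<psi> \<psi>' j l) (mat_pow (mat_B lam) j) k)))\<^sup>2) +
           ennreal ((cmod (L2_inner f
              (dil_mod (shear_gen r \<psi> \<psi>' j l) (mat_pow (mat_B lam) j ** mat_E) k)))\<^sup>2)))"

definition I_phi :: "(real^2 \<Rightarrow> complex) \<Rightarrow> real^2 \<Rightarrow> real^2 \<Rightarrow> complex" where
  "I_phi \<phi> k \<xi> =
     (if k \<in> int_lattice then cnj (\<phi> \<xi>) * \<phi> (\<xi> + (2 * pi) *\<^sub>R k) else 0)"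

definition I_Psi ::
    "(nat \<Rightarrow> nat) \<Rightarrow> (nat \<Rightarrow> nat) \<Rightarrow> (real^2 \<Rightarrow> complex) \<Rightarrow>
     (nat \<Rightarrow> int \<Rightarrow> real^2 \<Rightarrow> complex) \<Rightarrow> nat \<Rightarrow> real^2 \<Rightarrow> real^2 \<Rightarrow> complex" where
  "I_Psi r s \<psi> \<psi>' j k \<xi> =
     (if k \<in> int_lattice then
        (\<Sum>l = - int (s j)..int (s j).
           cnj (psi_ext r \<psi> \<psi>' j l (mat_S (of_int l) *v \<xi>)) *
           psi_ext r \<psi> \<psi>' j l (mat_S (of_int l) *v (\<xi> + (2 * pi) *\<^sub>R k)))
      else 0)"

definition shift_set :: "real \<Rightarrow> (real^2) set" where
  "shift_set lam =
     (\<Union>j. ((*v) (mat_pow (mat_A lam) j)) ` int_lattice \<union>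
           ((*v) (mat_E ** mat_pow (mat_A lam) j)) ` int_lattice)"

text \<open>The \<open>j\<close>-th summand, in square brackets, of the two characterizing identities.\<close>

definition I_bracket ::
    "real \<Rightarrow> (nat \<Rightarrow> nat) \<Rightarrow> (nat \<Rightarrow> nat) \<Rightarrow> (real^2 \<Rightarrow> complex) \<Rightarrow>
     (nat \<Rightarrow> int \<Rightarrow> real^2 \<Rightarrow> complex) \<Rightarrow> real^2 \<Rightarrow> real^2 \<Rightarrow> nat \<Rightarrow> complex" where
  "I_bracket lam r s \<psi> \<psi>' k \<xi> j =
     I_Psi r s \<psi> \<psi>' j (mat_pow (mat_B lam) j *v k) (mat_pow (mat_B lam) j *v \<xi>) +
     I_Psi r s \<psi> \<psi>' j ((mat_pow (mat_B lam) j ** mat_E) *v k)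
       ((mat_pow (mat_B lam) j ** mat_E) *v \<xi>)"

end

theory Submission
  imports Defs
begin

text \<open>Everything is tested on functions \<open>f\<close> that are bounded with bounded support. For one generator \<open>h\<close>
  and one invertible matrix \<open>U\<close>, Parseval's identity on the torus, applied to the periodisation of
  \<open>y \<mapsto> f (U\<^sup>-\<^sup>1 y) * cnj (h y)\<close>, turns the sum over all shifts \<open>k\<close> of the squared frame
  coefficients into
  \[ (2\pi)^2 \sum_\kappa \int f(x)\,\overline{f(x + 2\pi\kappa)}\;
     \overline{h(Ux)}\,h(U(x + 2\pi\kappa))\,dx , \]
  the sum running over the \<open>\<kappa>\<close> with \<open>U \<kappa>\<close> integral (\<open>dilated_shift_energy\<close>). For the matrices of
  the system these \<open>\<kappa>\<close> fill the shift set. Summing over all generators and scales, the function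
  multiplying \<open>f x * cnj (f (x + 2 \<pi> \<kappa>))\<close> is the left-hand side of the identity belonging to
  \<open>\<kappa>\<close>. A nonzero \<open>\<kappa>\<close> for which scale \<open>j\<close> contributes has norm at least \<open>lam ^ j\<close>; hence only
  finitely many scales see a given \<open>\<kappa>\<close>, only finitely many \<open>\<kappa>\<close> see a given \<open>f\<close>, and infinite
  sums occur only in the nonnegative term \<open>\<kappa> = 0\<close>, where no convergence question arises
  (\<open>frame_sum_identity\<close>).\<close>

text \<open>If the identities hold, the frame identity for test functions is immediate. It already forces the
  generators into \<open>L\<^sub>2\<close>, because a single frame coefficient is then a bounded functional of \<open>f\<close>, and it
  extends to all of \<open>L\<^sub>2\<close> because the frame sum is a lower semicontinuous quadratic functional
  (\<open>FAS_tight_frame_iff_frame_on_tests\<close>).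
  
  Conversely, the shift set is discrete. Test functions supported in a small ball only see \<open>\<kappa> = 0\<close>
  and yield the first identity. Test functions supported in a small ball and its translate by
  \<open>2 \<pi> \<kappa>\<close> only see \<open>0\<close>, \<open>\<kappa>\<close> and \<open>-\<kappa>\<close>, and varying a complex factor on the small ball separates the
  contributions of \<open>\<kappa>\<close> and \<open>-\<kappa>\<close> (\<open>offdiag_eq_0_if_frame\<close>).\<close>

section \<open>Affine changes of variables for Lebesgue measure\<close>

text \<open>Boxes determine \<open>lborel\<close>, and the preimage of a box is the image of a box under the inverse matrix,
  whose volume is known. Null sets correspond under the map, so the formula passes to the completion.\<close>

lemma
  fixes U :: "real^'n::{finite,wellorder}^'n::_" and t :: "real^'n::_"
  assumes "det U \<noteq> 0"
  shows lborel_matrix_affine: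
      "lborel = density (distr lborel borel (\<lambda>x. t + U *v x)) (\<lambda>_. ennreal \<bar>det U\<bar>)"
    and lebesgue_matrix_affine:
      "lebesgue = density (distr lebesgue lebesgue (\<lambda>x. t + U *v x)) (\<lambda>_. ennreal \<bar>det U\<bar>)"
    and measurable_matrix_affine: "(\<lambda>x. t + U *v x) \<in> lebesgue \<rightarrow>\<^sub>M lebesgue"
proof -
  define T where "T x = t + U *v x" for x
  obtain V where VU: "V ** U = mat 1" "U ** V = mat 1"
    using assms by (auto simp: invertible_det_nz[symmetric] invertible_def)
  have det: "det V * det U = 1"
    using VU(1) by (metis det_I det_mul)
  have T_borel[measurable]: "T \<in> borel \<rightarrow>\<^sub>M borel"
    unfolding T_def[abs_def]
    by (intro borel_measurable_continuous_onI continuous_intros linear_continuous_on)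
  have pre: "T -` A = (*v) V ` ((+) (- t) ` A)" for A
  proof (intro set_eqI iffI)
    fix x assume "x \<in> T -` A"
    then have "x = V *v (- t + T x)" "T x \<in> A"
      by (auto simp: T_def matrix_vector_mul_assoc VU)
    then show "x \<in> (*v) V ` ((+) (- t) ` A)" by blast
  next
    fix x assume "x \<in> (*v) V ` ((+) (- t) ` A)"
    then show "x \<in> T -` A"
      by (auto simp: T_def matrix_vector_mul_assoc VU)
  qed
  show lb: "lborel = density (distr lborel borel (\<lambda>x. t + U *v x)) (\<lambda>_. ennreal \<bar>det U\<bar>)"
    unfolding T_def[symmetric]
  proof (rule lborel_eqI)
    fix l u :: "real^'n::_" assume le: "\<And>b. b \<in> Basis \<Longrightarrow> l \<bullet> b \<le> u \<bullet> b"
    have bl: "(+) (-t) ` box l u \<in> lmeasurable"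
      by (metis lmeasurable_box measurable_translation)
    have "measure lebesgue (T -` box l u) = \<bar>det V\<bar> * measure lebesgue ((+) (-t) ` box l u)"
      unfolding pre using measure_linear_image[OF matrix_vector_mul_linear[of V] bl] by simp
    also have "measure lebesgue ((+) (-t) ` box l u) = measure lebesgue (box l u)"
      by (rule measure_translation)
    finally have m: "measure lebesgue (T -` box l u) = \<bar>det V\<bar> * measure lebesgue (box l u)" .
    have "T -` box l u \<in> lmeasurable"
      unfolding pre using measurable_linear_image[OF matrix_vector_mul_linear[of V] bl] by simp
    then have e: "emeasure lebesgue (T -` box l u) = ennreal (\<bar>det V\<bar> * measure lebesgue (box l u))"
      using m by (metis emeasure_eq_measure2)
    have [measurable]: "T -` box l u \<in> sets borel"
      using measurable_sets[OF T_borel, of "box l u"] by simp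
    have "emeasure (density (distr lborel borel T) (\<lambda>_. ennreal \<bar>det U\<bar>)) (box l u)
       = ennreal \<bar>det U\<bar> * emeasure lborel (T -` box l u)"
      by (simp add: emeasure_density nn_integral_cmult emeasure_distr)
    also have "emeasure lborel (T -` box l u) = ennreal (\<bar>det V\<bar> * measure lebesgue (box l u))"
      using e by simp
    also have "ennreal \<bar>det U\<bar> * \<dots> = measure lborel (box l u)"
      using det by (simp flip: ennreal_mult' add: abs_mult mult.assoc[symmetric])
         (metis abs_mult abs_one mult.commute mult_1)
    also have "\<dots> = (\<Prod>b\<in>Basis. (u - l) \<bullet> b)"
      using le by (simp add: measure_lborel_box_eq inner_diff_left)
    finally show "emeasure (density (distr lborel borel T) (\<lambda>_. ennreal \<bar>det U\<bar>)) (box l u) =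
      (\<Prod>b\<in>Basis. (u - l) \<bullet> b)" .
  qed simp
  { fix A :: "(real^'n::_) set" assume A: "A \<in> sets borel"
    have "emeasure lborel A = 0 \<longleftrightarrow> emeasure (density (distr lborel borel T) (\<lambda>_. ennreal \<bar>det U\<bar>)) A = 0"
      unfolding T_def by (rule arg_cong[OF lb, where f = "\<lambda>M. emeasure M A = 0"])
    also have "\<dots> \<longleftrightarrow> emeasure (distr lebesgue lborel T) A = 0"
      using A assms by (simp add: distr_completion emeasure_density nn_integral_cmult cong: distr_cong)
    finally have "emeasure lborel A = 0 \<longleftrightarrow> emeasure (distr lebesgue lborel T) A = 0" . }
  then have eq: "null_sets lborel = null_sets (distr lebesgue lborel T)"
    by (auto simp: null_sets_def)
  have "T \<in> lebesgue \<rightarrow>\<^sub>M lebesgue"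
    by (simp add: completion.measurable_completion2 eq measurable_completion)
  then show "(\<lambda>x. t + U *v x) \<in> lebesgue \<rightarrow>\<^sub>M lebesgue" by (simp add: T_def[abs_def])
  have "lebesgue = completion (density (distr lborel borel T) (\<lambda>_. ennreal \<bar>det U\<bar>))"
    unfolding T_def by (rule arg_cong[OF lb])
  also have "\<dots> = density (completion (distr lebesgue lborel T)) (\<lambda>_. ennreal \<bar>det U\<bar>)"
    using assms by (auto intro!: always_eventually completion_density_eq simp: distr_completion cong: distr_cong)
  also have "\<dots> = density (distr lebesgue lebesgue T) (\<lambda>_. ennreal \<bar>det U\<bar>)"
    by (subst completion.completion_distr_eq) (auto simp: eq measurable_completion)
  finally show "lebesgue = density (distr lebesgue lebesgue (\<lambda>x. t + U *v x)) (\<lambda>_. ennreal \<bar>det U\<bar>)"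
    by (simp add: T_def[abs_def])
qed

lemma
  fixes U :: "real^'n::{finite,wellorder}^'n::_" and t :: "real^'n::_"
    and f :: "real^'n::_ \<Rightarrow> 'b::{banach,second_countable_topology}"
  assumes U: "det U \<noteq> 0" and f: "f \<in> borel_measurable lebesgue"
  shows borel_measurable_matrix_affine: "(\<lambda>x. f (t + U *v x)) \<in> borel_measurable lebesgue"
    and integral_matrix_affine:
      "integral\<^sup>L lebesgue f = \<bar>det U\<bar> *\<^sub>R (LINT x|lebesgue. f (t + U *v x))"
    and integrable_matrix_affine_iff:
      "integrable lebesgue (\<lambda>x. f (t + U *v x)) \<longleftrightarrow> integrable lebesgue f"
proof -
  note T = measurable_matrix_affine[OF U, of t]
  show *: "(\<lambda>x. f (t + U *v x)) \<in> borel_measurable lebesgue"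
    using measurable_compose[OF T f] .
  have f': "f \<in> borel_measurable (distr lebesgue lebesgue (\<lambda>x. t + U *v x))"
    using f by simp
  show "integral\<^sup>L lebesgue f = \<bar>det U\<bar> *\<^sub>R (LINT x|lebesgue. f (t + U *v x))"
    by (subst lebesgue_matrix_affine[OF U, of t], subst integral_density)
      (use f T in \<open>simp_all add: integral_distr\<close>)
  show "integrable lebesgue (\<lambda>x. f (t + U *v x)) \<longleftrightarrow> integrable lebesgue f"
  proof -
    have "integrable lebesgue f \<longleftrightarrow> integrable (density (distr lebesgue lebesgue (\<lambda>x. t + U *v x)) (\<lambda>_. ennreal \<bar>det U\<bar>)) f"
      by (rule arg_cong[OF lebesgue_matrix_affine[OF U, of t], where f = "\<lambda>M. integrable M f"])
    also have "\<dots> \<longleftrightarrow> integrable (distr lebesgue lebesgue (\<lambda>x. t + U *v x)) (\<lambda>x. \<bar>det U\<bar> *\<^sub>R f x)"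
      by (rule integrable_density) (use f in simp_all)
    also have "\<dots> \<longleftrightarrow> integrable lebesgue (\<lambda>x. \<bar>det U\<bar> *\<^sub>R f (t + U *v x))"
      by (rule integrable_distr_eq) (use f T in simp_all)
    also have "\<dots> \<longleftrightarrow> integrable lebesgue (\<lambda>x. f (t + U *v x))"
      using U integrable_scaleR_right[of "inverse \<bar>det U\<bar>" lebesgue "\<lambda>x. \<bar>det U\<bar> *\<^sub>R f (t + U *v x)"]
      by auto
    finally show ?thesis ..
  qed
qed

lemma
  fixes t :: "real^'n::{finite,wellorder}" and f :: "real^'n::_ \<Rightarrow> 'b::{banach,second_countable_topology}"
  assumes f: "f \<in> borel_measurable lebesgue"
  shows borel_measurable_translate: "(\<lambda>x. f (x + t)) \<in> borel_measurable lebesgue"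
    and integral_translate: "(LINT x|lebesgue. f (x + t)) = integral\<^sup>L lebesgue f"
    and integrable_translate_iff: "integrable lebesgue (\<lambda>x. f (x + t)) \<longleftrightarrow> integrable lebesgue f"
  using borel_measurable_matrix_affine[of "mat 1" f t] integral_matrix_affine[of "mat 1" f t]
    integrable_matrix_affine_iff[of "mat 1" f t] f
  by (simp_all add: add.commute)

text \<open>Image measures on other spaces integrate Borel functions, so a Lebesgue measurable function has to be
  replaced by a Borel one before it is transported.\<close>

lemma borel_representative:
  fixes g :: "'a::euclidean_space \<Rightarrow> complex"
  assumes "g \<in> borel_measurable lebesgue"
  obtains g' where "g' \<in> borel_measurable borel" "AE x in lebesgue. g x = g' x"
proof -
  obtain a where a: "a \<in> borel_measurable lborel" "AE x in lborel. Re (g x) = a x"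
    using completion_ex_borel_measurable_real[of "\<lambda>x. Re (g x)" lborel] assms by auto
  obtain b where b: "b \<in> borel_measurable lborel" "AE x in lborel. Im (g x) = b x"
    using completion_ex_borel_measurable_real[of "\<lambda>x. Im (g x)" lborel] assms by auto
  show ?thesis
  proof
    show "(\<lambda>x. Complex (a x) (b x)) \<in> borel_measurable borel"
      using a b by (simp add: borel_measurable_complex_iff)
    show "AE x in lebesgue. g x = Complex (a x) (b x)"
      using AE_completion[OF a(2)] AE_completion[OF b(2)] by eventually_elim (simp add: complex_eq_iff)
  qed
qed

section \<open>Density of polynomials in L2 of a compactly supported measure\<close>

text \<open>The squared \<open>L\<^sub>2\<close> distance takes values in \<open>ennreal\<close>, so that no integrability has to be carried along.\<close>

definition sqdist :: "'a measure \<Rightarrow> ('a \<Rightarrow> complex) \<Rightarrow> ('a \<Rightarrow> complex) \<Rightarrow> ennreal" where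
  "sqdist M f g = (\<integral>\<^sup>+x. ennreal ((cmod (f x - g x))\<^sup>2) \<partial>M)"

lemma sqdist_triangle:
  assumes [measurable]: "f \<in> borel_measurable M" "g \<in> borel_measurable M" "h \<in> borel_measurable M"
  shows "sqdist M f h \<le> 2 * sqdist M f g + 2 * sqdist M g h"
proof -
  have *: "(cmod (f x - h x))\<^sup>2 \<le> 2 * (cmod (f x - g x))\<^sup>2 + 2 * (cmod (g x - h x))\<^sup>2" for x
  proof -
    have "cmod (f x - h x) \<le> cmod (f x - g x) + cmod (g x - h x)"
      by (metis diff_add_cancel add_diff_eq norm_triangle_ineq)
    then have "(cmod (f x - h x))\<^sup>2 \<le> (cmod (f x - g x) + cmod (g x - h x))\<^sup>2"
      by (simp add: power_mono)
    also have "\<dots> \<le> 2 * (cmod (f x - g x))\<^sup>2 + 2 * (cmod (g x - h x))\<^sup>2"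
      using sum_squares_bound[of "cmod (f x - g x)" "cmod (g x - h x)"]
      by (simp add: power2_sum)
    finally show ?thesis .
  qed
  have "sqdist M f h \<le> (\<integral>\<^sup>+x. 2 * ennreal ((cmod (f x - g x))\<^sup>2) + 2 * ennreal ((cmod (g x - h x))\<^sup>2) \<partial>M)"
    unfolding sqdist_def
  proof (rule nn_integral_mono)
    fix x
    show "ennreal ((cmod (f x - h x))\<^sup>2)
        \<le> 2 * ennreal ((cmod (f x - g x))\<^sup>2) + 2 * ennreal ((cmod (g x - h x))\<^sup>2)"
      using ennreal_leI[OF *[of x]] by (simp add: ennreal_plus ennreal_mult)
  qed
  also have "\<dots> = 2 * sqdist M f g + 2 * sqdist M g h"
    unfolding sqdist_def by (simp add: nn_integral_add nn_integral_cmult)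
  finally show ?thesis .
qed

lemma ennreal_four_quarters:
  assumes "a < ennreal (\<epsilon>/4)" "b < ennreal (\<epsilon>/4)" "\<epsilon> > 0"
  shows "2 * a + 2 * b < ennreal \<epsilon>"
proof -
  obtain a' where a: "a = ennreal a'" "0 \<le> a'" using assms(1) by (cases a) auto
  obtain b' where b: "b = ennreal b'" "0 \<le> b'" using assms(2) by (cases b) auto
  have "2 * a + 2 * b = ennreal (2 * a' + 2 * b')"
    using a b by (simp add: ennreal_plus ennreal_mult)
  moreover have "2 * a' + 2 * b' < \<epsilon>"
    using assms a b by (simp add: ennreal_less_iff)
  ultimately show ?thesis
    by (simp only: ennreal_lessI assms(3))
qed

definition L2_closure :: "'a measure \<Rightarrow> ('a \<Rightarrow> complex) set \<Rightarrow> ('a \<Rightarrow> complex) set" where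
  "L2_closure M P = {h \<in> borel_measurable M. \<forall>\<epsilon>>0. \<exists>p\<in>P. sqdist M h p < ennreal \<epsilon>}"

lemma L2_closure_limit:
  assumes h: "h \<in> borel_measurable M" and P: "P \<subseteq> borel_measurable M"
    and s: "\<And>\<epsilon>. \<epsilon> > 0 \<Longrightarrow> \<exists>g\<in>L2_closure M P. sqdist M h g < ennreal \<epsilon>"
  shows "h \<in> L2_closure M P"
  unfolding L2_closure_def
proof (intro CollectI conjI h allI impI)
  fix \<epsilon> :: real assume \<epsilon>: "\<epsilon> > 0"
  obtain g where g: "g \<in> L2_closure M P" "sqdist M h g < ennreal (\<epsilon>/4)"
    using s[of "\<epsilon>/4"] \<epsilon> by auto
  then obtain p where p: "p \<in> P" "sqdist M g p < ennreal (\<epsilon>/4)"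
    using \<epsilon> unfolding L2_closure_def by (force dest!: spec[of _ "\<epsilon>/4"])
  have "sqdist M h p \<le> 2 * sqdist M h g + 2 * sqdist M g p"
    using g p P h by (intro sqdist_triangle) (auto simp: L2_closure_def)
  also have "\<dots> < ennreal \<epsilon>"
    using g(2) p(2) \<epsilon> by (rule ennreal_four_quarters)
  finally show "\<exists>p\<in>P. sqdist M h p < ennreal \<epsilon>" using p by blast
qed

lemma L2_closure_add:
  assumes P: "P \<subseteq> borel_measurable M" "\<And>p q. p \<in> P \<Longrightarrow> q \<in> P \<Longrightarrow> (\<lambda>x. p x + q x) \<in> P"
    and fg: "f \<in> L2_closure M P" "g \<in> L2_closure M P"
  shows "(\<lambda>x. f x + g x) \<in> L2_closure M P"
  unfolding L2_closure_def
proof (intro CollectI conjI allI impI)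
  have [measurable]: "f \<in> borel_measurable M" "g \<in> borel_measurable M"
    using fg by (auto simp: L2_closure_def)
  show "(\<lambda>x. f x + g x) \<in> borel_measurable M" by simp
  fix \<epsilon> :: real assume \<epsilon>: "\<epsilon> > 0"
  obtain p where p: "p \<in> P" "sqdist M f p < ennreal (\<epsilon>/4)"
    using fg(1) \<epsilon> unfolding L2_closure_def by (force dest!: spec[of _ "\<epsilon>/4"])
  obtain q where q: "q \<in> P" "sqdist M g q < ennreal (\<epsilon>/4)"
    using fg(2) \<epsilon> unfolding L2_closure_def by (force dest!: spec[of _ "\<epsilon>/4"])
  have [measurable]: "p \<in> borel_measurable M" "q \<in> borel_measurable M"
    using p q P by auto
  have "sqdist M (\<lambda>x. f x + g x) (\<lambda>x. p x + q x)
      \<le> 2 * sqdist M (\<lambda>x. f x + g x) (\<lambda>x. p x + g x) + 2 * sqdist M (\<lambda>x. p x + g x) (\<lambda>x. p x + q x)"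
    by (rule sqdist_triangle) simp_all
  also have "\<dots> = 2 * sqdist M f p + 2 * sqdist M g q"
    by (simp add: sqdist_def)
  also have "\<dots> < ennreal \<epsilon>"
    using p(2) q(2) \<epsilon> by (rule ennreal_four_quarters)
  finally show "\<exists>p\<in>P. sqdist M (\<lambda>x. f x + g x) p < ennreal \<epsilon>" using p q P(2) by blast
qed

lemma L2_closure_scale:
  assumes P: "P \<subseteq> borel_measurable M" "\<And>c p. p \<in> P \<Longrightarrow> (\<lambda>x. c * p x) \<in> P"
    and f: "f \<in> L2_closure M P"
  shows "(\<lambda>x. c * f x) \<in> L2_closure M P"
  unfolding L2_closure_def
proof (intro CollectI conjI allI impI)
  have [measurable]: "f \<in> borel_measurable M" using f by (auto simp: L2_closure_def)
  show "(\<lambda>x. c * f x) \<in> borel_measurable M" by simp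
  fix \<epsilon> :: real assume \<epsilon>: "\<epsilon> > 0"
  \<comment> \<open>The summand 1 avoids a division by zero.\<close>
  define \<delta> where "\<delta> = \<epsilon> / ((cmod c)\<^sup>2 + 1)"
  have pos: "(cmod c)\<^sup>2 + 1 > 0" by (simp add: add_nonneg_pos)
  have \<delta>: "\<delta> > 0" using \<epsilon> pos by (simp add: \<delta>_def)
  have "(cmod c)\<^sup>2 * \<delta> < \<epsilon>"
    using \<epsilon> pos by (simp add: \<delta>_def field_simps)
  obtain p where p: "p \<in> P" "sqdist M f p < ennreal \<delta>"
    using f \<delta> unfolding L2_closure_def by blast
  have [measurable]: "p \<in> borel_measurable M" using p P by auto
  have "sqdist M (\<lambda>x. c * f x) (\<lambda>x. c * p x) = ennreal ((cmod c)\<^sup>2) * sqdist M f p"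
    unfolding sqdist_def
    by (subst nn_integral_cmult[symmetric])
       (auto simp: norm_mult power_mult_distrib ennreal_mult simp flip: right_diff_distrib)
  also have "\<dots> \<le> ennreal ((cmod c)\<^sup>2) * ennreal \<delta>"
    using p(2) by (intro mult_left_mono) auto
  also have "\<dots> < ennreal \<epsilon>"
    using \<open>(cmod c)\<^sup>2 * \<delta> < \<epsilon>\<close> \<epsilon> \<delta> by (simp flip: ennreal_mult add: ennreal_lessI)
  finally show "\<exists>p\<in>P. sqdist M (\<lambda>x. c * f x) p < ennreal \<epsilon>" using p(1) P(2) by blast
qed

definition complex_polys :: "('a::euclidean_space \<Rightarrow> complex) set" where
  "complex_polys = {p. polynomial_function p}"

text \<open>By regularity the set lies between a compact set \<open>C\<close> and an open set \<open>U\<close> of nearly the same measure.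
  An Urysohn function for \<open>C\<close> and the complement of \<open>U\<close> is \<open>L\<^sub>2\<close> close to the indicator, and on the
  compact carrier of the measure it is uniformly close to a polynomial.\<close>

lemma complex_polys_indicator:
  fixes M :: "'a::euclidean_space measure"
  assumes M: "finite_measure M" "sets M = sets borel"
    and K: "compact K" "emeasure M (- K) = 0" and B: "B \<in> sets borel"
  shows "(\<lambda>x. indicator B x :: complex) \<in> L2_closure M complex_polys"
  unfolding L2_closure_def
proof (intro CollectI conjI allI impI)
  interpret finite_measure M by fact
  have sp: "space M = UNIV" using M(2) by (metis sets_eq_imp_space_eq space_borel)
  note [measurable_cong] = M(2)
  have [measurable]: "B \<in> sets borel" by fact
  show "(\<lambda>x. indicator B x :: complex) \<in> borel_measurable M" by measurable
  fix \<epsilon> :: real assume \<epsilon>: "\<epsilon> > 0"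
  define \<delta> where "\<delta> = \<epsilon> / (8 * (measure M UNIV + 1))"
  have pos: "measure M UNIV + 1 > 0" by (simp add: add_nonneg_pos)
  have \<delta>: "\<delta> > 0" using \<epsilon> pos by (simp add: \<delta>_def)
  have B\<delta>: "emeasure M B < \<infinity>" by (simp add: emeasure_eq_measure)
  obtain C where C: "C \<subseteq> B" "compact C" "emeasure M B < emeasure M C + ennreal (\<epsilon>/16)"
  proof (cases "emeasure M B = 0")
    case True
    then show ?thesis using that[of "{}"] \<epsilon> by simp
  next
    case False
    then have "emeasure M B - ennreal (\<epsilon>/16) < emeasure M B"
      using \<epsilon> B\<delta> by (intro ennreal_between) (auto simp: zero_less_iff_neq_zero)
    then have "emeasure M B - ennreal (\<epsilon>/16) < (SUP K \<in> {K. K \<subseteq> B \<and> compact K}. emeasure M K)"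
      using inner_regular[OF M(2) _ B] sp emeasure_finite by simp
    then obtain C where C: "C \<subseteq> B" "compact C" "emeasure M B - ennreal (\<epsilon>/16) < emeasure M C"
      by (auto simp: less_SUP_iff)
    have "emeasure M B < emeasure M C + ennreal (\<epsilon>/16)"
    proof -
      have "ennreal (measure M B - \<epsilon>/16) < ennreal (measure M C)"
        using C(3) \<epsilon> by (simp add: emeasure_eq_measure ennreal_minus)
      then have "measure M B - \<epsilon>/16 < measure M C"
        by (metis ennreal_leI not_less)
      then show ?thesis
        using \<epsilon> by (simp add: emeasure_eq_measure ennreal_lessI add_nonneg_pos flip: ennreal_plus)
    qed
    with C show ?thesis using that by blast
  qed
  obtain U where U: "B \<subseteq> U" "open U" "emeasure M U < emeasure M B + ennreal (\<epsilon>/16)"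
  proof -
    have "emeasure M B < emeasure M B + ennreal (\<epsilon>/16)"
      using \<epsilon> by (simp add: emeasure_eq_measure ennreal_lessI add_nonneg_pos flip: ennreal_plus)
    then have "(INF U \<in> {U. B \<subseteq> U \<and> open U}. emeasure M U) < emeasure M B + ennreal (\<epsilon>/16)"
      using outer_regular[OF M(2) _ B] sp emeasure_finite by simp
    then show ?thesis using that by (auto simp: INF_less_iff)
  qed
  have [measurable]: "C \<in> sets borel" "U \<in> sets borel"
    using C U by (auto simp: borel_compact)
  have "measure M B < measure M C + \<epsilon>/16" "measure M U < measure M B + \<epsilon>/16"
    using C(3) U(3) \<epsilon> by (simp_all add: emeasure_eq_measure ennreal_less_iff flip: ennreal_plus)
  then have UC: "measure M (U - C) < \<epsilon>/8"
    using C(1) U(1) by (subst finite_measure_Diff) (auto simp: M(2))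
  obtain f :: "'a \<Rightarrow> complex" where f: "continuous_on UNIV f"
      "\<And>x. f x \<in> closed_segment 1 0" "\<And>x. x \<in> C \<Longrightarrow> f x = 1" "\<And>x. x \<in> - U \<Longrightarrow> f x = 0"
    using Urysohn[of C "- U" "1::complex" 0] C U by (auto simp: compact_imp_closed)
  have [measurable]: "f \<in> borel_measurable borel" by (rule borel_measurable_continuous_onI[OF f(1)])
  obtain p where p: "polynomial_function p" "\<And>x. x \<in> K \<Longrightarrow> cmod (f x - p x) < min 1 \<delta>"
    using Stone_Weierstrass_polynomial_function[OF K(1) continuous_on_subset[OF f(1) subset_UNIV], of "min 1 \<delta>"] \<delta>
    by auto
  have [measurable]: "p \<in> borel_measurable borel"
    by (rule borel_measurable_continuous_onI) (rule continuous_on_polymonial_function[OF p(1)])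
  have "sqdist M (indicator B) p \<le> 2 * sqdist M (indicator B) f + 2 * sqdist M f p"
    by (rule sqdist_triangle) measurable
  also have "sqdist M (indicator B) f \<le> (\<integral>\<^sup>+x. indicator (U - C) x \<partial>M)"
    unfolding sqdist_def
  proof (rule nn_integral_mono)
    fix x
    have seg: "cmod (indicator B x - f x) \<le> 1"
    proof -
      obtain u where "0 \<le> u" "u \<le> 1" "f x = of_real (1 - u)"
        using f(2)[of x] by (auto simp: closed_segment_def scaleR_conv_of_real)
      then have "cmod (f x) = 1 - u" "cmod (1 - f x) = u"
        by (metis abs_of_nonneg diff_ge_0_iff_ge norm_of_real, simp)
      then show ?thesis
        using \<open>0 \<le> u\<close> \<open>u \<le> 1\<close> by (cases "x \<in> B") auto
    qed
    have "(cmod (indicator B x - f x))\<^sup>2 \<le> indicator (U - C) x"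
      using f(3,4)[of x] C(1) U(1) power_mono[OF seg, of 2] by (auto simp: indicator_def split: if_splits)
    then show "ennreal ((cmod (indicator B x - f x))\<^sup>2) \<le> indicator (U - C) x"
      using ennreal_leI[of _ "indicator (U - C) x"] by (metis ennreal_indicator)
  qed
  also have "\<dots> = ennreal (measure M (U - C))"
    by (simp add: emeasure_eq_measure)
  also have "\<dots> \<le> ennreal (\<epsilon>/8)" using UC by (intro ennreal_leI) simp
  also have "sqdist M f p \<le> (\<integral>\<^sup>+x. ennreal \<delta> \<partial>M)"
    unfolding sqdist_def
  proof (rule nn_integral_mono_AE)
    have "- K \<in> sets M"
      using borel_open[of "- K"] compact_imp_closed[OF K(1)] by (simp add: M(2) open_Compl)
    then have "AE x in M. x \<in> K" using K(2) by (intro AE_I[where N = "- K"]) auto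
    then show "AE x in M. ennreal ((cmod (f x - p x))\<^sup>2) \<le> ennreal \<delta>"
    proof eventually_elim
      case (elim x)
      have "(cmod (f x - p x))\<^sup>2 \<le> cmod (f x - p x) * 1"
        unfolding power2_eq_square using p(2)[OF elim] by (intro mult_left_mono) auto
      also have "\<dots> \<le> \<delta>" using p(2)[OF elim] by simp
      finally show ?case by (rule ennreal_leI)
    qed
  qed
  also have "\<dots> = ennreal (\<delta> * measure M UNIV)"
    using \<delta> by (simp add: sp emeasure_eq_measure ennreal_mult)
  also have "\<dots> \<le> ennreal (\<epsilon>/8)"
    using \<epsilon> pos by (intro ennreal_leI) (simp add: \<delta>_def field_simps)
  finally have "sqdist M (indicator B) p \<le> 2 * ennreal (\<epsilon>/8) + 2 * ennreal (\<epsilon>/8)"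
    by (auto simp: mult_left_mono add_mono)
  also have "\<dots> = ennreal (\<epsilon>/2)"
    using \<epsilon> by (simp flip: ennreal_plus ennreal_numeral ennreal_mult)
  also have "\<dots> < ennreal \<epsilon>" using \<epsilon> by (simp add: ennreal_lessI)
  finally show "\<exists>p\<in>complex_polys. sqdist M (indicator B) p < ennreal \<epsilon>"
    using p(1) by (auto simp: complex_polys_def)
qed

text \<open>Simple functions are combinations of indicators, and \<open>h\<close> is a dominated limit of simple functions.\<close>

proposition complex_polys_dense_L2:
  fixes M :: "'a::euclidean_space measure"
  assumes M: "finite_measure M" "sets M = sets borel"
    and K: "compact K" "emeasure M (- K) = 0"
    and h: "h \<in> borel_measurable borel" and int: "integrable M (\<lambda>x. (cmod (h x))\<^sup>2)"
  shows "h \<in> L2_closure M complex_polys"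
proof -
  interpret finite_measure M by fact
  have sp: "space M = UNIV" using M(2) by (metis sets_eq_imp_space_eq space_borel)
  note [measurable_cong] = M(2)
  have [measurable]: "h \<in> borel_measurable M" using h by measurable
  have P: "complex_polys \<subseteq> borel_measurable M"
    by (auto simp: complex_polys_def measurable_cong_sets[OF M(2) refl]
        intro!: borel_measurable_continuous_onI continuous_on_polymonial_function)
  have P_add: "(\<lambda>x. p x + q x) \<in> complex_polys" if "p \<in> complex_polys" "q \<in> complex_polys"
    for p q :: "'a \<Rightarrow> complex"
    using that by (auto simp: complex_polys_def)
  have P_scale: "(\<lambda>x. c * p x) \<in> complex_polys" if "p \<in> complex_polys" for p :: "'a \<Rightarrow> complex" and c
  proof -
    have "polynomial_function ((\<lambda>z. c * z) \<circ> p)"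
        using that by (intro polynomial_function_compose)
        (auto simp: complex_polys_def bounded_linear_mult_right intro: polynomial_function_bounded_linear)
    then show ?thesis by (simp add: complex_polys_def o_def)
  qed
  obtain s where s: "\<And>i. simple_function M (s i)" "\<And>x. (\<lambda>i. s i x) \<longlonglongrightarrow> h x"
      "\<And>i x. cmod (s i x) \<le> 2 * cmod (h x)"
    using borel_measurable_implies_sequence_metric[of h M 0] sp by (auto simp: dist_norm)
  have [measurable]: "s i \<in> borel_measurable M" for i
    using s(1) by (rule borel_measurable_simple_function)
  have simp_in: "s i \<in> L2_closure M complex_polys" for i
  proof -
    have fin: "finite (range (s i))" using s(1)[of i] sp by (simp add: simple_function_def)
    have "(\<lambda>x. \<Sum>y\<in>F. y * indicator (s i -` {y}) x) \<in> L2_closure M complex_polys"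
      if "finite F" for F
      using that
    proof (induction F)
      case empty
      show ?case
        using complex_polys_indicator[OF M K, of "{}"] by simp
    next
      case (insert y F)
      have "s i -` {y} \<in> sets borel"
        using simple_functionD(2)[OF s(1), of i "{y}"] sp M(2) by simp
      then have "(\<lambda>x. y * indicator (s i -` {y}) x) \<in> L2_closure M complex_polys"
        by (intro L2_closure_scale P P_scale complex_polys_indicator[OF M K])
      then have "(\<lambda>x. y * indicator (s i -` {y}) x + (\<Sum>y\<in>F. y * indicator (s i -` {y}) x))
          \<in> L2_closure M complex_polys"
        by (intro L2_closure_add P P_add insert.IH)
      moreover have "(\<lambda>x. y * indicator (s i -` {y}) x + (\<Sum>y\<in>F. y * indicator (s i -` {y}) x))
          = (\<lambda>x. \<Sum>y\<in>insert y F. y * indicator (s i -` {y}) x)"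
        by (rule ext, rule sum.insert[symmetric]) (use insert.hyps in auto)
      ultimately show ?case by metis
    qed
    note this[OF fin]
    also have "(\<lambda>x. \<Sum>y\<in>range (s i). y * indicator (s i -` {y}) x) = s i"
    proof
      fix x
      have "(\<Sum>y\<in>range (s i). y * indicator (s i -` {y}) x) = (\<Sum>y\<in>range (s i). if y = s i x then y else 0)"
        by (intro sum.cong) (auto simp: indicator_def)
      also have "\<dots> = s i x" using fin by simp
      finally show "(\<Sum>y\<in>range (s i). y * indicator (s i -` {y}) x) = s i x" .
    qed
    finally show ?thesis .
  qed
  have "(\<lambda>i. \<integral>\<^sup>+x. ennreal ((cmod (h x - s i x))\<^sup>2) \<partial>M) \<longlonglongrightarrow> (\<integral>\<^sup>+x. 0 \<partial>M)"
  proof (rule nn_integral_dominated_convergence[where w = "\<lambda>x. ennreal (9 * (cmod (h x))\<^sup>2)"])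
    \<comment> \<open>The approximations are bounded by twice the norm of h, so the errors are bounded by three times it.\<close>
    show "(\<integral>\<^sup>+x. ennreal (9 * (cmod (h x))\<^sup>2) \<partial>M) < \<infinity>"
      using integrableD(2)[of M "\<lambda>x. 9 * (cmod (h x))\<^sup>2"] int by (simp add: less_top)
    show "AE x in M. ennreal ((cmod (h x - s i x))\<^sup>2) \<le> ennreal (9 * (cmod (h x))\<^sup>2)" for i
    proof (intro AE_I2 ennreal_leI)
      fix x
      have "cmod (h x - s i x) \<le> 3 * cmod (h x)"
        using norm_triangle_ineq4[of "h x" "s i x"] s(3)[of i x] by simp
      then show "(cmod (h x - s i x))\<^sup>2 \<le> 9 * (cmod (h x))\<^sup>2"
        using power_mono[of "cmod (h x - s i x)" "3 * cmod (h x)" 2] by (simp add: power_mult_distrib)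
    qed
    show "AE x in M. (\<lambda>i. ennreal ((cmod (h x - s i x))\<^sup>2)) \<longlonglongrightarrow> 0"
    proof (intro AE_I2)
      fix x
      have "(\<lambda>i. (cmod (h x - s i x))\<^sup>2) \<longlonglongrightarrow> (cmod (h x - h x))\<^sup>2"
        by (intro tendsto_intros s(2))
      then show "(\<lambda>i. ennreal ((cmod (h x - s i x))\<^sup>2)) \<longlonglongrightarrow> 0"
        using tendsto_ennrealI by fastforce
    qed
  qed measurable
  then have lim: "(\<lambda>i. sqdist M h (s i)) \<longlonglongrightarrow> 0" by (simp add: sqdist_def)
  show ?thesis
  proof (rule L2_closure_limit[OF _ P])
    fix \<epsilon> :: real assume "\<epsilon> > 0"
    then have "eventually (\<lambda>i. sqdist M h (s i) < ennreal \<epsilon>) sequentially"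
      by (intro order_tendstoD(2)[OF lim]) simp
    then obtain i where "sqdist M h (s i) < ennreal \<epsilon>" by (auto simp: eventually_sequentially)
    then show "\<exists>g\<in>L2_closure M complex_polys. sqdist M h g < ennreal \<epsilon>" using simp_in by blast
  qed simp
qed

section \<open>The torus and its characters\<close>

text \<open>Half-open, so that the translates by \<open>2 \<pi> n\<close> tile the plane without overlap.\<close>

definition cell :: "(real^2) set" where
  "cell = {x. \<forall>i. - pi < x $ i \<and> x $ i \<le> pi}"

lemma int_lattice_add: "m \<in> int_lattice \<Longrightarrow> n \<in> int_lattice \<Longrightarrow> m + n \<in> int_lattice"
  and int_lattice_diff: "m \<in> int_lattice \<Longrightarrow> n \<in> int_lattice \<Longrightarrow> m - n \<in> int_lattice"
  and int_lattice_minus: "m \<in> int_lattice \<Longrightarrow> - m \<in> int_lattice"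
  and int_lattice_0: "0 \<in> int_lattice"
  by (auto simp: int_lattice_def)

lemma finite_int_lattice_Int_bounded:
  assumes "bounded S"
  shows "finite (int_lattice \<inter> S)"
proof -
  obtain R where R: "\<And>x. x \<in> S \<Longrightarrow> norm x \<le> R"
    using assms by (auto simp: bounded_iff)
  define F where "F = real_of_int ` {- \<lceil>R\<rceil>..\<lceil>R\<rceil>}"
  have "int_lattice \<inter> S \<subseteq> (\<lambda>(a, b). vector [a, b]) ` (F \<times> F)"
  proof
    fix k assume k: "k \<in> int_lattice \<inter> S"
    have *: "k $ i \<in> F" for i
    proof -
      obtain n where n: "k $ i = of_int n" using k by (auto simp: int_lattice_def elim: Ints_cases)
      have "\<bar>k $ i\<bar> \<le> R" using R[of k] k component_le_norm_cart[of k i] by auto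
      then have "- \<lceil>R\<rceil> \<le> n" "n \<le> \<lceil>R\<rceil>" using n by linarith+
      then show ?thesis using n by (auto simp: F_def)
    qed
    have "k = vector [k $ 1, k $ 2]" by (simp add: vec_eq_iff forall_2)
    then show "k \<in> (\<lambda>(a, b). vector [a, b]) ` (F \<times> F)" using * by force
  qed
  moreover have "finite F" by (simp add: F_def)
  ultimately show ?thesis by (meson finite_SigmaI finite_imageI finite_subset)
qed

lemma countable_int_lattice: "countable int_lattice"
proof -
  have "\<exists>n::nat. x \<in> cball 0 (real n)" for x :: "real^2"
    using real_arch_simple[of "norm x"] by simp
  then have "int_lattice = (\<Union>n::nat. int_lattice \<inter> cball 0 (real n))"
    by blast
  moreover have "countable (\<Union>n::nat. int_lattice \<inter> cball 0 (real n))"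
    by (rule countable_UN) (auto intro: countable_finite finite_int_lattice_Int_bounded)
  ultimately show ?thesis by simp
qed

lemma cell_translate_exists:
  obtains n where "n \<in> int_lattice" "x - (2*pi) *\<^sub>R n \<in> cell"
proof
  define n :: "real^2" where "n = (\<chi> i. of_int \<lceil>(x $ i - pi) / (2*pi)\<rceil>)"
  show "n \<in> int_lattice" by (simp add: n_def int_lattice_def)
  have "- pi < x $ i - 2*pi * of_int \<lceil>(x $ i - pi) / (2*pi)\<rceil>"
       "x $ i - 2*pi * of_int \<lceil>(x $ i - pi) / (2*pi)\<rceil> \<le> pi" for i
  proof -
    define y where "y = (x $ i - pi) / (2*pi)"
    have x: "x $ i = 2*pi*y + pi" by (simp add: y_def field_simps)
    have "2*pi*y \<le> 2*pi * of_int \<lceil>y\<rceil>" "2*pi * of_int \<lceil>y\<rceil> < 2*pi*(y + 1)"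
      by (intro mult_left_mono mult_strict_left_mono; use ceiling_correct[of y] in simp)+
    then show "- pi < x $ i - 2*pi * of_int \<lceil>(x $ i - pi) / (2*pi)\<rceil>"
       "x $ i - 2*pi * of_int \<lceil>(x $ i - pi) / (2*pi)\<rceil> \<le> pi"
      unfolding y_def[symmetric] x by (simp_all add: algebra_simps)
  qed
  then show "x - (2*pi) *\<^sub>R n \<in> cell" by (simp add: cell_def n_def)
qed

lemma cell_translate_unique:
  assumes "m \<in> int_lattice" "n \<in> int_lattice" "x - (2*pi) *\<^sub>R m \<in> cell" "x - (2*pi) *\<^sub>R n \<in> cell"
  shows "m = n"
proof -
  have "m $ i = n $ i" for i
  proof -
    obtain a b where ab: "m $ i = of_int a" "n $ i = of_int b"
      using assms(1,2) by (auto simp: int_lattice_def elim!: Ints_cases dest!: spec[of _ i])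
    have "\<bar>2*pi*(m $ i) - 2*pi*(n $ i)\<bar> < 2*pi"
      using assms(3,4)[unfolded cell_def] by (auto dest!: spec[of _ i])
    also have "\<bar>2*pi*(m $ i) - 2*pi*(n $ i)\<bar> = 2*pi*\<bar>m $ i - n $ i\<bar>"
      by (simp add: abs_mult flip: right_diff_distrib)
    finally have "\<bar>m $ i - n $ i\<bar> < 1" by simp
    then have "\<bar>a - b\<bar> < 1" unfolding ab by linarith
    then show ?thesis using ab by simp
  qed
  then show ?thesis by (simp add: vec_eq_iff)
qed

lemma norm_cell: "x \<in> cell \<Longrightarrow> norm x \<le> 2*pi"
proof -
  assume x: "x \<in> cell"
  have "norm x \<le> (\<Sum>i\<in>UNIV. \<bar>x $ i\<bar>)" by (rule norm_le_l1_cart)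
  also have "\<dots> \<le> (\<Sum>i\<in>(UNIV::2 set). pi)"
    using x by (intro sum_mono) (auto simp: cell_def abs_le_iff less_imp_le minus_le_iff)
  finally show ?thesis by simp
qed

lemma cell_subset: "box (\<chi> i. - pi) (\<chi> i. pi) \<subseteq> cell" "cell \<subseteq> cbox (\<chi> i. - pi) (\<chi> i. pi)"
  by (auto simp: cell_def mem_box_cart less_imp_le)

lemma cell_borel [measurable]: "cell \<in> sets borel"
proof -
  have "cell = (\<Inter>i. {x. - pi < x $ i} \<inter> {x. x $ i \<le> pi})" by (auto simp: cell_def)
  also have "\<dots> \<in> sets borel"
    by (intro sets.finite_INT sets.Int borel_open borel_closed open_halfspace_component_gt_cart
        closed_halfspace_component_le_cart) auto
  finally show ?thesis .
qed

lemma cell_lebesgue [measurable]: "cell \<in> sets lebesgue"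
  using cell_borel by simp

lemma emeasure_cell: "emeasure lebesgue cell = ennreal ((2*pi)\<^sup>2)"
proof -
  have "emeasure lborel (box (\<chi> i. - pi) (\<chi> i. pi) :: (real^2) set) = ennreal ((2*pi)\<^sup>2)"
       "emeasure lborel (cbox (\<chi> i. - pi) (\<chi> i. pi) :: (real^2) set) = ennreal ((2*pi)\<^sup>2)"
    by (auto simp: emeasure_lborel_box_eq emeasure_lborel_cbox_eq Basis_vec_def inner_axis
        image_iff prod_constant UNIV_2 axis_eq_axis power2_eq_square)
  with emeasure_mono[OF cell_subset(1), of lborel] emeasure_mono[OF cell_subset(2), of lborel]
  show ?thesis by simp
qed

abbreviation torus :: "(real^2) measure" where "torus \<equiv> lebesgue_on cell"

lemma finite_measure_torus: "finite_measure torus"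
  by (intro finite_measure_lebesgue_on) (simp add: fmeasurable_def emeasure_cell)

lemma measure_torus: "measure torus cell = (2*pi)\<^sup>2"
  by (simp add: Sigma_Algebra.measure_def emeasure_restrict_space emeasure_cell del: emeasure_completion)

text \<open>The plane is cut into translates of the cell and the pieces are moved back to it. The vanishing
  assumption says that \<open>F\<close> meets only the translates indexed by \<open>N\<close>, which keeps the sum finite.\<close>

lemma integral_periodize:
  fixes F :: "real^2 \<Rightarrow> complex"
  assumes F: "integrable lebesgue F" and N: "finite N" "N \<subseteq> int_lattice"
    and van: "\<And>n x. n \<in> int_lattice - N \<Longrightarrow> x \<in> cell \<Longrightarrow> F (x + (2*pi) *\<^sub>R n) = 0"
  shows "\<And>n. integrable torus (\<lambda>x. F (x + (2*pi) *\<^sub>R n))"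
    and "integral\<^sup>L lebesgue F = (\<Sum>n\<in>N. LINT x|torus. F (x + (2*pi) *\<^sub>R n))"
proof -
  have Fm: "F \<in> borel_measurable lebesgue" using F by auto
  have int: "integrable lebesgue (\<lambda>x. F (x + t))" for t
    using F Fm by (simp add: integrable_translate_iff)
  show "integrable torus (\<lambda>x. F (x + (2*pi) *\<^sub>R n))" for n
    using int integrable_restrict_space[of cell lebesgue "\<lambda>x. F (x + (2*pi) *\<^sub>R n)"]
    by (simp add: integrable_mult_indicator)
  have int2: "integrable lebesgue (\<lambda>x. indicat_real cell x *\<^sub>R F (x + t))" for t
    by (intro integrable_mult_indicator int) simp
  have decomp: "F x = (\<Sum>n\<in>N. indicat_real cell (x - (2*pi) *\<^sub>R n) *\<^sub>R F x)" for x
  proof -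
    obtain m where m: "m \<in> int_lattice" "x - (2*pi) *\<^sub>R m \<in> cell" by (rule cell_translate_exists)
    have ind: "indicat_real cell (x - (2*pi) *\<^sub>R n) = (if n = m then 1 else 0)" if "n \<in> N" for n
    proof (cases "n = m")
      case False
      then have "x - (2*pi) *\<^sub>R n \<notin> cell"
        using cell_translate_unique[of n m x] m that N(2) by blast
      then show ?thesis using False by simp
    qed (use m in simp)
    have "(\<Sum>n\<in>N. indicat_real cell (x - (2*pi) *\<^sub>R n) *\<^sub>R F x) = (\<Sum>n\<in>N. if n = m then F x else 0)"
      by (intro sum.cong) (auto simp: ind)
    also have "\<dots> = (if m \<in> N then F x else 0)" using N by simp
    also have "\<dots> = F x" using van[of m "x - (2*pi) *\<^sub>R m"] m by auto
    finally show ?thesis ..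
  qed
  have trans: "(\<lambda>x. indicat_real cell x *\<^sub>R F (x + (2*pi) *\<^sub>R n)) =
        (\<lambda>x. (\<lambda>y. indicat_real cell (y - (2*pi) *\<^sub>R n) *\<^sub>R F y) (x + (2*pi) *\<^sub>R n))" for n
    by simp
  have cm: "(\<lambda>y. indicat_real cell (y - (2*pi) *\<^sub>R n) *\<^sub>R F y) \<in> borel_measurable lebesgue" for n
    using borel_measurable_translate[of "indicat_real cell" "- ((2*pi) *\<^sub>R n)"] Fm
    by (intro borel_measurable_scaleR) auto
  have "integral\<^sup>L lebesgue F = (LINT x|lebesgue. (\<Sum>n\<in>N. indicat_real cell (x - (2*pi) *\<^sub>R n) *\<^sub>R F x))"
    using decomp by simp
  also have "\<dots> = (\<Sum>n\<in>N. LINT x|lebesgue. indicat_real cell (x - (2*pi) *\<^sub>R n) *\<^sub>R F x)"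
  proof (rule Bochner_Integration.integral_sum)
    fix n
    show "integrable lebesgue (\<lambda>x. indicat_real cell (x - (2*pi) *\<^sub>R n) *\<^sub>R F x)"
      using int2[of "(2*pi) *\<^sub>R n"] integrable_translate_iff[OF cm[of n], of "(2*pi) *\<^sub>R n"]
      unfolding trans[of n] by (rule iffD1[rotated])
  qed
  also have "\<dots> = (\<Sum>n\<in>N. LINT x|lebesgue. indicat_real cell x *\<^sub>R F (x + (2*pi) *\<^sub>R n))"
    by (intro sum.cong refl) (simp only: trans integral_translate[OF cm])
  also have "\<dots> = (\<Sum>n\<in>N. LINT x|torus. F (x + (2*pi) *\<^sub>R n))"
    by (intro sum.cong refl integral_restrict_space[symmetric]) simp
  finally show "integral\<^sup>L lebesgue F = (\<Sum>n\<in>N. LINT x|torus. F (x + (2*pi) *\<^sub>R n))" .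
qed

definition chr :: "real^2 \<Rightarrow> real^2 \<Rightarrow> complex" where
  "chr k x = cis (k \<bullet> x)"

lemma norm_chr [simp]: "cmod (chr k x) = 1"
  and chr_0 [simp]: "chr 0 x = 1"
  and chr_add_left: "chr (k + l) x = chr k x * chr l x"
  and chr_add_right: "chr k (x + y) = chr k x * chr k y"
  and cnj_chr: "cnj (chr k x) = chr (- k) x"
  by (simp_all add: chr_def inner_add_left inner_add_right cis_mult cis_cnj)

lemma chr_borel [measurable]: "chr k \<in> borel_measurable borel"
  unfolding chr_def[abs_def] cis_conv_exp
  by (intro borel_measurable_continuous_onI continuous_intros)

lemma chr_lebesgue [measurable]: "chr k \<in> borel_measurable lebesgue"
  using measurable_completion[of "chr k" lborel borel] by simp

lemma chr_periodic:
  assumes "k \<in> int_lattice" "n \<in> int_lattice"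
  shows "chr k (x + (2*pi) *\<^sub>R n) = chr k x"
proof -
  have "k \<bullet> n \<in> \<int>"
    using assms by (auto simp: int_lattice_def inner_vec_def intro!: Ints_sum Ints_mult)
  then have "chr k ((2*pi) *\<^sub>R n) = 1"
    by (auto simp: chr_def elim!: Ints_cases intro: cis_multiple_2pi)
  then show ?thesis by (simp add: chr_add_right)
qed

lemma integrable_chr: "integrable torus (chr k)"
proof -
  interpret finite_measure torus by (rule finite_measure_torus)
  show ?thesis
    by (rule integrable_const_bound[where B = 1]) (auto intro: measurable_restrict_space1 chr_lebesgue)
qed

text \<open>The integral of a periodic function over a fundamental domain does not depend on the domain: after
  the translation, the integrand is cut off by the translated cell, whose periodisation is constantly \<open>1\<close>.\<close>

lemma integral_chr_shift:
  assumes k: "k \<in> int_lattice"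
  shows "(LINT x|torus. chr k (x + v)) = (LINT x|torus. chr k x)"
proof -
  define F where "F x = indicat_real cell (x - v) *\<^sub>R chr k x" for x
  define N where "N = int_lattice \<inter> cball 0 (norm v + 2)"
  have N: "finite N" "N \<subseteq> int_lattice"
    unfolding N_def by (auto intro: finite_int_lattice_Int_bounded)
  have Nmem: "n \<in> N" if "n \<in> int_lattice" "x \<in> cell" "x + (2*pi) *\<^sub>R n - v \<in> cell" for n x
  proof -
    have "norm ((2*pi) *\<^sub>R n) \<le> norm (x + (2*pi) *\<^sub>R n - v) + norm x + norm v"
      using norm_triangle_ineq4[of "x + (2*pi) *\<^sub>R n - v" "x - v"] norm_triangle_ineq4[of x v] by simp
    also have "\<dots> \<le> 2*pi + 2*pi + norm v"
      using norm_cell[OF that(2)] norm_cell[OF that(3)] by simp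
    finally have "2*pi * norm n \<le> 2*pi * 2 + norm v" by simp
    also have "norm v \<le> 2*pi * norm v"
      using pi_ge_two mult_right_mono[of 1 "2*pi" "norm v"] by simp
    finally have "2*pi * norm n \<le> 2*pi*(norm v + 2)" by (simp add: algebra_simps)
    then have "norm n \<le> norm v + 2" by simp
    then show ?thesis using that by (simp add: N_def)
  qed
  have cm: "F \<in> borel_measurable lebesgue"
    unfolding F_def[abs_def] using borel_measurable_translate[of "indicat_real cell" "- v"]
    by (intro borel_measurable_scaleR) (auto intro: chr_lebesgue)
  have shift: "(\<lambda>x. F (x + v)) = (\<lambda>x. indicat_real cell x *\<^sub>R chr k (x + v))"
    by (simp add: F_def)
  have "integrable lebesgue (\<lambda>x. indicat_real cell x *\<^sub>R chr k (x + v))"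
    using integrable_restrict_space[of cell lebesgue "\<lambda>x. chr k (x + v)"] integrable_chr[of k]
    by (simp add: chr_add_right)
  then have Fint: "integrable lebesgue F"
    using integrable_translate_iff[OF cm, of v] shift by simp
  have "(LINT x|torus. chr k (x + v)) = integral\<^sup>L lebesgue F"
    using integral_translate[OF cm, of v] shift integral_restrict_space[of cell lebesgue "\<lambda>x. chr k (x + v)"]
    by simp
  also have "\<dots> = (\<Sum>n\<in>N. LINT x|torus. F (x + (2*pi) *\<^sub>R n))"
    by (rule integral_periodize(2)[OF Fint N]) (use Nmem in \<open>auto simp: F_def indicator_def\<close>)
  also have "\<dots> = (LINT x|torus. (\<Sum>n\<in>N. F (x + (2*pi) *\<^sub>R n)))"
    by (intro Bochner_Integration.integral_sum[symmetric] integral_periodize(1)[OF Fint N])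
       (use Nmem in \<open>auto simp: F_def indicator_def\<close>)
  also have "\<dots> = (LINT x|torus. chr k x)"
  proof (rule Bochner_Integration.integral_cong[OF refl])
    fix x assume "x \<in> space torus"
    then have x: "x \<in> cell" by (simp add: space_restrict_space)
    obtain m where m: "m \<in> int_lattice" "x - v - (2*pi) *\<^sub>R m \<in> cell" by (rule cell_translate_exists)
    have mN: "- m \<in> N" using Nmem[of "- m" x] x m by (simp add: int_lattice_minus algebra_simps)
    have "F (x + (2*pi) *\<^sub>R n) = (if n = - m then chr k x else 0)" if "n \<in> N" for n
    proof -
      have nl: "n \<in> int_lattice" using that N by auto
      have "x + (2*pi) *\<^sub>R n - v \<in> cell \<longleftrightarrow> n = - m"
        using cell_translate_unique[of "- n" m "x - v"] m nl
        by (auto simp: int_lattice_minus algebra_simps)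
      then show ?thesis using nl k by (auto simp: F_def chr_periodic indicator_def)
    qed
    then have "(\<Sum>n\<in>N. F (x + (2*pi) *\<^sub>R n)) = (\<Sum>n\<in>N. if n = - m then chr k x else 0)"
      by (intro sum.cong) auto
    then show "(\<Sum>n\<in>N. F (x + (2*pi) *\<^sub>R n)) = chr k x" using mN N by simp
  qed
  finally show ?thesis .
qed

text \<open>Some translation turns a nontrivial character into its negative without changing the integral.\<close>

lemma integral_chr:
  assumes k: "k \<in> int_lattice"
  shows "(LINT x|torus. chr k x) = (if k = 0 then of_real ((2*pi)\<^sup>2) else 0)"
proof (cases "k = 0")
  case True
  interpret finite_measure torus by (rule finite_measure_torus)
  show ?thesis using True measure_torus by (simp add: lebesgue_integral_const space_restrict_space scaleR_conv_of_real)
next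
  case False
  then obtain i where i: "k $ i \<noteq> 0" by (auto simp: vec_eq_iff)
  \<comment> \<open>With this v the inner product of k and v is pi.\<close>
  define v where "v = (pi / k $ i) *\<^sub>R (axis i 1 :: real^2)"
  have "chr k v = -1" using i by (simp add: chr_def v_def inner_axis)
  then have "(LINT x|torus. chr k x) = - (LINT x|torus. chr k x)"
    using integral_chr_shift[OF k, of v] by (simp add: chr_add_right)
  then show ?thesis using False by simp
qed

section \<open>Parseval's identity on the torus\<close>

lemma integrable_mult_square_integrable:
  fixes u v :: "'a \<Rightarrow> complex"
  assumes [measurable]: "u \<in> borel_measurable M" "v \<in> borel_measurable M"
    and "integrable M (\<lambda>x. (cmod (u x))\<^sup>2)" "integrable M (\<lambda>x. (cmod (v x))\<^sup>2)"
  shows "integrable M (\<lambda>x. u x * v x)"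
proof (rule Bochner_Integration.integrable_bound)
  show "integrable M (\<lambda>x. (cmod (u x))\<^sup>2 + (cmod (v x))\<^sup>2)"
    using assms by simp
  show "AE x in M. norm (u x * v x) \<le> norm ((cmod (u x))\<^sup>2 + (cmod (v x))\<^sup>2)"
  proof (rule AE_I2)
    fix x
    have "2 * (cmod (u x) * cmod (v x)) \<le> (cmod (u x))\<^sup>2 + (cmod (v x))\<^sup>2"
      using sum_squares_bound[of "cmod (u x)" "cmod (v x)"] by (simp add: mult.assoc)
    moreover have "0 \<le> cmod (u x) * cmod (v x)" by simp
    ultimately have "cmod (u x) * cmod (v x) \<le> (cmod (u x))\<^sup>2 + (cmod (v x))\<^sup>2"
      by linarith
    then show "norm (u x * v x) \<le> norm ((cmod (u x))\<^sup>2 + (cmod (v x))\<^sup>2)"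
      by (simp add: norm_mult)
  qed
qed measurable

lemma square_integrable_add:
  fixes u v :: "'a \<Rightarrow> complex"
  assumes [measurable]: "u \<in> borel_measurable M" "v \<in> borel_measurable M"
    and "integrable M (\<lambda>x. (cmod (u x))\<^sup>2)" "integrable M (\<lambda>x. (cmod (v x))\<^sup>2)"
  shows "integrable M (\<lambda>x. (cmod (u x + v x))\<^sup>2)"
proof (rule Bochner_Integration.integrable_bound)
  show "integrable M (\<lambda>x. 2 * (cmod (u x))\<^sup>2 + 2 * (cmod (v x))\<^sup>2)"
    using assms by simp
  show "AE x in M. norm ((cmod (u x + v x))\<^sup>2) \<le> norm (2 * (cmod (u x))\<^sup>2 + 2 * (cmod (v x))\<^sup>2)"
  proof (rule AE_I2)
    fix x
    have "(cmod (u x + v x))\<^sup>2 \<le> (cmod (u x) + cmod (v x))\<^sup>2"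
      by (intro power_mono norm_triangle_ineq) simp
    also have "\<dots> \<le> 2 * (cmod (u x))\<^sup>2 + 2 * (cmod (v x))\<^sup>2"
      using sum_squares_bound[of "cmod (u x)" "cmod (v x)"] by (simp add: power2_sum)
    finally show "norm ((cmod (u x + v x))\<^sup>2) \<le> norm (2 * (cmod (u x))\<^sup>2 + 2 * (cmod (v x))\<^sup>2)"
      by simp
  qed
qed measurable

lemma borel_measurable_lebesgueI:
  "f \<in> borel_measurable borel \<Longrightarrow> f \<in> borel_measurable lebesgue"
  by (rule measurable_completion) simp

definition trig_polys :: "(real^2 \<Rightarrow> complex) set" where
  "trig_polys = {q. \<exists>F b. finite F \<and> F \<subseteq> int_lattice \<and> q = (\<lambda>x. \<Sum>k\<in>F. b k * chr k x)}"

lemma trig_polys_monom: "k \<in> int_lattice \<Longrightarrow> (\<lambda>x. c * chr k x) \<in> trig_polys"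
  unfolding trig_polys_def by (intro CollectI exI[of _ "{k}"] exI[of _ "\<lambda>_. c"]) auto

lemma trig_polys_const: "(\<lambda>x. c) \<in> trig_polys"
  using trig_polys_monom[of 0 c] by (simp add: int_lattice_0)

lemma trig_polys_add:
  assumes "p \<in> trig_polys" "q \<in> trig_polys"
  shows "(\<lambda>x. p x + q x) \<in> trig_polys"
proof -
  obtain F b where F: "finite F" "F \<subseteq> int_lattice" "p = (\<lambda>x. \<Sum>k\<in>F. b k * chr k x)"
    using assms(1) by (auto simp: trig_polys_def)
  obtain H c where H: "finite H" "H \<subseteq> int_lattice" "q = (\<lambda>x. \<Sum>k\<in>H. c k * chr k x)"
    using assms(2) by (auto simp: trig_polys_def)
  define d where "d k = (if k \<in> F then b k else 0) + (if k \<in> H then c k else 0)" for k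
  have "p x + q x = (\<Sum>k\<in>F \<union> H. d k * chr k x)" for x
  proof -
    have "(\<Sum>k\<in>F \<union> H. d k * chr k x) = (\<Sum>k\<in>F \<union> H. (if k \<in> F then b k * chr k x else 0))
        + (\<Sum>k\<in>F \<union> H. (if k \<in> H then c k * chr k x else 0))"
      unfolding sum.distrib[symmetric] by (intro sum.cong) (auto simp: d_def algebra_simps)
    also have "(\<Sum>k\<in>F \<union> H. (if k \<in> F then b k * chr k x else 0)) = p x"
      unfolding F(3) by (rule sum.mono_neutral_cong_right) (use F H in auto)
    also have "(\<Sum>k\<in>F \<union> H. (if k \<in> H then c k * chr k x else 0)) = q x"
      unfolding H(3) by (rule sum.mono_neutral_cong_right) (use F H in auto)
    finally show ?thesis ..
  qed
  then have "(\<lambda>x. p x + q x) = (\<lambda>x. \<Sum>k\<in>F \<union> H. d k * chr k x)" by blast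
  then show ?thesis
    unfolding trig_polys_def using F H by (intro CollectI exI[of _ "F \<union> H"] exI[of _ d]) auto
qed

lemma trig_polys_sum:
  "finite I \<Longrightarrow> (\<And>i. i \<in> I \<Longrightarrow> p i \<in> trig_polys) \<Longrightarrow> (\<lambda>x. \<Sum>i\<in>I. p i x) \<in> trig_polys"
proof (induction I rule: finite_induct)
  case empty
  show ?case using trig_polys_const[of 0] by simp
next
  case (insert i I)
  then show ?case using trig_polys_add[of "p i" "\<lambda>x. \<Sum>i\<in>I. p i x"] by simp
qed

lemma trig_polys_mult:
  assumes "p \<in> trig_polys" "q \<in> trig_polys"
  shows "(\<lambda>x. p x * q x) \<in> trig_polys"
proof -
  obtain F b where F: "finite F" "F \<subseteq> int_lattice" "p = (\<lambda>x. \<Sum>k\<in>F. b k * chr k x)"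
    using assms(1) by (auto simp: trig_polys_def)
  obtain H c where H: "finite H" "H \<subseteq> int_lattice" "q = (\<lambda>x. \<Sum>k\<in>H. c k * chr k x)"
    using assms(2) by (auto simp: trig_polys_def)
  have "p x * q x = (\<Sum>k\<in>F. \<Sum>l\<in>H. (b k * c l) * chr (k + l) x)" for x
    unfolding F(3) H(3) sum_product by (intro sum.cong) (auto simp: chr_add_left)
  then have "(\<lambda>x. p x * q x) = (\<lambda>x. \<Sum>k\<in>F. \<Sum>l\<in>H. (b k * c l) * chr (k + l) x)" by blast
  also have "\<dots> \<in> trig_polys"
    using F H by (intro trig_polys_sum trig_polys_monom int_lattice_add) auto
  finally show ?thesis .
qed

definition torus_map :: "real^2 \<Rightarrow> complex \<times> complex" where
  "torus_map x = (cis (x $ 1), cis (x $ 2))"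

text \<open>On the torus the coordinate functions of \<open>\<complex> \<times> \<complex>\<close> are cosines and sines, hence combinations
  of characters, and these span an algebra.\<close>

lemma trig_polys_real_polynomial:
  "real_polynomial_function p \<Longrightarrow> (\<lambda>x. complex_of_real (p (torus_map x))) \<in> trig_polys"
proof (induction p rule: real_polynomial_function.induct)
  case (linear f)
  interpret f: bounded_linear f by fact
  have ax: "axis i 1 \<in> int_lattice" for i :: 2
    by (auto simp: int_lattice_def axis_def)
  have f: "f (z, w) = Re z * f (1, 0) + Im z * f (\<i>, 0) + Re w * f (0, 1) + Im w * f (0, \<i>)" for z w
  proof -
    have "(z, w) = Re z *\<^sub>R (1, 0) + Im z *\<^sub>R (\<i>, 0) + Re w *\<^sub>R (0, 1) + Im w *\<^sub>R (0, \<i>)"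
      by (simp add: complex_eq_iff)
    then have "f (z, w) = f (Re z *\<^sub>R (1, 0) + Im z *\<^sub>R (\<i>, 0) + Re w *\<^sub>R (0, 1) + Im w *\<^sub>R (0, \<i>))"
      by (rule arg_cong)
    then show ?thesis by (simp only: f.add f.scaleR real_scaleR_def)
  qed
  have re: "complex_of_real (cos (x $ i)) = 1/2 * chr (axis i 1) x + 1/2 * chr (- axis i 1) x" for x :: "real^2" and i
    by (simp add: chr_def inner_axis' complex_eq_iff)
  have im: "complex_of_real (sin (x $ i)) = (- \<i>/2) * chr (axis i 1) x + (\<i>/2) * chr (- axis i 1) x" for x :: "real^2" and i
    by (simp add: chr_def inner_axis' complex_eq_iff)
  have re': "(\<lambda>x. complex_of_real (cos (x $ i))) \<in> trig_polys" for i :: 2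
    unfolding re by (intro trig_polys_add trig_polys_monom int_lattice_minus ax)
  have im': "(\<lambda>x. complex_of_real (sin (x $ i))) \<in> trig_polys" for i :: 2
    unfolding im by (intro trig_polys_add trig_polys_monom int_lattice_minus ax)
  have "(\<lambda>x. complex_of_real (f (torus_map x))) =
     (\<lambda>x. of_real (cos (x $ 1)) * of_real (f (1, 0)) + of_real (sin (x $ 1)) * of_real (f (\<i>, 0)) +
      of_real (cos (x $ 2)) * of_real (f (0, 1)) + of_real (sin (x $ 2)) * of_real (f (0, \<i>)))"
    unfolding torus_map_def by (subst f) simp
  then show ?case
    by (simp only:) (intro trig_polys_add trig_polys_mult re' im' trig_polys_const)
next
  case (const c)
  show ?case by (rule trig_polys_const)
next
  case (add f g)
  then show ?case using trig_polys_add by fastforce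
next
  case (mult f g)
  then show ?case using trig_polys_mult by fastforce
qed

lemma trig_polys_polynomial:
  assumes "p \<in> complex_polys"
  shows "(\<lambda>x. p (torus_map x)) \<in> trig_polys"
proof -
  have "real_polynomial_function (\<lambda>x. p x \<bullet> b)" if "b \<in> Basis" for b
    using assms that by (simp add: complex_polys_def polynomial_function_iff_Basis_inner)
  then have "real_polynomial_function (\<lambda>x. Re (p x))" "real_polynomial_function (\<lambda>x. Im (p x))"
    by (force simp: Basis_complex_def inner_complex_def)+
  note t = this[THEN trig_polys_real_polynomial]
  have "(\<lambda>x. complex_of_real (Re (p (torus_map x))) + \<i> * complex_of_real (Im (p (torus_map x)))) \<in> trig_polys"
    by (intro trig_polys_add trig_polys_mult t trig_polys_const)
  then show ?thesis by (simp flip: complex_eq)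
qed

text \<open>A Borel inverse of \<open>cis\<close> on \<open>(-\<pi>, \<pi>]\<close>. The clipping makes the argument of \<open>arccos\<close> legitimate
  everywhere, so that the function is visibly measurable.\<close>

definition circle_angle :: "complex \<Rightarrow> real" where
  "circle_angle z = (if Im z < 0 then -1 else 1) * arccos (max (-1) (min 1 (Re z)))"

lemma circle_angle_cis:
  assumes "- pi < t" "t \<le> pi"
  shows "circle_angle (cis t) = t"
proof (cases "0 \<le> t")
  case True
  then show ?thesis using assms sin_ge_zero[of t] by (simp add: circle_angle_def arccos_cos)
next
  case False
  then have "sin t < 0" using assms sin_gt_zero[of "-t"] by simp
  then show ?thesis using False assms arccos_cos[of "- t"] by (simp add: circle_angle_def)
qed

lemma circle_angle_borel [measurable]: "circle_angle \<in> borel_measurable borel"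
proof -
  have "(\<lambda>z. arccos (max (-1) (min 1 (Re z)))) \<in> borel_measurable borel"
    by (intro borel_measurable_continuous_onI continuous_intros) auto
  then show ?thesis unfolding circle_angle_def[abs_def] by measurable
qed

lemma torus_map_measurable: "torus_map \<in> torus \<rightarrow>\<^sub>M borel"
proof (rule measurable_restrict_space1)
  have "torus_map \<in> borel_measurable borel"
    unfolding torus_map_def[abs_def] cis_conv_exp
    by (intro borel_measurable_continuous_onI continuous_intros)
  then show "torus_map \<in> borel_measurable lebesgue"
    by (rule borel_measurable_lebesgueI)
qed

text \<open>The map \<open>torus_map\<close> is injective on the cell, with the Borel inverse built from \<open>circle_angle\<close>. It
  carries the measure to one supported on a product of two circles, where polynomials are dense; pulled
  back, polynomials become trigonometric polynomials.\<close>

proposition trig_polys_dense: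
  assumes G: "G \<in> borel_measurable lebesgue" and int: "integrable torus (\<lambda>x. (cmod (G x))\<^sup>2)"
    and \<epsilon>: "\<epsilon> > 0"
  shows "\<exists>q\<in>trig_polys. sqdist torus G q < ennreal \<epsilon>"
proof -
  obtain G' where G': "G' \<in> borel_measurable borel" "AE x in lebesgue. G x = G' x"
    using borel_representative[OF G] by blast
  have ae: "AE x in torus. G x = G' x"
    using G'(2) by (auto simp: AE_restrict_space_iff elim: eventually_mono)
  have G'leb: "G' \<in> borel_measurable lebesgue"
    using G'(1) by (rule borel_measurable_lebesgueI)
  have Gt: "G \<in> borel_measurable torus" "G' \<in> borel_measurable torus"
    using G G'leb by (auto intro: measurable_restrict_space1)
  define h where "h zw = G' (\<chi> i. if i = 1 then circle_angle (fst zw) else circle_angle (snd zw))" for zw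
  have h_e: "h (torus_map x) = G' x" if "x \<in> cell" for x
  proof -
    have "(\<chi> i. if i = 1 then circle_angle (cis (x $ 1)) else circle_angle (cis (x $ 2))) = x"
      using that by (simp add: vec_eq_iff forall_2 cell_def circle_angle_cis)
    then show ?thesis by (simp add: h_def torus_map_def cong: if_cong)
  qed
  have h: "h \<in> borel_measurable borel"
  proof -
    have "(\<lambda>zw :: complex \<times> complex. (\<chi> i. if i = 1 then circle_angle (fst zw) else circle_angle (snd zw)) :: real^2)
       \<in> borel_measurable borel"
    proof (subst borel_measurable_euclidean_space, intro ballI)
      fix b :: "real^2" assume "b \<in> Basis"
      then obtain i where b: "b = axis i 1" by (auto simp: Basis_vec_def)
      have [measurable]: "fst \<in> borel_measurable (borel :: (complex \<times> complex) measure)"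
        "snd \<in> borel_measurable (borel :: (complex \<times> complex) measure)"
        by (intro borel_measurable_continuous_onI continuous_intros)+
      show "(\<lambda>zw. (\<chi> i. if i = 1 then circle_angle (fst zw) else circle_angle (snd zw)) \<bullet> b) \<in> borel_measurable borel"
        by (cases "i = 1") (simp_all add: b inner_axis)
    qed
    then show ?thesis unfolding h_def[abs_def] using G'(1) by (rule measurable_compose)
  qed
  define \<mu> where "\<mu> = distr torus borel torus_map"
  have \<mu>: "finite_measure \<mu>" "sets \<mu> = sets borel"
    unfolding \<mu>_def using finite_measure.finite_measure_distr[OF finite_measure_torus torus_map_measurable]
    by auto
  define K where "K = sphere (0::complex) 1 \<times> sphere (0::complex) 1"
  have K: "compact K" by (simp add: K_def compact_Times)
  have K0: "emeasure \<mu> (- K) = 0"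
  proof -
    have "- K \<in> sets borel" using K by (auto intro!: borel_open open_Compl compact_imp_closed)
    moreover have "torus_map -` (- K) \<inter> space torus = {}"
      by (auto simp: K_def torus_map_def)
    ultimately show ?thesis by (simp add: \<mu>_def emeasure_distr[OF torus_map_measurable])
  qed
  have "integrable torus (\<lambda>x. (cmod (h (torus_map x)))\<^sup>2)"
  proof (rule integrable_cong_AE_imp[OF int])
    show "(\<lambda>x. (cmod (h (torus_map x)))\<^sup>2) \<in> borel_measurable torus"
      using measurable_compose[OF torus_map_measurable h] by measurable
    show "AE x in torus. (cmod (G x))\<^sup>2 = (cmod (h (torus_map x)))\<^sup>2"
      using ae AE_space by eventually_elim (simp add: h_e space_restrict_space)
  qed
  then have "integrable \<mu> (\<lambda>x. (cmod (h x))\<^sup>2)"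
    unfolding \<mu>_def using h by (subst integrable_distr_eq[OF torus_map_measurable]) auto
  then have "h \<in> L2_closure \<mu> complex_polys"
    by (rule complex_polys_dense_L2[OF \<mu> K K0 h])
  then obtain p where p: "p \<in> complex_polys" "sqdist \<mu> h p < ennreal \<epsilon>"
    using \<epsilon> by (auto simp: L2_closure_def)
  have pm: "p \<in> borel_measurable borel"
    using p(1) by (auto simp: complex_polys_def intro!: borel_measurable_continuous_onI continuous_on_polymonial_function)
  have "sqdist \<mu> h p = (\<integral>\<^sup>+x. ennreal ((cmod (h (torus_map x) - p (torus_map x)))\<^sup>2) \<partial>torus)"
    unfolding sqdist_def \<mu>_def using h pm by (intro nn_integral_distr[OF torus_map_measurable]) simp
  also have "\<dots> = sqdist torus G (\<lambda>x. p (torus_map x))"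
    unfolding sqdist_def
  proof (rule nn_integral_cong_AE)
    show "AE x in torus. ennreal ((cmod (h (torus_map x) - p (torus_map x)))\<^sup>2)
       = ennreal ((cmod (G x - p (torus_map x)))\<^sup>2)"
      using ae AE_space by eventually_elim (simp add: h_e space_restrict_space)
  qed
  finally show ?thesis using p trig_polys_polynomial by auto
qed

text \<open>Completing the square coefficientwise: the error splits into the part of \<open>G\<close> not captured by the
  coefficients in \<open>F\<close> and the distance of \<open>b\<close> from the Fourier coefficients. The first part gives
  Bessel's inequality, and together with density both parts give Parseval's identity.\<close>

lemma integral_square_trig_error:
  assumes G: "G \<in> borel_measurable lebesgue" and int: "integrable torus (\<lambda>x. (cmod (G x))\<^sup>2)"
    and F: "finite F" "F \<subseteq> int_lattice"
  defines "c k \<equiv> LINT x|torus. G x * cnj (chr k x)"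
  shows "has_bochner_integral torus (\<lambda>x. (cmod (G x - (\<Sum>k\<in>F. b k * chr k x)))\<^sup>2)
     ((LINT x|torus. (cmod (G x))\<^sup>2) - (\<Sum>k\<in>F. (cmod (c k))\<^sup>2) / (2*pi)\<^sup>2
      + (2*pi)\<^sup>2 * (\<Sum>k\<in>F. (cmod (b k - c k / of_real ((2*pi)\<^sup>2)))\<^sup>2))"
    (is "has_bochner_integral _ ?E ?R")
proof -
  interpret finite_measure torus by (rule finite_measure_torus)
  define P where "P = (2*pi)\<^sup>2"
  have P: "P > 0" by (simp add: P_def)
  have [measurable]: "G \<in> borel_measurable torus" "chr k \<in> borel_measurable torus" for k
    using G chr_lebesgue by (auto intro: measurable_restrict_space1)
  have [measurable]: "(\<lambda>x. cnj (chr k x)) \<in> borel_measurable torus" for k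
    unfolding cnj_chr by measurable
  have "integrable torus (\<lambda>x. G x * cnj (chr k x))" for k
    by (rule integrable_mult_square_integrable) (auto intro: int)
  then have H2: "has_bochner_integral torus (\<lambda>x. G x * cnj (chr k x)) (c k)" for k
    unfolding c_def by (rule has_bochner_integral_integrable)
  then have H2': "has_bochner_integral torus (\<lambda>x. cnj (G x) * chr k x) (cnj (c k))" for k
    using has_bochner_integral_cnj[OF H2[of k]] by simp
  have H1: "has_bochner_integral torus (\<lambda>x. complex_of_real ((cmod (G x))\<^sup>2)) (complex_of_real (LINT x|torus. (cmod (G x))\<^sup>2))"
    by (intro has_bochner_integral_of_real has_bochner_integral_integrable int)
  have H3: "has_bochner_integral torus (\<lambda>x. chr k x * cnj (chr l x)) (if k = l then of_real P else 0)"
    if "k \<in> F" "l \<in> F" for k l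
  proof -
    have kl: "k - l \<in> int_lattice" using that F by (auto intro: int_lattice_diff)
    have "(\<lambda>x. chr k x * cnj (chr l x)) = chr (k - l)"
      using chr_add_left[of k "- l"] by (auto simp: cnj_chr)
    then show ?thesis
      using has_bochner_integral_integrable[OF integrable_chr[of "k - l"], unfolded integral_chr[OF kl]]
      by (simp only: P_def right_minus_eq)
  qed
  define S where "S x = (\<Sum>k\<in>F. b k * chr k x)" for x
  have expand: "complex_of_real (?E x) = of_real ((cmod (G x))\<^sup>2)
      - (\<Sum>k\<in>F. cnj (b k) * (G x * cnj (chr k x))) - (\<Sum>k\<in>F. b k * (cnj (G x) * chr k x))
      + (\<Sum>k\<in>F. \<Sum>l\<in>F. (b k * cnj (b l)) * (chr k x * cnj (chr l x)))" for x
  proof -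
    have "complex_of_real (?E x) = (G x - S x) * cnj (G x - S x)"
      unfolding S_def[symmetric] by (simp only: complex_norm_square)
    also have "\<dots> = G x * cnj (G x) - G x * cnj (S x) - S x * cnj (G x) + S x * cnj (S x)"
      by (simp add: algebra_simps)
    also have "G x * cnj (G x) = of_real ((cmod (G x))\<^sup>2)" by (simp only: complex_norm_square)
    also have "G x * cnj (S x) = (\<Sum>k\<in>F. cnj (b k) * (G x * cnj (chr k x)))"
      by (simp add: S_def sum_distrib_left mult.left_commute)
    also have "S x * cnj (G x) = (\<Sum>k\<in>F. b k * (cnj (G x) * chr k x))"
      by (simp add: S_def sum_distrib_left mult.left_commute mult.commute[of _ "cnj (G x)"])
    also have "S x * cnj (S x) = (\<Sum>k\<in>F. \<Sum>l\<in>F. (b k * cnj (b l)) * (chr k x * cnj (chr l x)))"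
      unfolding S_def cnj_sum sum_product by (intro sum.cong) (auto simp: ac_simps)
    finally show ?thesis .
  qed
  have "has_bochner_integral torus (\<lambda>x. complex_of_real (?E x))
     (of_real (LINT x|torus. (cmod (G x))\<^sup>2)
      - (\<Sum>k\<in>F. cnj (b k) * c k) - (\<Sum>k\<in>F. b k * cnj (c k))
      + (\<Sum>k\<in>F. \<Sum>l\<in>F. (b k * cnj (b l)) * (if k = l then of_real P else 0)))"
    unfolding expand
    by (intro has_bochner_integral_add has_bochner_integral_diff has_bochner_integral_sum
        has_bochner_integral_mult_right H1 H2 H2' H3) auto
  also have "(of_real (LINT x|torus. (cmod (G x))\<^sup>2)
      - (\<Sum>k\<in>F. cnj (b k) * c k) - (\<Sum>k\<in>F. b k * cnj (c k))
      + (\<Sum>k\<in>F. \<Sum>l\<in>F. (b k * cnj (b l)) * (if k = l then of_real P else 0)))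
     = complex_of_real ?R"
  proof -
    have *: "cnj (b k) * c k + b k * cnj (c k) - b k * cnj (b k) * of_real P
       = of_real ((cmod (c k))\<^sup>2 / P - P * (cmod (b k - c k / of_real P))\<^sup>2)" for k
    proof -
      have "complex_of_real ((cmod (c k))\<^sup>2 / P - P * (cmod (b k - c k / of_real P))\<^sup>2)
        = c k * cnj (c k) / of_real P - of_real P * ((b k - c k / of_real P) * cnj (b k - c k / of_real P))"
        by (simp only: of_real_diff of_real_divide of_real_mult complex_norm_square)
      also have "\<dots> = cnj (b k) * c k + b k * cnj (c k) - b k * cnj (b k) * of_real P"
        using P by (simp add: field_simps)
      finally show ?thesis ..
    qed
    have "(\<Sum>k\<in>F. \<Sum>l\<in>F. (b k * cnj (b l)) * (if k = l then of_real P else 0)) = (\<Sum>k\<in>F. b k * cnj (b k) * of_real P)"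
      using F by (intro sum.cong refl) (simp add: if_distrib cong: if_cong)
    then have "(of_real (LINT x|torus. (cmod (G x))\<^sup>2)
      - (\<Sum>k\<in>F. cnj (b k) * c k) - (\<Sum>k\<in>F. b k * cnj (c k))
      + (\<Sum>k\<in>F. \<Sum>l\<in>F. (b k * cnj (b l)) * (if k = l then of_real P else 0)))
      = of_real (LINT x|torus. (cmod (G x))\<^sup>2) - (\<Sum>k\<in>F. cnj (b k) * c k + b k * cnj (c k) - b k * cnj (b k) * of_real P)"
      by (simp add: sum.distrib sum_subtractf)
    also have "\<dots> = complex_of_real ?R"
      unfolding * P_def[symmetric] by (simp add: sum_subtractf sum_divide_distrib sum_distrib_left)
    finally show ?thesis .
  qed
  finally have "has_bochner_integral torus (\<lambda>x. Re (complex_of_real (?E x))) (Re (complex_of_real ?R))"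
    by (rule has_bochner_integral_Re)
  then show ?thesis by simp
qed

lemma ennreal_less_imp_less: "ennreal a < ennreal b \<Longrightarrow> a < b"
  using ennreal_leI[of b a] by (meson leD leI)

lemma Bessel_torus:
  assumes G: "G \<in> borel_measurable lebesgue" and int: "integrable torus (\<lambda>x. (cmod (G x))\<^sup>2)"
    and F: "finite F" "F \<subseteq> int_lattice"
  shows "(\<Sum>k\<in>F. (cmod (LINT x|torus. G x * cnj (chr k x)))\<^sup>2) \<le> (2*pi)\<^sup>2 * (LINT x|torus. (cmod (G x))\<^sup>2)"
proof -
  define c where "c k = (LINT x|torus. G x * cnj (chr k x))" for k
  note E = integral_square_trig_error[OF assms, of "\<lambda>k. c k / of_real ((2*pi)\<^sup>2)", folded c_def]
  have "0 \<le> (LINT x|torus. (cmod (G x))\<^sup>2) - (\<Sum>k\<in>F. (cmod (c k))\<^sup>2) / (2*pi)\<^sup>2"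
  proof -
    have "0 \<le> (LINT x|torus. (cmod (G x - (\<Sum>k\<in>F. c k / of_real ((2*pi)\<^sup>2) * chr k x)))\<^sup>2)"
      by (rule integral_nonneg_AE) simp
    then show ?thesis unfolding has_bochner_integral_integral_eq[OF E] by simp
  qed
  then show ?thesis by (simp add: c_def field_simps)
qed

lemma Parseval_torus:
  assumes G: "G \<in> borel_measurable lebesgue" and int: "integrable torus (\<lambda>x. (cmod (G x))\<^sup>2)"
  shows "(\<Sum>\<^sub>\<infinity>k\<in>int_lattice. ennreal ((cmod (LINT x|torus. G x * cnj (chr k x)))\<^sup>2))
    = ennreal ((2*pi)\<^sup>2 * (LINT x|torus. (cmod (G x))\<^sup>2))" (is "infsum (\<lambda>k. ennreal (?c k)) _ = ennreal (_ * ?N)")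
proof -
  have SUP: "infsum (\<lambda>k. ennreal (?c k)) int_lattice =
      (SUP F\<in>{F. finite F \<and> F \<subseteq> int_lattice}. \<Sum>k\<in>F. ennreal (?c k))"
    by (rule nonneg_infsum_complete) simp
  show ?thesis
  proof (rule antisym)
    show "infsum (\<lambda>k. ennreal (?c k)) int_lattice \<le> ennreal ((2*pi)\<^sup>2 * ?N)"
      unfolding SUP using Bessel_torus[OF assms] by (intro SUP_least) (auto intro!: ennreal_leI)
    show "ennreal ((2*pi)\<^sup>2 * ?N) \<le> infsum (\<lambda>k. ennreal (?c k)) int_lattice"
    proof (rule ennreal_le_epsilon)
      fix \<epsilon> :: real assume \<epsilon>: "\<epsilon> > 0"
      define \<delta> where "\<delta> = \<epsilon> / (2*pi)\<^sup>2"
      have \<delta>: "\<delta> > 0" using \<epsilon> by (simp add: \<delta>_def)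
      obtain q where q: "q \<in> trig_polys" "sqdist torus G q < ennreal \<delta>"
        using trig_polys_dense[OF assms \<delta>] by blast
      obtain F b where F: "finite F" "F \<subseteq> int_lattice" "q = (\<lambda>x. \<Sum>k\<in>F. b k * chr k x)"
        using q(1) by (auto simp: trig_polys_def)
      note E = integral_square_trig_error[OF assms F(1,2), of b]
      have "sqdist torus G q = ennreal (?N - (\<Sum>k\<in>F. ?c k) / (2*pi)\<^sup>2
        + (2*pi)\<^sup>2 * (\<Sum>k\<in>F. (cmod (b k - (LINT x|torus. G x * cnj (chr k x)) / of_real ((2*pi)\<^sup>2)))\<^sup>2))"
        (is "_ = ennreal ?R")
      proof -
        have "sqdist torus G q = ennreal (LINT x|torus. (cmod (G x - (\<Sum>k\<in>F. b k * chr k x)))\<^sup>2)"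
          unfolding sqdist_def F(3) by (rule nn_integral_eq_integral[OF integrable.intros[OF E]]) simp
        then show ?thesis by (simp only: has_bochner_integral_integral_eq[OF E])
      qed
      then have "ennreal ?R < ennreal \<delta>" using q(2) by (rule subst)
      then have "?R < \<delta>" by (rule ennreal_less_imp_less)
      moreover have "0 \<le> (2*pi)\<^sup>2 * (\<Sum>k\<in>F. (cmod (b k - (LINT x|torus. G x * cnj (chr k x)) / of_real ((2*pi)\<^sup>2)))\<^sup>2)"
        by (intro mult_nonneg_nonneg sum_nonneg) auto
      ultimately have "?N - (\<Sum>k\<in>F. ?c k) / (2*pi)\<^sup>2 < \<delta>" by linarith
      then have "(2*pi)\<^sup>2 * (?N - (\<Sum>k\<in>F. ?c k) / (2*pi)\<^sup>2) < (2*pi)\<^sup>2 * \<delta>"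
        by (intro mult_strict_left_mono) simp_all
      then have "(2*pi)\<^sup>2 * ?N < (\<Sum>k\<in>F. ?c k) + \<epsilon>"
        by (simp add: \<delta>_def right_diff_distrib)
      then have "ennreal ((2*pi)\<^sup>2 * ?N) \<le> ennreal ((\<Sum>k\<in>F. ?c k) + \<epsilon>)"
        by (intro ennreal_leI) simp
      also have "\<dots> = (\<Sum>k\<in>F. ennreal (?c k)) + ennreal \<epsilon>"
        using \<epsilon> by (subst ennreal_plus) (auto simp: sum_nonneg)
      also have "(\<Sum>k\<in>F. ennreal (?c k)) \<le> infsum (\<lambda>k. ennreal (?c k)) int_lattice"
        unfolding SUP using F by (intro SUP_upper) auto
      finally show "ennreal ((2*pi)\<^sup>2 * ?N) \<le> infsum (\<lambda>k. ennreal (?c k)) int_lattice + ennreal \<epsilon>"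
        by (simp add: add_mono)
    qed
  qed
qed

section \<open>The energy of the shifts of one generator\<close>

lemma borel_measurable_cnj [measurable (raw), simp]:
  "f \<in> borel_measurable M \<Longrightarrow> (\<lambda>x. cnj (f x)) \<in> borel_measurable M"
  by (rule borel_measurable_continuous_on) (intro continuous_intros)

text \<open>Makes Fatou's lemma and the linearity of the integral available for sums over the lattice.\<close>

lemma infsum_ennreal_conv_nn_integral:
  fixes f :: "'a \<Rightarrow> ennreal"
  assumes "countable A"
  shows "infsum f A = (\<integral>\<^sup>+x. f x \<partial>count_space A)"
proof -
  have SUP: "infsum f A = (SUP F\<in>{F. finite F \<and> F \<subseteq> A}. sum f F)"
    by (rule nonneg_infsum_complete) simp
  have fin: "sum f F \<le> (\<integral>\<^sup>+x. f x \<partial>count_space A)" if "finite F" "F \<subseteq> A" for F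
  proof -
    have "sum f F = (\<Sum>x\<in>F. f x * indicator F x)" by (intro sum.cong) auto
    also have "\<dots> = (\<integral>\<^sup>+x. f x * indicator F x \<partial>count_space A)"
      by (rule nn_integral_count_space'[symmetric]) (use that in auto)
    also have "\<dots> \<le> (\<integral>\<^sup>+x. f x \<partial>count_space A)"
      by (intro nn_integral_mono) (auto simp: indicator_def)
    finally show ?thesis .
  qed
  show ?thesis
  proof (rule antisym)
    show "infsum f A \<le> (\<integral>\<^sup>+x. f x \<partial>count_space A)"
      unfolding SUP using fin by (intro SUP_least) auto
    show "(\<integral>\<^sup>+x. f x \<partial>count_space A) \<le> infsum f A"
    proof (cases "finite A")
      case True
      then show ?thesis by (simp add: nn_integral_count_space_finite)
    next
      case False
      then have bij: "bij_betw (from_nat_into A) UNIV A"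
        using assms by (rule bij_betw_from_nat_into[rotated])
      have "(\<integral>\<^sup>+x. f x \<partial>count_space A) = (\<integral>\<^sup>+n. f (from_nat_into A n) \<partial>count_space UNIV)"
        by (rule nn_integral_bij_count_space[OF bij, symmetric])
      also have "\<dots> = (SUP n. \<Sum>i<n. f (from_nat_into A i))"
        by (simp add: nn_integral_count_space_nat suminf_eq_SUP)
      also have "\<dots> \<le> infsum f A"
      proof (rule SUP_least)
        fix n
        have "(\<Sum>i<n. f (from_nat_into A i)) = sum f (from_nat_into A ` {..<n})"
          using bij by (subst sum.reindex) (auto simp: bij_betw_def intro: inj_on_subset)
        also have "\<dots> \<le> infsum f A"
          unfolding SUP using bij by (intro SUP_upper) (auto simp: bij_betw_def)
        finally show "(\<Sum>i<n. f (from_nat_into A i)) \<le> infsum f A" .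
      qed
      finally show ?thesis .
    qed
  qed
qed

lemma square_integrable_sum:
  fixes u :: "'i \<Rightarrow> 'a \<Rightarrow> complex"
  assumes "finite I" "\<And>i. i \<in> I \<Longrightarrow> u i \<in> borel_measurable M"
    and "\<And>i. i \<in> I \<Longrightarrow> integrable M (\<lambda>x. (cmod (u i x))\<^sup>2)"
  shows "integrable M (\<lambda>x. (cmod (\<Sum>i\<in>I. u i x))\<^sup>2)"
  using assms
proof (induction I rule: finite_induct)
  case (insert i I)
  then show ?case
    using square_integrable_add[of "u i" M "\<lambda>x. \<Sum>i\<in>I. u i x"] by simp
qed simp

lemma integrable_square_bounded_support:
  fixes g :: "real^2 \<Rightarrow> complex"
  assumes g: "g \<in> borel_measurable lebesgue" "integrable lebesgue (\<lambda>x. (cmod (g x))\<^sup>2)"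
    and supp: "\<And>x. g x \<noteq> 0 \<Longrightarrow> norm x \<le> R"
  shows "integrable lebesgue g"
proof (rule Bochner_Integration.integrable_bound)
  show "integrable lebesgue (\<lambda>x. indicator (cball 0 R) x + (cmod (g x))\<^sup>2)"
    using g(2) by (intro Bochner_Integration.integrable_add)
      (use emeasure_bounded_finite[OF bounded_cball, of "0 :: real^2" R] in
        \<open>simp_all add: integrable_indicator_iff\<close>)
  show "AE x in lebesgue. norm (g x) \<le> norm (indicator (cball 0 R) x + (cmod (g x))\<^sup>2)"
  proof (rule AE_I2)
    fix x
    show "norm (g x) \<le> norm (indicator (cball 0 R) x + (cmod (g x))\<^sup>2)"
    proof (cases "g x = 0")
      case False
      then have "indicat_real (cball 0 R) x = 1" using supp by simp
      moreover have "2 * cmod (g x) \<le> 1 + (cmod (g x))\<^sup>2"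
        using sum_squares_bound[of 1 "cmod (g x)"] by simp
      then have "cmod (g x) \<le> 1 + (cmod (g x))\<^sup>2"
        using norm_ge_zero[of "g x"] by linarith
      ultimately show ?thesis by simp
    qed simp
  qed
qed (rule g(1))

text \<open>The integrals against characters are the Fourier coefficients of the periodisation \<open>G\<close> of \<open>g\<close>.
  Expanding the square of \<open>G\<close> and undoing the periodisation in one of the two indices leaves the
  autocorrelations of \<open>g\<close> at the lattice points.\<close>

proposition Parseval_plane:
  fixes g :: "real^2 \<Rightarrow> complex"
  assumes gm: "g \<in> borel_measurable lebesgue" and gi: "integrable lebesgue (\<lambda>x. (cmod (g x))\<^sup>2)"
    and supp: "\<And>x. g x \<noteq> 0 \<Longrightarrow> norm x \<le> R"
    and N: "finite N" "N \<subseteq> int_lattice"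
    and van: "\<And>n x. n \<in> int_lattice - N \<Longrightarrow> g x * cnj (g (x + (2*pi) *\<^sub>R n)) = 0"
  obtains q where "q \<ge> 0"
    "(\<Sum>\<^sub>\<infinity>k\<in>int_lattice. ennreal ((cmod (LINT x|lebesgue. g x * chr k x))\<^sup>2)) = ennreal q"
    "complex_of_real q = of_real ((2*pi)\<^sup>2) *
       (\<Sum>n\<in>N. LINT x|lebesgue. g x * cnj (g (x + (2*pi) *\<^sub>R n)))"
proof -
  define \<rho> where "\<rho> = \<bar>R\<bar> + 1"
  \<comment> \<open>N0 indexes the cells that the support of g can meet, and D contains all differences of such indices.\<close>
  define N0 where "N0 = int_lattice \<inter> cball 0 \<rho>"
  define D where "D = N \<union> (int_lattice \<inter> cball 0 (2*\<rho>))"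
  have N0: "finite N0" "N0 \<subseteq> int_lattice"
    unfolding N0_def by (auto intro: finite_int_lattice_Int_bounded)
  have D: "finite D" "D \<subseteq> int_lattice" "N \<subseteq> D"
    unfolding D_def using N by (auto intro: finite_int_lattice_Int_bounded)
  have g0: "g (x + (2*pi) *\<^sub>R n) = 0" if n: "n \<in> int_lattice - N0" and x: "x \<in> cell" for n x
  proof (rule ccontr)
    assume "g (x + (2*pi) *\<^sub>R n) \<noteq> 0"
    then have "norm (x + (2*pi) *\<^sub>R n) \<le> R" by (rule supp)
    then have "2*pi * norm n \<le> R + 2*pi"
      using norm_triangle_ineq4[of "x + (2*pi) *\<^sub>R n" x] norm_cell[OF x] by simp
    also have "R \<le> 2*pi * \<bar>R\<bar>"
      using pi_ge_two mult_right_mono[of 1 "2*pi" "\<bar>R\<bar>"] by simp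
    finally have "2*pi * norm n \<le> 2*pi * \<rho>" by (simp add: \<rho>_def algebra_simps)
    then have "norm n \<le> \<rho>" by simp
    then show False using n by (simp add: N0_def)
  qed
  define gt where "gt m x = g (x + (2*pi) *\<^sub>R m)" for m x
  define G where "G x = (\<Sum>m\<in>N0. gt m x)" for x
  have gtm: "gt m \<in> borel_measurable lebesgue" for m
    unfolding gt_def[abs_def] by (rule borel_measurable_translate[OF gm])
  have gti: "integrable lebesgue (\<lambda>x. (cmod (gt m x))\<^sup>2)" for m
    unfolding gt_def using integrable_translate_iff[of "\<lambda>x. (cmod (g x))\<^sup>2"] gm gi by simp
  have Gm: "G \<in> borel_measurable lebesgue"
    unfolding G_def[abs_def] using gtm by (intro borel_measurable_sum)
  have toT: "integrable torus F" if "integrable lebesgue F" for F :: "real^2 \<Rightarrow> 'b::{banach,second_countable_topology}"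
    using that by (subst integrable_restrict_space) (auto intro: integrable_mult_indicator)
  have Gi: "integrable torus (\<lambda>x. (cmod (G x))\<^sup>2)"
    unfolding G_def by (intro square_integrable_sum N0 toT gti measurable_restrict_space1 gtm)
  have prod_int: "integrable lebesgue (\<lambda>x. gt m x * cnj (gt m' x))" for m m'
    using gtm gti by (intro integrable_mult_square_integrable) auto
  have gint: "integrable lebesgue g" by (rule integrable_square_bounded_support[OF gm gi supp])
  have coeff: "(LINT x|lebesgue. g x * chr k x) = (LINT x|torus. G x * chr k x)"
    if k: "k \<in> int_lattice" for k
  proof -
    have int: "integrable lebesgue (\<lambda>x. g x * chr k x)"
      using gm chr_lebesgue[of k]
      by (intro Bochner_Integration.integrable_bound[OF gint]) (auto simp: norm_mult)
    note per = integral_periodize[OF int N0]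
    have "(LINT x|lebesgue. g x * chr k x) =
        (\<Sum>m\<in>N0. LINT x|torus. g (x + (2*pi) *\<^sub>R m) * chr k (x + (2*pi) *\<^sub>R m))"
      by (rule per(2)) (simp add: g0)
    also have "\<dots> = (LINT x|torus. (\<Sum>m\<in>N0. g (x + (2*pi) *\<^sub>R m) * chr k (x + (2*pi) *\<^sub>R m)))"
      by (intro Bochner_Integration.integral_sum[symmetric] per(1)) (simp add: g0)
    also have "\<dots> = (LINT x|torus. G x * chr k x)"
      using k N0 by (intro Bochner_Integration.integral_cong refl)
        (auto simp: G_def gt_def sum_distrib_right chr_periodic subset_iff intro!: sum.cong)
    finally show ?thesis .
  qed
  define q where "q = (2*pi)\<^sup>2 * (LINT x|torus. (cmod (G x))\<^sup>2)"
  show ?thesis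
  proof
    show "q \<ge> 0" by (simp add: q_def)
    have "(\<Sum>\<^sub>\<infinity>k\<in>int_lattice. ennreal ((cmod (LINT x|lebesgue. g x * chr k x))\<^sup>2))
        = (\<Sum>\<^sub>\<infinity>k\<in>int_lattice. ennreal ((cmod (LINT x|torus. G x * cnj (chr (- k) x)))\<^sup>2))"
      by (intro infsum_cong) (simp add: coeff cnj_chr)
    also have "\<dots> = (\<Sum>\<^sub>\<infinity>k\<in>int_lattice. ennreal ((cmod (LINT x|torus. G x * cnj (chr k x)))\<^sup>2))"
    proof (rule infsum_reindex_bij_betw)
      show "bij_betw uminus int_lattice int_lattice"
        by (rule bij_betwI[where g = uminus]) (auto intro: int_lattice_minus)
    qed
    also have "\<dots> = ennreal q"
      unfolding q_def by (rule Parseval_torus[OF Gm Gi])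
    finally show "(\<Sum>\<^sub>\<infinity>k\<in>int_lattice. ennreal ((cmod (LINT x|lebesgue. g x * chr k x))\<^sup>2)) = ennreal q" .
    define I where "I m m' = (LINT x|torus. gt m x * cnj (gt m' x))" for m m'
    have I0: "I m m' = 0" if "m' \<in> int_lattice - N0" for m m'
    proof -
      have "I m m' = (LINT x|torus. 0)"
        unfolding I_def by (rule Bochner_Integration.integral_cong) (use that g0 in \<open>auto simp: gt_def\<close>)
      then show ?thesis by simp
    qed
    have "complex_of_real (LINT x|torus. (cmod (G x))\<^sup>2) = (LINT x|torus. G x * cnj (G x))"
      by (simp only: integral_complex_of_real[symmetric] complex_norm_square)
    also have "\<dots> = (LINT x|torus. (\<Sum>m\<in>N0. \<Sum>m'\<in>N0. gt m x * cnj (gt m' x)))"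
      by (simp add: G_def sum_product)
    also have "\<dots> = (\<Sum>m\<in>N0. \<Sum>m'\<in>N0. I m m')"
      unfolding I_def by (subst Bochner_Integration.integral_sum, (intro Bochner_Integration.integrable_sum toT prod_int),
        intro sum.cong refl Bochner_Integration.integral_sum toT prod_int)
    also have "\<dots> = (\<Sum>m\<in>N0. \<Sum>n\<in>D. I m (m + n))"
    proof (rule sum.cong[OF refl])
      fix m assume m: "m \<in> N0"
      have "(\<Sum>n\<in>D. I m (m + n)) = (\<Sum>m'\<in>(+) m ` D. I m m')"
        by (subst sum.reindex) (auto simp: o_def)
      also have "\<dots> = (\<Sum>m'\<in>N0. I m m')"
      proof (rule sum.mono_neutral_right)
        show "N0 \<subseteq> (+) m ` D"
        proof
          fix m' assume m': "m' \<in> N0"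
          have "norm (m' - m) \<le> 2*\<rho>"
            using norm_triangle_ineq4[of m' m] m m' by (simp add: N0_def)
          then have "m' - m \<in> D" using m m' N0(2) by (auto simp: D_def intro: int_lattice_diff)
          then show "m' \<in> (+) m ` D" by (intro image_eqI[of _ _ "m' - m"]) auto
        qed
        show "\<forall>i\<in>(+) m ` D - N0. I m i = 0"
          using D(2) N0(2) m by (auto intro!: I0 int_lattice_add)
      qed (use D in auto)
      finally show "(\<Sum>m'\<in>N0. I m m') = (\<Sum>n\<in>D. I m (m + n))" ..
    qed
    also have "\<dots> = (\<Sum>n\<in>D. \<Sum>m\<in>N0. I m (m + n))" by (rule sum.swap)
    also have "\<dots> = (\<Sum>n\<in>D. LINT x|lebesgue. g x * cnj (g (x + (2*pi) *\<^sub>R n)))"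
    proof (intro sum.cong refl)
      fix n
      have int: "integrable lebesgue (\<lambda>x. g x * cnj (g (x + (2*pi) *\<^sub>R n)))"
        using prod_int[of 0 n] by (simp add: gt_def)
      have "(LINT x|lebesgue. g x * cnj (g (x + (2*pi) *\<^sub>R n))) =
         (\<Sum>m\<in>N0. LINT x|torus. g (x + (2*pi) *\<^sub>R m) * cnj (g (x + (2*pi) *\<^sub>R m + (2*pi) *\<^sub>R n)))"
        by (rule integral_periodize(2)[OF int N0]) (simp add: g0)
      also have "\<dots> = (\<Sum>m\<in>N0. I m (m + n))"
        by (simp add: I_def gt_def scaleR_add_right add.assoc)
      finally show "(\<Sum>m\<in>N0. I m (m + n)) = (LINT x|lebesgue. g x * cnj (g (x + (2*pi) *\<^sub>R n)))" ..
    qed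
    also have "\<dots> = (\<Sum>n\<in>N. LINT x|lebesgue. g x * cnj (g (x + (2*pi) *\<^sub>R n)))"
    proof (rule sum.mono_neutral_right)
      show "\<forall>n\<in>D - N. (LINT x|lebesgue. g x * cnj (g (x + (2*pi) *\<^sub>R n))) = 0"
      proof
        fix n assume "n \<in> D - N"
        then have "(\<lambda>x. g x * cnj (g (x + (2*pi) *\<^sub>R n))) = (\<lambda>x. 0)"
          using van[of n] D(2) by blast
        then show "(LINT x|lebesgue. g x * cnj (g (x + (2*pi) *\<^sub>R n))) = 0" by simp
      qed
    qed (use D in auto)
    finally show "complex_of_real q = of_real ((2*pi)\<^sup>2) *
       (\<Sum>n\<in>N. LINT x|lebesgue. g x * cnj (g (x + (2*pi) *\<^sub>R n)))"
      by (simp only: q_def of_real_mult)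
  qed
qed

definition test_fun :: "(real^2 \<Rightarrow> complex) \<Rightarrow> bool" where
  "test_fun f \<longleftrightarrow> f \<in> borel_measurable lebesgue \<and> (\<exists>C. \<forall>x. cmod (f x) \<le> C) \<and>
     (\<exists>R. \<forall>x. f x \<noteq> 0 \<longrightarrow> norm x \<le> R)"

definition autocorr :: "(real^2 \<Rightarrow> complex) \<Rightarrow> real^2 \<Rightarrow> real^2 \<Rightarrow> complex" where
  "autocorr f k x = f x * cnj (f (x + (2*pi) *\<^sub>R k))"

text \<open>The contribution of one generator and one matrix to the pointwise identity belonging to \<open>k\<close>.\<close>

definition lat_prod :: "(real^2 \<Rightarrow> complex) \<Rightarrow> real^2^2 \<Rightarrow> real^2 \<Rightarrow> real^2 \<Rightarrow> complex" where
  "lat_prod h U k x =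
     (if U *v k \<in> int_lattice then cnj (h (U *v x)) * h (U *v (x + (2*pi) *\<^sub>R k)) else 0)"

lemma L2_loc_mult_test:
  assumes h: "L2_loc h" and f: "test_fun f"
  shows "(\<lambda>x. f x * h x) \<in> borel_measurable lebesgue"
    and "integrable lebesgue (\<lambda>x. (cmod (f x * h x))\<^sup>2)"
proof -
  have [measurable]: "h \<in> borel_measurable lebesgue" "f \<in> borel_measurable lebesgue"
    using h f by (auto simp: L2_loc_def test_fun_def)
  show "(\<lambda>x. f x * h x) \<in> borel_measurable lebesgue" by measurable
  obtain C R where C: "\<And>x. cmod (f x) \<le> C" and R: "\<And>x. f x \<noteq> 0 \<Longrightarrow> norm x \<le> R"
    using f by (auto simp: test_fun_def)
  have "integrable lebesgue (\<lambda>x. indicator (cball 0 R) x *\<^sub>R (cmod (h x))\<^sup>2)"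
    using h by (simp add: L2_loc_def set_integrable_def)
  then have int: "integrable lebesgue (\<lambda>x. C\<^sup>2 * (indicator (cball 0 R) x *\<^sub>R (cmod (h x))\<^sup>2))"
    by simp
  show "integrable lebesgue (\<lambda>x. (cmod (f x * h x))\<^sup>2)"
  proof (rule Bochner_Integration.integrable_bound[OF int])
    show "AE x in lebesgue. norm ((cmod (f x * h x))\<^sup>2) \<le> norm (C\<^sup>2 * (indicator (cball 0 R) x *\<^sub>R (cmod (h x))\<^sup>2))"
    proof (rule AE_I2)
      fix x
      show "norm ((cmod (f x * h x))\<^sup>2) \<le> norm (C\<^sup>2 * (indicator (cball 0 R) x *\<^sub>R (cmod (h x))\<^sup>2))"
      proof (cases "f x = 0")
        case False
        then have "indicat_real (cball 0 R) x = 1" using R by simp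
        moreover have "(cmod (f x))\<^sup>2 \<le> C\<^sup>2" using C by (intro power_mono) auto
        ultimately show ?thesis by (simp add: norm_mult power_mult_distrib mult_right_mono)
      qed simp
    qed
  qed measurable
qed

lemma L2_loc_linear:
  assumes U: "det U \<noteq> 0" and h: "L2_loc h"
  shows "L2_loc (\<lambda>x. h (U *v x))"
  unfolding L2_loc_def
proof (intro conjI allI impI)
  have hm: "h \<in> borel_measurable lebesgue" using h by (simp add: L2_loc_def)
  show m: "(\<lambda>x. h (U *v x)) \<in> borel_measurable lebesgue"
    using borel_measurable_matrix_affine[OF U hm, of 0] by simp
  fix K :: "(real^2) set" assume K: "compact K"
  have cK: "compact ((*v) U ` K)"
    by (intro compact_continuous_image linear_continuous_on K) simp
  have int: "integrable lebesgue (\<lambda>y. indicator ((*v) U ` K) y *\<^sub>R (cmod (h y))\<^sup>2)"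
    using h cK by (simp add: L2_loc_def set_integrable_def)
  have inj: "inj ((*v) U)" using U by (simp add: invertible_det_nz[symmetric] inj_matrix_vector_mult)
  have "(\<lambda>x. indicator ((*v) U ` K) (0 + U *v x) *\<^sub>R (cmod (h (0 + U *v x)))\<^sup>2)
      = (\<lambda>x. indicator K x *\<^sub>R (cmod (h (U *v x)))\<^sup>2)"
    using inj by (auto simp: fun_eq_iff indicator_def inj_image_mem_iff)
  then show "set_integrable lebesgue K (\<lambda>x. (cmod (h (U *v x)))\<^sup>2)"
    using iffD2[OF integrable_matrix_affine_iff[OF U, of _ 0] int] int
    by (auto simp: set_integrable_def)
qed

lemma lat_prod_integrable:
  assumes U: "det U \<noteq> 0" and h: "L2_loc h" and f: "test_fun f"
  shows "integrable lebesgue (\<lambda>x. autocorr f k x * lat_prod h U k x)"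
proof (cases "U *v k \<in> int_lattice")
  case True
  define H where "H x = h (U *v x)" for x
  have H: "L2_loc H" unfolding H_def[abs_def] by (rule L2_loc_linear[OF U h])
  define g where "g x = f x * cnj (H x)" for x
  have cH: "L2_loc (\<lambda>x. cnj (H x))" using H by (simp add: L2_loc_def)
  have g: "g \<in> borel_measurable lebesgue" "integrable lebesgue (\<lambda>x. (cmod (g x))\<^sup>2)"
    unfolding g_def[abs_def] by (rule L2_loc_mult_test[OF cH f])+
  have "integrable lebesgue (\<lambda>x. g x * cnj (g (x + (2*pi) *\<^sub>R k)))"
    using g integrable_translate_iff[of "\<lambda>x. (cmod (g x))\<^sup>2"]
      borel_measurable_translate[of g] by (intro integrable_mult_square_integrable) auto
  also have "(\<lambda>x. g x * cnj (g (x + (2*pi) *\<^sub>R k))) = (\<lambda>x. autocorr f k x * lat_prod h U k x)"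
    using True by (auto simp: autocorr_def lat_prod_def g_def H_def fun_eq_iff)
  finally show ?thesis .
qed (simp add: lat_prod_def)

abbreviation shift_energy ::
    "(real^2 \<Rightarrow> complex) \<Rightarrow> (real^2 \<Rightarrow> complex) \<Rightarrow> real^2^2 \<Rightarrow> ennreal" where
  "shift_energy f h U \<equiv>
     (\<Sum>\<^sub>\<infinity>k\<in>int_lattice. ennreal ((cmod (L2_inner f (dil_mod h U k)))\<^sup>2))"

text \<open>Substituting \<open>y = U x\<close> reduces to the case of the identity matrix, which is Parseval's identity on the
  plane for \<open>y \<mapsto> f (U\<^sup>-\<^sup>1 y) * cnj (h y)\<close>. Indexing by \<open>k = U\<^sup>-\<^sup>1 n\<close> instead of the
  lattice points \<open>n\<close> allows one index set \<open>K\<close> to serve all matrices of the system at once.\<close>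

proposition dilated_shift_energy:
  assumes U: "det U \<noteq> 0" and h: "L2_loc h" and f: "test_fun f"
    and K: "finite K" "\<And>k. U *v k \<in> int_lattice \<Longrightarrow> k \<notin> K \<Longrightarrow> autocorr f k = (\<lambda>x. 0)"
  obtains q where "q \<ge> 0"
    "shift_energy f h U = ennreal q"
    "complex_of_real q = of_real ((2*pi)\<^sup>2) *
       (\<Sum>k\<in>K. LINT x|lebesgue. autocorr f k x * lat_prod h U k x)"
proof -
  obtain V where VU: "V ** U = mat 1" "U ** V = mat 1"
    using U by (auto simp: invertible_det_nz[symmetric] invertible_def)
  have detVU: "det V * det U = 1" using VU(1) by (metis det_I det_mul)
  then have detV: "det V \<noteq> 0" by auto
  have VU': "V *v (U *v x) = x" "U *v (V *v x) = x" for x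
    by (simp_all add: matrix_vector_mul_assoc VU)
  define g where "g x = f x * cnj (h (U *v x))" for x
  have cH: "L2_loc (\<lambda>x. cnj (h (U *v x)))"
    using L2_loc_linear[OF U h] by (simp add: L2_loc_def)
  have gm: "g \<in> borel_measurable lebesgue" and gi: "integrable lebesgue (\<lambda>x. (cmod (g x))\<^sup>2)"
    unfolding g_def[abs_def] by (rule L2_loc_mult_test[OF cH f])+
  define g' where "g' y = g (V *v y)" for y
  have g'm: "g' \<in> borel_measurable lebesgue"
    unfolding g'_def[abs_def] using borel_measurable_matrix_affine[OF detV gm, of 0] by simp
  have g'i: "integrable lebesgue (\<lambda>x. (cmod (g' x))\<^sup>2)"
    unfolding g'_def using integrable_matrix_affine_iff[OF detV, of "\<lambda>x. (cmod (g x))\<^sup>2" 0] gm gi by simp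
  obtain R where R: "\<And>x. f x \<noteq> 0 \<Longrightarrow> norm x \<le> R"
    using f by (auto simp: test_fun_def)
  obtain B where B: "\<And>x. norm (U *v x) \<le> norm x * B" "B > 0"
    using bounded_linear.pos_bounded[of "(*v) U"] by (auto simp: matrix_vector_mul_bounded_linear)
  have supp: "norm y \<le> R * B" if "g' y \<noteq> 0" for y
  proof -
    have "norm (V *v y) \<le> R" using that R by (simp add: g'_def g_def)
    then have "norm (V *v y) * B \<le> R * B" using B(2) by simp
    then show ?thesis using B(1)[of "V *v y"] by (simp add: VU')
  qed
  define N where "N = {n \<in> int_lattice. V *v n \<in> K}"
  have N: "finite N" "N \<subseteq> int_lattice"
  proof -
    have "N \<subseteq> (*v) U ` K" unfolding N_def using VU'(2) by (auto intro: image_eqI[of _ _ "V *v _"])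
    then show "finite N" using K(1) finite_subset by blast
  qed (auto simp: N_def)
  have gg: "g x * cnj (g (x + (2*pi) *\<^sub>R k)) = autocorr f k x * (cnj (h (U *v x)) * h (U *v (x + (2*pi) *\<^sub>R k)))" for x k
    by (simp add: g_def autocorr_def)
  have shift: "g' y * cnj (g' (y + (2*pi) *\<^sub>R n)) = g (V *v y) * cnj (g (V *v y + (2*pi) *\<^sub>R (V *v n)))" for y n
    by (simp add: g'_def matrix_vector_right_distrib matrix_vector_mult_scaleR)
  have van: "g' x * cnj (g' (x + (2*pi) *\<^sub>R n)) = 0" if "n \<in> int_lattice - N" for n x
    unfolding shift gg using K(2)[of "V *v n"] that by (simp add: N_def VU')
  obtain q where q: "q \<ge> 0"
    "(\<Sum>\<^sub>\<infinity>k\<in>int_lattice. ennreal ((cmod (LINT x|lebesgue. g' x * chr k x))\<^sup>2)) = ennreal q"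
    "complex_of_real q = of_real ((2*pi)\<^sup>2) *
       (\<Sum>n\<in>N. LINT x|lebesgue. g' x * cnj (g' (x + (2*pi) *\<^sub>R n)))"
    by (rule Parseval_plane[OF g'm g'i supp N van]) blast
  show ?thesis
  proof
    show "\<bar>det V\<bar> * q \<ge> 0" using q(1) by simp
    have inner: "L2_inner f (dil_mod h U k) =
        of_real (sqrt \<bar>det U\<bar> * \<bar>det V\<bar>) * (LINT y|lebesgue. g' y * chr k y)" for k
    proof -
      have kU: "(\<lambda>x. chr k (U *v x)) \<in> borel_measurable lebesgue"
        using borel_measurable_matrix_affine[OF U chr_lebesgue[of k], of 0] by simp
      have pm: "(\<lambda>x. g x * chr k (U *v x)) \<in> borel_measurable lebesgue"
        using gm kU by measurable
      have "L2_inner f (dil_mod h U k) =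
          (LINT x|lebesgue. of_real (sqrt \<bar>det U\<bar>) * (g x * chr k (U *v x)))"
        unfolding L2_inner_def
        by (intro Bochner_Integration.integral_cong refl)
          (simp add: dil_mod_def g_def chr_def cis_conv_exp exp_cnj)
      also have "\<dots> = of_real (sqrt \<bar>det U\<bar>) * (LINT x|lebesgue. g x * chr k (U *v x))"
        by simp
      also have "(LINT x|lebesgue. g x * chr k (U *v x)) =
          \<bar>det V\<bar> *\<^sub>R (LINT y|lebesgue. g' y * chr k y)"
        using integral_matrix_affine[OF detV pm, of 0] by (simp add: g'_def VU')
      finally show ?thesis by (simp add: scaleR_conv_of_real)
    qed
    have "\<bar>det U\<bar> * \<bar>det V\<bar> = 1"
      by (metis abs_mult abs_one detVU mult.commute)
    moreover have "(sqrt a * b)\<^sup>2 = (a * b) * b" if "a \<ge> 0" for a b :: real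
      using that by (simp add: power_mult_distrib power2_eq_square)
    ultimately have sq: "(sqrt \<bar>det U\<bar> * \<bar>det V\<bar>)\<^sup>2 = \<bar>det V\<bar>"
      by (metis abs_ge_zero mult_1)
    have "cmod (L2_inner f (dil_mod h U k)) =
        (sqrt \<bar>det U\<bar> * \<bar>det V\<bar>) * cmod (LINT y|lebesgue. g' y * chr k y)" for k
      by (simp add: inner norm_mult)
    then have "(cmod (L2_inner f (dil_mod h U k)))\<^sup>2 =
        \<bar>det V\<bar> * (cmod (LINT y|lebesgue. g' y * chr k y))\<^sup>2" for k
      by (simp only: power_mult_distrib[of "sqrt \<bar>det U\<bar> * \<bar>det V\<bar>"] sq)
    then have "shift_energy f h U
       = (\<Sum>\<^sub>\<infinity>k\<in>int_lattice. ennreal \<bar>det V\<bar> * ennreal ((cmod (LINT y|lebesgue. g' y * chr k y))\<^sup>2))"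
      by (simp add: ennreal_mult)
    also have "\<dots> = ennreal \<bar>det V\<bar> * (\<Sum>\<^sub>\<infinity>k\<in>int_lattice. ennreal ((cmod (LINT y|lebesgue. g' y * chr k y))\<^sup>2))"
      by (simp add: infsum_ennreal_conv_nn_integral countable_int_lattice nn_integral_cmult)
    also have "\<dots> = ennreal (\<bar>det V\<bar> * q)"
      using q by (simp add: ennreal_mult)
    finally show "shift_energy f h U = ennreal (\<bar>det V\<bar> * q)" .
    have pull: "\<bar>det V\<bar> *\<^sub>R (LINT x|lebesgue. g' x * cnj (g' (x + (2*pi) *\<^sub>R n)))
        = (LINT x|lebesgue. autocorr f (V *v n) x * lat_prod h U (V *v n) x)" if n: "n \<in> N" for n
    proof -
      have pm: "(\<lambda>x. g x * cnj (g (x + (2*pi) *\<^sub>R (V *v n)))) \<in> borel_measurable lebesgue"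
        using gm borel_measurable_translate[OF gm] by measurable
      have "\<bar>det V\<bar> *\<^sub>R (LINT x|lebesgue. g' x * cnj (g' (x + (2*pi) *\<^sub>R n)))
         = (LINT x|lebesgue. g x * cnj (g (x + (2*pi) *\<^sub>R (V *v n))))"
        unfolding shift using integral_matrix_affine[OF detV pm, of 0] by simp
      also have "\<dots> = (LINT x|lebesgue. autocorr f (V *v n) x * lat_prod h U (V *v n) x)"
        unfolding gg using n by (simp add: lat_prod_def N_def VU')
      finally show ?thesis .
    qed
    have "(\<Sum>n\<in>N. LINT x|lebesgue. autocorr f (V *v n) x * lat_prod h U (V *v n) x)
       = (\<Sum>k\<in>(*v) V ` N. LINT x|lebesgue. autocorr f k x * lat_prod h U k x)"
      using VU'(2) by (subst sum.reindex) (auto simp: o_def intro!: inj_on_inverseI[where g = "(*v) U"])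
    also have "\<dots> = (\<Sum>k\<in>K. LINT x|lebesgue. autocorr f k x * lat_prod h U k x)"
    proof (rule sum.mono_neutral_left)
      show "(*v) V ` N \<subseteq> K" by (auto simp: N_def)
      show "\<forall>k\<in>K - (*v) V ` N. (LINT x|lebesgue. autocorr f k x * lat_prod h U k x) = 0"
      proof
        fix k assume k: "k \<in> K - (*v) V ` N"
        have "U *v k \<notin> int_lattice"
        proof
          assume "U *v k \<in> int_lattice"
          then have "U *v k \<in> N" using k by (simp add: N_def VU')
          then have "V *v (U *v k) \<in> (*v) V ` N" by blast
          then show False using k by (simp add: VU')
        qed
        then show "(LINT x|lebesgue. autocorr f k x * lat_prod h U k x) = 0"
          by (simp add: lat_prod_def)
      qed
    qed (rule K)
    finally have "(\<Sum>k\<in>K. LINT x|lebesgue. autocorr f k x * lat_prod h U k x)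
       = (\<Sum>n\<in>N. \<bar>det V\<bar> *\<^sub>R (LINT x|lebesgue. g' x * cnj (g' (x + (2*pi) *\<^sub>R n))))"
      using pull by simp
    then show "complex_of_real (\<bar>det V\<bar> * q) = of_real ((2*pi)\<^sup>2) *
       (\<Sum>k\<in>K. LINT x|lebesgue. autocorr f k x * lat_prod h U k x)"
      using q(3) by (simp add: scaleR_conv_of_real sum_distrib_left mult.left_commute)
  qed
qed

section \<open>The frame sum of a test function\<close>

lemma matrix_vector_mult_diag2:
  fixes x :: "real^2"
  shows "vector [vector [a, 0], vector [0, b]] *v x = (vector [a * x $ 1, b * x $ 2] :: real^2)"
  by (simp add: vec_eq_iff forall_2 matrix_vector_mult_def sum_2)

lemma mat_pow_diag2:
  "mat_pow (vector [vector [a, 0], vector [0, b]]) j = vector [vector [a ^ j, 0], vector [0, b ^ j]]"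
  by (induction j) (simp_all add: vec_eq_iff forall_2 matrix_matrix_mult_def sum_2 mat_def)

lemma mat_E_mult_vec: "mat_E *v (x :: real^2) = (vector [x $ 2, x $ 1] :: real^2)"
  by (simp add: mat_E_def vec_eq_iff forall_2 matrix_vector_mult_def sum_2)

lemma norm_mat_E [simp]: "norm (mat_E *v x) = norm x"
  by (simp add: mat_E_mult_vec norm_vec_def L2_set_def sum_2 add.commute)

lemma mat_E_mat_E [simp]: "mat_E *v (mat_E *v x) = x"
  by (simp add: mat_E_mult_vec vec_eq_iff forall_2)

lemma det_mat_E: "det mat_E = -1"
  by (simp add: det_2 mat_E_def)

lemma norm_int_lattice_ge_1:
  assumes "n \<in> int_lattice" "n \<noteq> 0"
  shows "1 \<le> norm n"
proof -
  obtain i where i: "n $ i \<noteq> 0" using assms(2) by (auto simp: vec_eq_iff)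
  obtain m where m: "n $ i = of_int m" using assms(1) by (auto simp: int_lattice_def elim: Ints_cases)
  have "1 \<le> \<bar>m\<bar>" using i m by simp
  then have "1 \<le> \<bar>n $ i\<bar>" unfolding m by linarith
  also have "\<dots> \<le> norm n" by (rule component_le_norm_cart)
  finally show ?thesis .
qed

text \<open>The generators enter only through the functions \<open>shear_gen\<close>; the shear matrices are absorbed in them.\<close>

locale shear_system =
  fixes lam :: real and r s :: "nat \<Rightarrow> nat" and \<phi> \<psi> :: "real^2 \<Rightarrow> complex"
    and \<psi>' :: "nat \<Rightarrow> int \<Rightarrow> real^2 \<Rightarrow> complex"
  assumes lam: "lam > 1"
    and phi_loc: "L2_loc \<phi>"
    and gen_loc: "\<And>j l. l \<in> {- int (s j)..int (s j)} \<Longrightarrow> L2_loc (shear_gen r \<psi> \<psi>' j l)"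
begin

text \<open>The Boolean selects the factor \<open>mat_E\<close>, so that both halves of a scale are treated alike.\<close>

definition scale_mat :: "nat \<Rightarrow> bool \<Rightarrow> real^2^2" where
  "scale_mat j b = (if b then mat_pow (mat_B lam) j ** mat_E else mat_pow (mat_B lam) j)"

lemma mat_pow_B: "mat_pow (mat_B lam) j *v x = vector [inverse (lam\<^sup>2) ^ j * x $ 1, inverse lam ^ j * x $ 2]"
  unfolding mat_B_def mat_pow_diag2 matrix_vector_mult_diag2 ..

lemma mat_pow_A: "mat_pow (mat_A lam) j *v x = vector [(lam\<^sup>2) ^ j * x $ 1, lam ^ j * x $ 2]"
  unfolding mat_A_def mat_pow_diag2 matrix_vector_mult_diag2 ..

lemma mat_pow_A_B:
  "mat_pow (mat_A lam) j *v (mat_pow (mat_B lam) j *v x) = x"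
  "mat_pow (mat_B lam) j *v (mat_pow (mat_A lam) j *v x) = x"
  using lam by (simp_all add: mat_pow_A mat_pow_B vec_eq_iff forall_2 field_simps)

lemma det_mat_pow_B: "det (mat_pow (mat_B lam) j) \<noteq> 0"
  using lam by (simp add: mat_B_def mat_pow_diag2 det_2)

lemma det_scale_mat: "det (scale_mat j b) \<noteq> 0"
  using det_mat_pow_B by (simp add: scale_mat_def det_mul det_mat_E)

lemma scale_mat_mult: "scale_mat j b *v x = mat_pow (mat_B lam) j *v (if b then mat_E *v x else x)"
  by (simp add: scale_mat_def matrix_vector_mul_assoc)

text \<open>Both diagonal entries of \<open>mat_B lam\<close> are at most \<open>inverse lam\<close>, and \<open>mat_E\<close> is an isometry.\<close>

lemma norm_scale_mat_le: "lam ^ j * norm (scale_mat j b *v x) \<le> norm x"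
proof -
  have *: "lam ^ j * norm (mat_pow (mat_B lam) j *v y) \<le> norm y" for y
  proof -
    have l1: "1 \<le> lam ^ j" using lam by (simp add: one_le_power)
    have "norm (mat_pow (mat_B lam) j *v y) \<le> norm (inverse (lam ^ j) *\<^sub>R y)"
    proof (rule norm_le_componentwise_cart)
      fix i :: 2
      have "inverse (lam\<^sup>2) ^ j \<le> inverse (lam ^ j)"
        using l1 lam by (simp add: power_inverse power_even_eq[symmetric] power_mult[symmetric] le_imp_inverse_le power_increasing)
      then have "\<bar>inverse (lam\<^sup>2) ^ j * y $ 1\<bar> \<le> inverse (lam ^ j) * \<bar>y $ 1\<bar>"
        using lam by (simp add: abs_mult mult_right_mono)
      then show "norm ((mat_pow (mat_B lam) j *v y) $ i) \<le> norm ((inverse (lam ^ j) *\<^sub>R y) $ i)"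
        using lam exhaust_2[of i] by (auto simp: mat_pow_B abs_mult power_inverse)
    qed
    also have "\<dots> = norm y / lam ^ j" using lam by (simp add: divide_inverse mult.commute)
    finally show ?thesis using lam by (simp add: field_simps)
  qed
  show ?thesis using *[of x] *[of "mat_E *v x"] by (simp add: scale_mat_mult)
qed

lemma scale_mat_lattice_imp_shift_set:
  assumes "scale_mat j b *v k \<in> int_lattice"
  shows "k \<in> shift_set lam"
proof -
  have "k = (if b then mat_E ** mat_pow (mat_A lam) j else mat_pow (mat_A lam) j) *v (scale_mat j b *v k)"
    by (simp add: scale_mat_mult mat_pow_A_B flip: matrix_vector_mul_assoc)
  then show ?thesis
    using assms unfolding shift_set_def by (cases b) (auto intro!: UN_I[of j])
qed

lemma shift_set_imp_scale_mat_lattice: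
  assumes "k \<in> shift_set lam"
  obtains j b where "scale_mat j b *v k \<in> int_lattice"
proof -
  obtain j n where n: "n \<in> int_lattice"
      "k = mat_pow (mat_A lam) j *v n \<or> k = (mat_E ** mat_pow (mat_A lam) j) *v n"
    using assms by (auto simp: shift_set_def)
  then have "scale_mat j False *v k = n \<or> scale_mat j True *v k = n"
    by (auto simp: scale_mat_mult mat_pow_A_B simp flip: matrix_vector_mul_assoc)
  then show ?thesis using n that by metis
qed

text \<open>Nonzero lattice points have norm at least \<open>1\<close>. Consequently a fixed nonzero \<open>k\<close> is seen by finitely
  many scales only, and a bounded set contains finitely many points of the shift set.\<close>

lemma lam_power_le_norm:
  assumes "scale_mat j b *v k \<in> int_lattice" "k \<noteq> 0"
  shows "lam ^ j \<le> norm k"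
proof -
  have "scale_mat j b *v k \<noteq> 0"
    using assms(2) det_scale_mat[of j b] invertible_mult[of "scale_mat j b"]
    by (metis invertible_det_nz matrix_left_invertible_ker invertible_def)
  then have "1 \<le> norm (scale_mat j b *v k)" using assms(1) by (rule norm_int_lattice_ge_1[rotated])
  then have "lam ^ j * 1 \<le> lam ^ j * norm (scale_mat j b *v k)"
    using lam by (intro mult_left_mono) auto
  then show ?thesis using norm_scale_mat_le[of j b k] by simp
qed

lemma norm_shift_set_ge_1: "k \<in> shift_set lam \<Longrightarrow> k \<noteq> 0 \<Longrightarrow> 1 \<le> norm k"
  using lam_power_le_norm lam one_le_power[of lam] by (metis shift_set_imp_scale_mat_lattice less_imp_le order_trans)

lemma eventually_not_lattice:
  assumes "k \<noteq> 0"
  obtains J where "\<And>j b. j \<ge> J \<Longrightarrow> scale_mat j b *v k \<notin> int_lattice"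
proof -
  obtain J where J: "norm k < lam ^ J" using real_arch_pow[OF lam] by blast
  show ?thesis
  proof
    fix j b assume "j \<ge> J"
    then have "norm k < lam ^ j"
      using J lam power_increasing[of J j lam] by linarith
    then show "scale_mat j b *v k \<notin> int_lattice"
      using lam_power_le_norm[of j b k] assms by auto
  qed
qed

lemma finite_shift_set_cball: "finite (shift_set lam \<inter> cball 0 R)"
proof -
  obtain J where J: "R < lam ^ J" using real_arch_pow[OF lam] by blast
  have inj: "inj ((*v) (scale_mat j b))" for j b
    using det_scale_mat by (simp add: invertible_det_nz[symmetric] inj_matrix_vector_mult)
  have "shift_set lam \<inter> cball 0 R \<subseteq>
     {0} \<union> (\<Union>j<J. \<Union>b. (*v) (scale_mat j b) -` (int_lattice \<inter> cball 0 R))"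
  proof
    fix k assume k: "k \<in> shift_set lam \<inter> cball 0 R"
    then obtain j b where jb: "scale_mat j b *v k \<in> int_lattice"
      by (auto elim: shift_set_imp_scale_mat_lattice)
    have "norm (scale_mat j b *v k) \<le> lam ^ j * norm (scale_mat j b *v k)"
      using lam mult_right_mono[of 1 "lam ^ j" "norm (scale_mat j b *v k)"] by (simp add: one_le_power)
    also have "\<dots> \<le> norm k" by (rule norm_scale_mat_le)
    finally have n: "norm (scale_mat j b *v k) \<le> R" using k by simp
    show "k \<in> {0} \<union> (\<Union>j<J. \<Union>b. (*v) (scale_mat j b) -` (int_lattice \<inter> cball 0 R))"
    proof (cases "k = 0")
      case False
      have "lam ^ j < lam ^ J" using lam_power_le_norm[OF jb False] J k by simp
      then have "j < J" using lam power_less_imp_less_exp by blast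
      then show ?thesis using jb n by auto
    qed simp
  qed
  moreover have "finite ({0} \<union> (\<Union>j<J. \<Union>b. (*v) (scale_mat j b) -` (int_lattice \<inter> cball 0 R)))"
    by (intro finite_UnI finite_UN_I finite_vimageI finite_int_lattice_Int_bounded inj) auto
  ultimately show ?thesis by (rule finite_subset)
qed

abbreviation shears :: "nat \<Rightarrow> int set" where
  "shears j \<equiv> {- int (s j)..int (s j)}"

abbreviation gen :: "nat \<Rightarrow> int \<Rightarrow> real^2 \<Rightarrow> complex" where
  "gen \<equiv> shear_gen r \<psi> \<psi>'"

abbreviation bracket :: "real^2 \<Rightarrow> real^2 \<Rightarrow> nat \<Rightarrow> complex" where
  "bracket \<equiv> I_bracket lam r s \<psi> \<psi>'"

lemma I_phi_eq: "I_phi \<phi> k \<xi> = lat_prod \<phi> (mat 1) k \<xi>"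
  by (simp add: I_phi_def lat_prod_def)

lemma I_Psi_scale_mat:
  "I_Psi r s \<psi> \<psi>' j (scale_mat j b *v k) (scale_mat j b *v \<xi>) =
    (\<Sum>l\<in>shears j. lat_prod (gen j l) (scale_mat j b) k \<xi>)"
  by (simp add: I_Psi_def lat_prod_def shear_gen_def matrix_vector_right_distrib matrix_vector_mult_scaleR)

lemma bracket_eq:
  "bracket k \<xi> j = (\<Sum>l\<in>shears j.
     lat_prod (gen j l) (scale_mat j False) k \<xi> + lat_prod (gen j l) (scale_mat j True) k \<xi>)"
  using I_Psi_scale_mat[of j False k \<xi>] I_Psi_scale_mat[of j True k \<xi>]
  by (simp add: I_bracket_def scale_mat_def sum.distrib)

definition energy :: "nat \<Rightarrow> real^2 \<Rightarrow> real" where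
  "energy j \<xi> = (\<Sum>l\<in>shears j.
     (cmod (gen j l (scale_mat j False *v \<xi>)))\<^sup>2 + (cmod (gen j l (scale_mat j True *v \<xi>)))\<^sup>2)"

lemma energy_nonneg: "0 \<le> energy j \<xi>"
  by (simp add: energy_def sum_nonneg)

lemma lat_prod_0: "lat_prod h U 0 \<xi> = complex_of_real ((cmod (h (U *v \<xi>)))\<^sup>2)"
  by (simp only: lat_prod_def complex_norm_square matrix_vector_mult_0_right int_lattice_0
      scaleR_zero_right add_0_right if_True mult.commute)

lemma bracket_0: "bracket 0 \<xi> j = complex_of_real (energy j \<xi>)"
  by (simp only: bracket_eq lat_prod_0 energy_def of_real_sum of_real_add)

lemma I_phi_0: "I_phi \<phi> 0 \<xi> = complex_of_real ((cmod (\<phi> \<xi>))\<^sup>2)"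
  by (simp only: I_phi_eq lat_prod_0 matrix_vector_mul_lid)

lemma bracket_eventually_0:
  assumes "k \<noteq> 0"
  obtains J where "\<And>j \<xi>. j \<ge> J \<Longrightarrow> bracket k \<xi> j = 0"
proof -
  obtain J where "\<And>j b. j \<ge> J \<Longrightarrow> scale_mat j b *v k \<notin> int_lattice"
    using eventually_not_lattice[OF assms] by blast
  then show ?thesis by (intro that[of J]) (simp add: bracket_eq lat_prod_def)
qed

lemma finite_bracket_nonzero:
  assumes "k \<noteq> 0"
  shows "finite {j. bracket k \<xi> j \<noteq> 0}"
proof -
  obtain J where "\<And>j \<xi>. j \<ge> J \<Longrightarrow> bracket k \<xi> j = 0"
    using bracket_eventually_0[OF assms] by blast
  then have "{j. bracket k \<xi> j \<noteq> 0} \<subseteq> {..<J}" by (auto simp: not_le[symmetric])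
  then show ?thesis by (rule finite_subset) simp
qed

definition phi_sum :: "(real^2 \<Rightarrow> complex) \<Rightarrow> ennreal" where
  "phi_sum f = shift_energy f \<phi> (mat 1)"

definition scale_sum :: "(real^2 \<Rightarrow> complex) \<Rightarrow> nat \<Rightarrow> ennreal" where
  "scale_sum f j = (\<Sum>l\<in>shears j. \<Sum>\<^sub>\<infinity>k\<in>int_lattice.
      ennreal ((cmod (L2_inner f (dil_mod (gen j l) (mat_pow (mat_B lam) j) k)))\<^sup>2) +
      ennreal ((cmod (L2_inner f (dil_mod (gen j l) (mat_pow (mat_B lam) j ** mat_E) k)))\<^sup>2))"

definition frame_sum :: "(real^2 \<Rightarrow> complex) \<Rightarrow> ennreal" where
  "frame_sum f = phi_sum f + (\<Sum>j. scale_sum f j)"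

lemma FAS_tight_frame_iff:
  "FAS_tight_frame lam r s \<phi> \<psi> \<psi>' \<longleftrightarrow> L2_fun \<phi> \<and>
     (\<forall>j. \<forall>l\<in>shears j. L2_fun (gen j l)) \<and>
     (\<forall>f. L2_fun f \<longrightarrow> ennreal ((2 * pi)\<^sup>2 * (LINT x|lebesgue. (cmod (f x))\<^sup>2)) = frame_sum f)"
  by (simp only: FAS_tight_frame_def frame_sum_def phi_sum_def scale_sum_def)

lemma scale_sum_eq:
  "scale_sum f j = (\<Sum>l\<in>shears j.
      shift_energy f (gen j l) (scale_mat j False) +
      shift_energy f (gen j l) (scale_mat j True))"
  unfolding scale_sum_def scale_mat_def
  by (simp add: infsum_ennreal_conv_nn_integral countable_int_lattice nn_integral_add)

text \<open>The shifts outside \<open>K\<close> do not contribute to the energies of \<open>f\<close>.\<close>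

definition negligible_shifts :: "(real^2 \<Rightarrow> complex) \<Rightarrow> (real^2) set \<Rightarrow> bool" where
  "negligible_shifts f K \<longleftrightarrow> finite K \<and> (\<forall>k\<in>shift_set lam - K. autocorr f k = (\<lambda>x. 0))"

lemma phi_sum_test:
  assumes f: "test_fun f" and K: "negligible_shifts f K"
  obtains q where "q \<ge> 0" "phi_sum f = ennreal q"
    "complex_of_real q = of_real ((2*pi)\<^sup>2) *
       (\<Sum>k\<in>K. LINT x|lebesgue. autocorr f k x * I_phi \<phi> k x)"
proof -
  have van: "autocorr f k = (\<lambda>x. 0)" if "mat 1 *v k \<in> int_lattice" "k \<notin> K" for k
    using K that scale_mat_lattice_imp_shift_set[of 0 False k] by (auto simp: negligible_shifts_def scale_mat_def)
  have U: "det (mat 1 :: real^2^2) \<noteq> 0" and fin: "finite K"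
    using K by (simp_all add: negligible_shifts_def)
  show ?thesis
    by (rule dilated_shift_energy[OF U phi_loc f fin])
      (rule van, assumption, assumption, (rule that; simp only: phi_sum_def I_phi_eq))
qed

lemma bracket_integrable:
  assumes f: "test_fun f"
  shows "integrable lebesgue (\<lambda>x. autocorr f k x * bracket k x j)"
  unfolding bracket_eq sum_distrib_left distrib_left
  by (intro Bochner_Integration.integrable_sum Bochner_Integration.integrable_add lat_prod_integrable
      det_scale_mat gen_loc f)

lemma I_phi_integrable:
  assumes f: "test_fun f"
  shows "integrable lebesgue (\<lambda>x. autocorr f k x * I_phi \<phi> k x)"
  unfolding I_phi_eq by (intro lat_prod_integrable f phi_loc) simp

lemma scale_sum_test:
  assumes f: "test_fun f" and K: "negligible_shifts f K"
  obtains q where "q \<ge> 0" "scale_sum f j = ennreal q"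
    "complex_of_real q = of_real ((2*pi)\<^sup>2) *
       (\<Sum>k\<in>K. LINT x|lebesgue. autocorr f k x * bracket k x j)"
proof -
  have fin: "finite K" using K by (simp add: negligible_shifts_def)
  define R where "R l b q \<longleftrightarrow> q \<ge> 0 \<and>
     shift_energy f (gen j l) (scale_mat j b) = ennreal q \<and>
     complex_of_real q = of_real ((2*pi)\<^sup>2) * (\<Sum>k\<in>K. LINT x|lebesgue. autocorr f k x * lat_prod (gen j l) (scale_mat j b) k x)"
    for l b q
  define q where "q l b = (SOME q. R l b q)" for l b
  have R: "R l b (q l b)" if l: "l \<in> shears j" for l b
  proof -
    have van: "autocorr f k = (\<lambda>x. 0)" if "scale_mat j b *v k \<in> int_lattice" "k \<notin> K" for k
      using K that scale_mat_lattice_imp_shift_set[of j b k] by (auto simp: negligible_shifts_def)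
    have "\<exists>q. R l b q"
      unfolding R_def
      by (rule dilated_shift_energy[OF det_scale_mat[of j b] gen_loc[OF l] f fin])
        (rule van, assumption, assumption, (intro exI conjI; assumption))
    then show ?thesis unfolding q_def by (rule someI_ex)
  qed
  have q: "\<And>l b. l \<in> shears j \<Longrightarrow> q l b \<ge> 0"
    "\<And>l b. l \<in> shears j \<Longrightarrow>
      shift_energy f (gen j l) (scale_mat j b) = ennreal (q l b)"
    "\<And>l b. l \<in> shears j \<Longrightarrow> complex_of_real (q l b) = of_real ((2*pi)\<^sup>2) *
       (\<Sum>k\<in>K. LINT x|lebesgue. autocorr f k x * lat_prod (gen j l) (scale_mat j b) k x)"
    using R unfolding R_def by blast+
  show ?thesis
  proof
    show "0 \<le> (\<Sum>l\<in>shears j. q l False + q l True)"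
      using q(1) by (intro sum_nonneg add_nonneg_nonneg)
    show "scale_sum f j = ennreal (\<Sum>l\<in>shears j. q l False + q l True)"
    proof -
      have "scale_sum f j = (\<Sum>l\<in>shears j. ennreal (q l False + q l True))"
        unfolding scale_sum_eq by (intro sum.cong refl) (use q(1,2) in simp)
      also have "\<dots> = ennreal (\<Sum>l\<in>shears j. q l False + q l True)"
        using q(1) by (intro sum_ennreal add_nonneg_nonneg)
      finally show ?thesis .
    qed
    have "complex_of_real (\<Sum>l\<in>shears j. q l False + q l True) =
      (\<Sum>l\<in>shears j. of_real ((2*pi)\<^sup>2) * ((\<Sum>k\<in>K. LINT x|lebesgue. autocorr f k x * lat_prod (gen j l) (scale_mat j False) k x)
        + (\<Sum>k\<in>K. LINT x|lebesgue. autocorr f k x * lat_prod (gen j l) (scale_mat j True) k x)))"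
      unfolding of_real_sum of_real_add distrib_left by (intro sum.cong refl) (simp only: q(3))
    also have "\<dots> = of_real ((2*pi)\<^sup>2) * (\<Sum>l\<in>shears j. \<Sum>k\<in>K.
        LINT x|lebesgue. autocorr f k x * (lat_prod (gen j l) (scale_mat j False) k x + lat_prod (gen j l) (scale_mat j True) k x))"
      unfolding sum_distrib_left[symmetric] sum.distrib[symmetric] distrib_left
      using lat_prod_integrable[OF det_scale_mat gen_loc f]
      by (intro arg_cong2[where f = "(*)"] refl sum.cong Bochner_Integration.integral_add[symmetric]) blast+
    also have "(\<Sum>l\<in>shears j. \<Sum>k\<in>K.
        LINT x|lebesgue. autocorr f k x * (lat_prod (gen j l) (scale_mat j False) k x + lat_prod (gen j l) (scale_mat j True) k x))
       = (\<Sum>k\<in>K. LINT x|lebesgue. autocorr f k x * bracket k x j)"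
      unfolding bracket_eq sum_distrib_left
      using lat_prod_integrable[OF det_scale_mat gen_loc f]
      by (subst sum.swap, intro sum.cong refl Bochner_Integration.integral_sum[symmetric])
        (auto simp: distrib_left)
    finally show "complex_of_real (\<Sum>l\<in>shears j. q l False + q l True) = of_real ((2*pi)\<^sup>2) *
       (\<Sum>k\<in>K. LINT x|lebesgue. autocorr f k x * bracket k x j)" .
  qed
qed

text \<open>The left-hand side of the identity belonging to a nonzero \<open>k\<close>.\<close>

definition offdiag :: "real^2 \<Rightarrow> real^2 \<Rightarrow> complex" where
  "offdiag k x = I_phi \<phi> k x + (\<Sum>j. bracket k x j)"

text \<open>The left-hand side of the identity belonging to \<open>0\<close>. Its terms are nonnegative, and with values in
  \<open>ennreal\<close> the equation \<open>diag x = 1\<close> includes the absolute convergence.\<close>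

definition diag :: "real^2 \<Rightarrow> ennreal" where
  "diag x = ennreal ((cmod (\<phi> x))\<^sup>2) + (\<Sum>j. ennreal (energy j x))"

lemma phi_measurable: "\<phi> \<in> borel_measurable lebesgue"
  using phi_loc by (simp add: L2_loc_def)

lemma energy_measurable: "energy j \<in> borel_measurable lebesgue"
proof -
  have "(\<lambda>x. gen j l (scale_mat j b *v x)) \<in> borel_measurable lebesgue"
    if "l \<in> shears j" for l b
    using L2_loc_linear[OF det_scale_mat gen_loc[OF that], of j b] by (simp add: L2_loc_def)
  then show ?thesis unfolding energy_def[abs_def]
    by (intro borel_measurable_sum borel_measurable_add borel_measurable_power
        measurable_compose[OF _ borel_measurable_norm]) blast+
qed

lemma diag_measurable: "diag \<in> borel_measurable lebesgue"
  unfolding diag_def[abs_def] using phi_measurable energy_measurable by measurable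

lemma diag_eq_1_iff:
  "(summable (\<lambda>j. norm (bracket 0 x j)) \<and> I_phi \<phi> 0 x + (\<Sum>j. bracket 0 x j) = 1) \<longleftrightarrow> diag x = 1"
proof -
  have norm_eq: "(\<lambda>j. norm (bracket 0 x j)) = (\<lambda>j. energy j x)"
    by (simp add: bracket_0 energy_nonneg)
  show ?thesis
  proof (cases "summable (\<lambda>j. energy j x)")
    case True
    have "(\<Sum>j. bracket 0 x j) = of_real (\<Sum>j. energy j x)"
      unfolding bracket_0 using True by (rule suminf_of_real[symmetric])
    then have "I_phi \<phi> 0 x + (\<Sum>j. bracket 0 x j) = of_real ((cmod (\<phi> x))\<^sup>2 + (\<Sum>j. energy j x))"
      by (simp only: I_phi_0 of_real_add)
    moreover have "diag x = ennreal ((cmod (\<phi> x))\<^sup>2 + (\<Sum>j. energy j x))"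
      unfolding diag_def suminf_ennreal2[OF energy_nonneg True]
      by (rule ennreal_plus[symmetric]) (auto intro: suminf_nonneg True energy_nonneg)
    ultimately show ?thesis
      unfolding norm_eq using True by (simp only: of_real_eq_1_iff ennreal_eq_1 simp_thms)
  next
    case False
    have "(\<Sum>j. ennreal (energy j x)) = top"
      using False summable_suminf_not_top[of "\<lambda>j. energy j x"] energy_nonneg by blast
    then show ?thesis unfolding norm_eq using False by (simp add: diag_def)
  qed
qed

lemma offdiag_finite_sum:
  assumes "\<And>j \<xi>. j \<ge> J \<Longrightarrow> bracket k \<xi> j = 0"
  shows "offdiag k x = I_phi \<phi> k x + (\<Sum>j<J. bracket k x j)"
  unfolding offdiag_def using assms by (subst suminf_finite[of "{..<J}"]) (auto simp: not_less)

lemma offdiag_integrable: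
  assumes f: "test_fun f" and k: "k \<noteq> 0"
  shows "integrable lebesgue (\<lambda>x. autocorr f k x * offdiag k x)"
proof -
  obtain J where J: "\<And>j \<xi>. j \<ge> J \<Longrightarrow> bracket k \<xi> j = 0"
    using bracket_eventually_0[OF k] by blast
  have "offdiag k x = I_phi \<phi> k x + (\<Sum>j<J. bracket k x j)" for x
    using J by (rule offdiag_finite_sum)
  then have "(\<lambda>x. autocorr f k x * offdiag k x) =
      (\<lambda>x. autocorr f k x * I_phi \<phi> k x + (\<Sum>j<J. autocorr f k x * bracket k x j))"
    by (simp add: distrib_left sum_distrib_left)
  then show ?thesis
    by (simp only:) (intro Bochner_Integration.integrable_add Bochner_Integration.integrable_sum
        I_phi_integrable bracket_integrable f)
qed

text \<open>Scales beyond some \<open>J\<close> contribute to the diagonal part only, because they do not see the nonzero shifts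
  in \<open>K\<close>. The off-diagonal part is therefore a finite sum; it is a real number \<open>c\<close>, since the energies
  and the diagonal part are real. As \<open>c\<close> may be negative while the other quantities may be infinite,
  the positive and the negative part of \<open>c\<close> are placed on different sides.\<close>

proposition frame_sum_identity:
  assumes f: "test_fun f" and K: "negligible_shifts f K" and K0: "0 \<in> K"
  obtains c where
    "(\<Sum>k\<in>K - {0}. LINT x|lebesgue. autocorr f k x * offdiag k x) = complex_of_real c"
    "frame_sum f + ennreal ((2*pi)\<^sup>2 * (- c)) =
      ennreal ((2*pi)\<^sup>2) * (\<integral>\<^sup>+x. ennreal ((cmod (f x))\<^sup>2) * diag x \<partial>lebesgue) + ennreal ((2*pi)\<^sup>2 * c)"
proof -
  define P where "P = (2*pi)\<^sup>2"
  have P: "P > 0" by (simp add: P_def)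
  have fin: "finite K" using K by (simp add: negligible_shifts_def)
  have fm: "f \<in> borel_measurable lebesgue" using f by (simp add: test_fun_def)
  note [measurable] = fm phi_measurable energy_measurable
  have "\<exists>J. \<forall>j\<ge>J. \<forall>\<xi>. bracket k \<xi> j = 0" if "k \<in> K - {0}" for k
    using that bracket_eventually_0[of k] by (metis Diff_iff insertI1)
  then obtain Jf where Jf: "\<And>k j \<xi>. k \<in> K - {0} \<Longrightarrow> j \<ge> Jf k \<Longrightarrow> bracket k \<xi> j = 0"
    by metis
  \<comment> \<open>Beyond J no nonzero shift in K is seen.\<close>
  define J where "J = Max (insert 0 (Jf ` (K - {0})))"
  have J: "bracket k \<xi> j = 0" if "k \<in> K - {0}" "j \<ge> J" for k j \<xi>
  proof -
    have "Jf k \<le> J" unfolding J_def using fin that(1) by (intro Max_ge) auto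
    then show ?thesis using Jf that by auto
  qed
  define mphi where "mphi = (LINT x|lebesgue. (cmod (f x * \<phi> x))\<^sup>2)"
  define m where "m j = (LINT x|lebesgue. (cmod (f x))\<^sup>2 * energy j x)" for j
  have autocorr_0: "autocorr f 0 x = of_real ((cmod (f x))\<^sup>2)" for x
    by (simp only: autocorr_def complex_norm_square scaleR_zero_right add_0_right)
  have d_phi: "autocorr f 0 x * I_phi \<phi> 0 x = complex_of_real ((cmod (f x * \<phi> x))\<^sup>2)" for x
    by (simp only: autocorr_0 I_phi_0 norm_mult power_mult_distrib of_real_mult)
  have d_br: "autocorr f 0 x * bracket 0 x j = complex_of_real ((cmod (f x))\<^sup>2 * energy j x)" for x j
    by (simp only: autocorr_0 bracket_0 of_real_mult)
  have mphi: "(LINT x|lebesgue. autocorr f 0 x * I_phi \<phi> 0 x) = of_real mphi"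
    unfolding d_phi mphi_def by (rule integral_complex_of_real)
  have m: "(LINT x|lebesgue. autocorr f 0 x * bracket 0 x j) = of_real (m j)" for j
    unfolding d_br m_def by (rule integral_complex_of_real)
  have int_phi: "integrable lebesgue (\<lambda>x. (cmod (f x * \<phi> x))\<^sup>2)"
    using I_phi_integrable[OF f, of 0] unfolding d_phi by (simp only: complex_of_real_integrable_eq)
  have int_m: "integrable lebesgue (\<lambda>x. (cmod (f x))\<^sup>2 * energy j x)" for j
    using bracket_integrable[OF f, of 0 j] unfolding d_br by (simp only: complex_of_real_integrable_eq)
  have mphi0: "mphi \<ge> 0" and m0: "m j \<ge> 0" for j
    unfolding mphi_def m_def by (auto intro!: integral_nonneg_AE simp: energy_nonneg)
  obtain qphi where qphi: "qphi \<ge> 0" "phi_sum f = ennreal qphi"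
    "complex_of_real qphi = of_real P * (\<Sum>k\<in>K. LINT x|lebesgue. autocorr f k x * I_phi \<phi> k x)"
    using phi_sum_test[OF f K] unfolding P_def by blast
  define R where "R j q \<longleftrightarrow> q \<ge> 0 \<and> scale_sum f j = ennreal q \<and>
    complex_of_real q = of_real P * (\<Sum>k\<in>K. LINT x|lebesgue. autocorr f k x * bracket k x j)" for j q
  define q where "q j = (SOME q. R j q)" for j
  have R: "R j (q j)" for j
  proof -
    have "\<exists>q. R j q"
      unfolding R_def P_def by (rule scale_sum_test[OF f K, of j]) (intro exI conjI; assumption)
    then show ?thesis unfolding q_def by (rule someI_ex)
  qed
  have q: "\<And>j. q j \<ge> 0" "\<And>j. scale_sum f j = ennreal (q j)"
    "\<And>j. complex_of_real (q j) = of_real P * (\<Sum>k\<in>K. LINT x|lebesgue. autocorr f k x * bracket k x j)"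
    using R unfolding R_def by blast+
  define cphi where "cphi = qphi / P - mphi"
  define c where "c j = q j / P - m j" for j
  have cphi: "(\<Sum>k\<in>K - {0}. LINT x|lebesgue. autocorr f k x * I_phi \<phi> k x) = of_real cphi"
    using qphi(3) P unfolding sum.remove[OF fin K0] mphi by (simp add: cphi_def field_simps)
  have c: "(\<Sum>k\<in>K - {0}. LINT x|lebesgue. autocorr f k x * bracket k x j) = of_real (c j)" for j
    using q(3)[of j] P unfolding sum.remove[OF fin K0] m by (simp add: c_def field_simps)
  have cJ: "c j = 0" if "j \<ge> J" for j
  proof -
    have "(\<Sum>k\<in>K - {0}. LINT x|lebesgue. autocorr f k x * bracket k x j) = 0"
      by (rule sum.neutral) (use J that in auto)
    then show ?thesis using c[of j] by (simp only: of_real_eq_0_iff)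
  qed
  then have qJ: "q (i + J) = P * m (i + J)" for i
    using P by (simp add: c_def field_simps)
  define C where "C = cphi + (\<Sum>j<J. c j)"
  have "(\<Sum>k\<in>K - {0}. LINT x|lebesgue. autocorr f k x * offdiag k x) =
     (\<Sum>k\<in>K - {0}. (LINT x|lebesgue. autocorr f k x * I_phi \<phi> k x) +
        (\<Sum>j<J. LINT x|lebesgue. autocorr f k x * bracket k x j))"
  proof (rule sum.cong[OF refl])
    fix k assume k: "k \<in> K - {0}"
    have "(LINT x|lebesgue. autocorr f k x * offdiag k x) =
      (LINT x|lebesgue. autocorr f k x * I_phi \<phi> k x + (\<Sum>j<J. autocorr f k x * bracket k x j))"
    proof -
      have "offdiag k x = I_phi \<phi> k x + (\<Sum>j<J. bracket k x j)" for x
        using J[OF k] by (rule offdiag_finite_sum)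
      then show ?thesis by (simp only: distrib_left sum_distrib_left)
    qed
    also have "\<dots> = (LINT x|lebesgue. autocorr f k x * I_phi \<phi> k x) +
        (LINT x|lebesgue. (\<Sum>j<J. autocorr f k x * bracket k x j))"
      by (intro Bochner_Integration.integral_add I_phi_integrable
          Bochner_Integration.integrable_sum bracket_integrable f)
    also have "(LINT x|lebesgue. (\<Sum>j<J. autocorr f k x * bracket k x j)) =
        (\<Sum>j<J. LINT x|lebesgue. autocorr f k x * bracket k x j)"
      by (intro Bochner_Integration.integral_sum bracket_integrable f)
    finally show "(LINT x|lebesgue. autocorr f k x * offdiag k x) =
      (LINT x|lebesgue. autocorr f k x * I_phi \<phi> k x) +
        (\<Sum>j<J. LINT x|lebesgue. autocorr f k x * bracket k x j)" .
  qed
  also have "\<dots> = of_real cphi + (\<Sum>j<J. of_real (c j))"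
    unfolding sum.distrib cphi by (subst sum.swap) (simp only: c)
  finally have C: "(\<Sum>k\<in>K - {0}. LINT x|lebesgue. autocorr f k x * offdiag k x) = of_real C"
    by (simp add: C_def)
  \<comment> \<open>The common and possibly infinite tail of both sides.\<close>
  define X where "X = (\<Sum>i. ennreal (P * m (i + J)))"
  have frame: "frame_sum f = ennreal (qphi + (\<Sum>j<J. q j)) + X"
  proof -
    have "(\<Sum>j. scale_sum f j) = (\<Sum>j. scale_sum f (j + J)) + (\<Sum>j<J. scale_sum f j)"
      by (subst suminf_offset[of _ J]) (simp_all add: add.commute)
    also have "\<dots> = X + (\<Sum>j<J. ennreal (q j))" by (simp add: X_def q(2) qJ)
    also have "(\<Sum>j<J. ennreal (q j)) = ennreal (\<Sum>j<J. q j)" using q(1) by simp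
    finally show ?thesis
      unfolding frame_sum_def qphi(2) using qphi(1) q(1)
      by (simp add: ennreal_plus sum_nonneg ac_simps del: sum_ennreal)
  qed
  have "(\<integral>\<^sup>+x. ennreal ((cmod (f x))\<^sup>2) * diag x \<partial>lebesgue) =
     (\<integral>\<^sup>+x. ennreal ((cmod (f x * \<phi> x))\<^sup>2) + (\<Sum>j. ennreal ((cmod (f x))\<^sup>2 * energy j x)) \<partial>lebesgue)"
    by (intro nn_integral_cong)
      (simp only: diag_def distrib_left norm_mult power_mult_distrib ennreal_suminf_cmult
        ennreal_mult[OF zero_le_power2 energy_nonneg] ennreal_mult[OF zero_le_power2 zero_le_power2])
  also have "\<dots> = (\<integral>\<^sup>+x. ennreal ((cmod (f x * \<phi> x))\<^sup>2) \<partial>lebesgue) +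
     (\<integral>\<^sup>+x. (\<Sum>j. ennreal ((cmod (f x))\<^sup>2 * energy j x)) \<partial>lebesgue)"
    by (rule nn_integral_add) measurable
  also have "(\<integral>\<^sup>+x. (\<Sum>j. ennreal ((cmod (f x))\<^sup>2 * energy j x)) \<partial>lebesgue) =
     (\<Sum>j. \<integral>\<^sup>+x. ennreal ((cmod (f x))\<^sup>2 * energy j x) \<partial>lebesgue)"
    by (rule nn_integral_suminf) measurable
  also have "(\<lambda>j. \<integral>\<^sup>+x. ennreal ((cmod (f x))\<^sup>2 * energy j x) \<partial>lebesgue) = (\<lambda>j. ennreal (m j))"
    unfolding m_def by (intro ext nn_integral_eq_integral int_m) (simp add: energy_nonneg)
  also have "(\<integral>\<^sup>+x. ennreal ((cmod (f x * \<phi> x))\<^sup>2) \<partial>lebesgue) = ennreal mphi"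
    unfolding mphi_def by (intro nn_integral_eq_integral int_phi) simp
  finally have "ennreal P * (\<integral>\<^sup>+x. ennreal ((cmod (f x))\<^sup>2) * diag x \<partial>lebesgue) =
     ennreal P * ennreal mphi + (\<Sum>j. ennreal P * ennreal (m j))"
    by (simp add: distrib_left)
  also have "\<dots> = ennreal (P * mphi) + (\<Sum>j. ennreal (P * m j))"
    using P m0 mphi0 by (simp add: ennreal_mult)
  also have "(\<Sum>j. ennreal (P * m j)) = X + (\<Sum>j<J. ennreal (P * m j))"
    unfolding X_def by (subst suminf_offset[of _ J]) (simp_all add: add.commute)
  also have "(\<Sum>j<J. ennreal (P * m j)) = ennreal (\<Sum>j<J. P * m j)"
    using P m0 by simp
  finally have diag: "ennreal P * (\<integral>\<^sup>+x. ennreal ((cmod (f x))\<^sup>2) * diag x \<partial>lebesgue) =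
     ennreal (P * mphi + (\<Sum>j<J. P * m j)) + X"
    using P m0 mphi0 by (simp add: ennreal_plus sum_nonneg ac_simps del: sum_ennreal)
  have AB: "qphi + (\<Sum>j<J. q j) = (P * mphi + (\<Sum>j<J. P * m j)) + P * C"
    using P by (simp add: C_def cphi_def c_def sum_subtractf sum_distrib_left right_diff_distrib distrib_left)
  have "ennreal (qphi + (\<Sum>j<J. q j)) + ennreal (P * (- C)) =
     ennreal (P * mphi + (\<Sum>j<J. P * m j)) + ennreal (P * C)"
  proof (cases "0 \<le> C")
    case True
    have "ennreal (P * (- C)) = 0" using True P by (intro ennreal_neg) (simp add: mult_nonneg_nonneg)
    then show ?thesis unfolding AB using True P m0 mphi0
      by (subst ennreal_plus) (auto intro!: sum_nonneg add_nonneg_nonneg)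
  next
    case False
    then have "ennreal (P * C) = 0" using P by (intro ennreal_neg) (simp add: mult_nonneg_nonpos)
    moreover have "ennreal (qphi + (\<Sum>j<J. q j)) + ennreal (P * (- C)) =
        ennreal (qphi + (\<Sum>j<J. q j) + P * (- C))"
      using qphi(1) q(1) False P
      by (intro ennreal_plus[symmetric]) (auto intro!: sum_nonneg add_nonneg_nonneg simp: mult_nonneg_nonpos)
    ultimately show ?thesis unfolding AB by simp
  qed
  then have "frame_sum f + ennreal (P * (- C)) =
      ennreal P * (\<integral>\<^sup>+x. ennreal ((cmod (f x))\<^sup>2) * diag x \<partial>lebesgue) + ennreal (P * C)"
    unfolding frame diag by (metis add.assoc add.commute)
  then show ?thesis using C that unfolding P_def by blast
qed

end

section \<open>From the frame identity to the pointwise identities\<close>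

lemma AE_locally:
  fixes P :: "'a::{second_countable_topology, metric_space} \<Rightarrow> bool"
  assumes \<rho>: "\<rho> > 0" and loc: "\<And>c. AE x in M. x \<in> ball c \<rho> \<longrightarrow> P x"
  shows "AE x in M. P x"
proof -
  obtain D :: "'a set" where D: "countable D" "\<And>X. open X \<Longrightarrow> X \<noteq> {} \<Longrightarrow> \<exists>d\<in>D. d \<in> X"
    by (rule countable_dense_setE) blast
  have "AE x in M. \<forall>c\<in>D. x \<in> ball c \<rho> \<longrightarrow> P x"
    unfolding AE_ball_countable[OF D(1)] using loc by blast
  then show ?thesis
  proof eventually_elim
    case (elim x)
    obtain c where "c \<in> D" "c \<in> ball x \<rho>" using D(2)[of "ball x \<rho>"] \<rho> by auto
    then show ?case using elim by (metis mem_ball dist_commute)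
  qed
qed

lemma test_fun_indicator_add:
  assumes A: "A \<in> sets lebesgue" "A \<subseteq> ball a \<rho>" and B: "B \<in> sets lebesgue" "B \<subseteq> ball b \<rho>"
  shows "test_fun (\<lambda>x. u * indicator A x + v * indicator B x)"
  unfolding test_fun_def
proof (intro conjI exI allI impI)
  show "(\<lambda>x. u * indicator A x + v * indicator B x) \<in> borel_measurable lebesgue"
    using A B by measurable
  fix x
  show "cmod (u * indicator A x + v * indicator B x) \<le> cmod u + cmod v"
    using norm_triangle_ineq[of u v] by (auto simp: indicator_def)
  assume "u * indicator A x + v * indicator B x \<noteq> 0"
  then have "x \<in> A \<or> x \<in> B" by (cases "x \<in> A"; cases "x \<in> B") simp_all
  then have "x \<in> ball a \<rho> \<or> x \<in> ball b \<rho>" using A B by blast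
  then show "norm x \<le> max (norm a) (norm b) + \<rho>"
    using norm_triangle_ineq4[of x "x - a"] norm_triangle_ineq4[of x "x - b"]
      norm_triangle_sub[of x a] norm_triangle_sub[of x b]
    by (auto simp: dist_norm norm_minus_commute)
qed

lemma nn_integral_test_fun_finite:
  assumes "test_fun f"
  shows "(\<integral>\<^sup>+x. ennreal ((cmod (f x))\<^sup>2) \<partial>lebesgue) < \<infinity>"
proof -
  have "L2_loc (\<lambda>x. 1)"
    unfolding L2_loc_def set_integrable_def
    using emeasure_bounded_finite[OF compact_imp_bounded]
    by (auto simp: integrable_indicator_iff borel_compact)
  then have "integrable lebesgue (\<lambda>x. (cmod (f x * 1))\<^sup>2)"
    by (rule L2_loc_mult_test[OF _ assms])
  then show ?thesis by (simp add: integrable_iff_bounded)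
qed

context shear_system
begin

definition frame_on_tests :: bool where
  "frame_on_tests \<longleftrightarrow> (\<forall>f. test_fun f \<longrightarrow>
     frame_sum f = ennreal ((2*pi)\<^sup>2) * (\<integral>\<^sup>+x. ennreal ((cmod (f x))\<^sup>2) \<partial>lebesgue))"

lemma frame_on_testsD:
  "frame_on_tests \<Longrightarrow> test_fun f \<Longrightarrow>
     frame_sum f = ennreal ((2*pi)\<^sup>2) * (\<integral>\<^sup>+x. ennreal ((cmod (f x))\<^sup>2) \<partial>lebesgue)"
  by (simp add: frame_on_tests_def)

text \<open>Nonzero points of the shift set have norm at least \<open>1\<close>, so a function supported in a ball of radius
  \<open>1\<close> is disjoint from its translates by \<open>2 \<pi> k\<close>. Testing with indicators determines the density
  \<open>diag\<close>.\<close>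

lemma diag_eq_1_if_frame:
  assumes frame: "frame_on_tests"
  shows "AE x in lebesgue. diag x = 1"
proof (rule AE_locally[of 1])
  fix c :: "real^2"
  define B where "B = ball c 1"
  have B: "B \<in> sets lebesgue" by (simp add: B_def)
  define M where "M = lebesgue_on B"
  have "B \<in> lmeasurable" by (simp add: B_def)
  then interpret M: finite_measure M
    unfolding M_def by (rule finite_measure_lebesgue_on)
  have "AE x in M. diag x = 1"
  proof (rule M.density_unique2)
    show "diag \<in> borel_measurable M"
      unfolding M_def by (rule measurable_restrict_space1[OF diag_measurable])
    fix A assume "A \<in> sets M"
    then have A: "A \<in> sets lebesgue" "A \<subseteq> B"
      unfolding M_def using B by (simp_all add: sets_restrict_space_iff)
    define f :: "real^2 \<Rightarrow> complex" where "f = indicator A"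
    have f: "test_fun f"
      using test_fun_indicator_add[of A c 1 A c 1 0] A by (simp add: f_def B_def)
    have K: "negligible_shifts f {0}"
      unfolding negligible_shifts_def
    proof (intro conjI ballI ext)
      fix k x assume k: "k \<in> shift_set lam - {0}"
      have "\<not> (x \<in> A \<and> x + (2*pi) *\<^sub>R k \<in> A)"
      proof
        assume "x \<in> A \<and> x + (2*pi) *\<^sub>R k \<in> A"
        then have "dist c x < 1" "dist c (x + (2*pi) *\<^sub>R k) < 1" using A by (auto simp: B_def)
        then have "norm ((2*pi) *\<^sub>R k) < 2"
          using dist_triangle[of x "x + (2*pi) *\<^sub>R k" c] by (simp add: dist_norm norm_minus_commute)
        moreover have "2*pi * 1 \<le> 2*pi * norm k"
          using norm_shift_set_ge_1[of k] k by (intro mult_left_mono) auto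
        ultimately show False using pi_ge_two by simp
      qed
      then show "autocorr f k x = 0" by (auto simp: autocorr_def f_def indicator_def)
    qed simp
    obtain c where c: "(0::complex) = of_real c"
      "frame_sum f + ennreal ((2*pi)\<^sup>2 * (- c)) =
       ennreal ((2*pi)\<^sup>2) * (\<integral>\<^sup>+x. ennreal ((cmod (f x))\<^sup>2) * diag x \<partial>lebesgue) + ennreal ((2*pi)\<^sup>2 * c)"
      by (rule frame_sum_identity[OF f K]) auto
    have "c = 0" using c(1) by simp
    then have "ennreal ((2*pi)\<^sup>2) * (\<integral>\<^sup>+x. ennreal ((cmod (f x))\<^sup>2) * diag x \<partial>lebesgue) =
      ennreal ((2*pi)\<^sup>2) * (\<integral>\<^sup>+x. ennreal ((cmod (f x))\<^sup>2) \<partial>lebesgue)"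
      using c(2) frame_on_testsD[OF frame f] by simp
    then have "(\<integral>\<^sup>+x. ennreal ((cmod (f x))\<^sup>2) * diag x \<partial>lebesgue) =
      (\<integral>\<^sup>+x. ennreal ((cmod (f x))\<^sup>2) \<partial>lebesgue)"
      by (subst (asm) ennreal_mult_cancel_left) auto
    moreover have "ennreal ((cmod (f x))\<^sup>2) = indicator A x" for x
      by (auto simp: f_def indicator_def)
    ultimately have eq: "(\<integral>\<^sup>+x. indicator A x * diag x \<partial>lebesgue) = (\<integral>\<^sup>+x. indicator A x \<partial>lebesgue)"
      by simp
    have res: "(\<integral>\<^sup>+x. g x * indicator A x \<partial>M) = (\<integral>\<^sup>+x. indicator A x * g x \<partial>lebesgue)" for g
      unfolding M_def using B A(2)
      by (subst nn_integral_restrict_space) (auto intro!: nn_integral_cong simp: indicator_def)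
    show "(\<integral>\<^sup>+x\<in>A. diag x \<partial>M) = (\<integral>\<^sup>+x\<in>A. 1 \<partial>M)"
      unfolding res using eq by simp
  qed simp
  then show "AE x in lebesgue. x \<in> ball c 1 \<longrightarrow> diag x = 1"
    unfolding M_def using B by (simp add: AE_restrict_space_iff B_def)
qed simp

lemma offdiag_sum_eq_0_if_frame:
  assumes frame: "frame_on_tests"
    and f: "test_fun f" and K: "negligible_shifts f K" "0 \<in> K"
  shows "(\<Sum>k\<in>K - {0}. LINT x|lebesgue. autocorr f k x * offdiag k x) = 0"
proof -
  obtain c where c: "(\<Sum>k\<in>K - {0}. LINT x|lebesgue. autocorr f k x * offdiag k x) = complex_of_real c"
      "frame_sum f + ennreal ((2*pi)\<^sup>2 * (- c)) =
       ennreal ((2*pi)\<^sup>2) * (\<integral>\<^sup>+x. ennreal ((cmod (f x))\<^sup>2) * diag x \<partial>lebesgue) + ennreal ((2*pi)\<^sup>2 * c)"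
    by (rule frame_sum_identity[OF f K])
  define N where "N = ennreal ((2*pi)\<^sup>2) * (\<integral>\<^sup>+x. ennreal ((cmod (f x))\<^sup>2) \<partial>lebesgue)"
  have "N < \<infinity>"
    unfolding N_def using nn_integral_test_fun_finite[OF f] by (simp add: ennreal_mult_less_top)
  have "(\<integral>\<^sup>+x. ennreal ((cmod (f x))\<^sup>2) * diag x \<partial>lebesgue) = (\<integral>\<^sup>+x. ennreal ((cmod (f x))\<^sup>2) \<partial>lebesgue)"
    using diag_eq_1_if_frame[OF frame] by (intro nn_integral_cong_AE) (auto elim: eventually_mono)
  then have "N + ennreal ((2*pi)\<^sup>2 * (- c)) = N + ennreal ((2*pi)\<^sup>2 * c)"
    using c(2) frame_on_testsD[OF frame f] by (simp add: N_def)
  then have eq: "ennreal ((2*pi)\<^sup>2 * (- c)) = ennreal ((2*pi)\<^sup>2 * c)"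
    using \<open>N < \<infinity>\<close> unfolding ennreal_add_left_cancel by auto
  have "c = 0"
  proof (rule ccontr)
    assume "c \<noteq> 0"
    then consider "c > 0" | "c < 0" by linarith
    then show False
    proof cases
      case 1
      then have "0 < (2*pi)\<^sup>2 * c" "(2*pi)\<^sup>2 * (- c) \<le> 0" by (simp_all add: mult_nonneg_nonpos)
      then show False using eq by (metis ennreal_eq_0_iff not_le)
    next
      case 2
      then have "0 < (2*pi)\<^sup>2 * (- c)" "(2*pi)\<^sup>2 * c \<le> 0" by (simp_all add: mult_nonneg_nonpos mult_pos_neg)
      then show False using eq by (metis ennreal_eq_0_iff not_le)
    qed
  qed
  then show ?thesis using c(1) by simp
qed

text \<open>The shift set is discrete; balls of radius below the gap isolate a single shift.\<close>

lemma shift_set_gap: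
  obtains \<delta> where "\<delta> > 0" "\<And>k. k \<in> shift_set lam \<Longrightarrow> k \<noteq> a \<Longrightarrow> \<delta> \<le> norm (k - a)"
proof -
  obtain \<delta> where \<delta>: "\<delta> > 0"
    "\<And>k. k \<in> shift_set lam \<inter> cball 0 (norm a + 1) \<Longrightarrow> k \<noteq> a \<Longrightarrow> \<delta> \<le> dist a k"
    using finite_set_avoid[OF finite_shift_set_cball, of "norm a + 1" a] by blast
  show ?thesis
  proof
    show "min \<delta> 1 > 0" using \<delta> by simp
    fix k assume k: "k \<in> shift_set lam" "k \<noteq> a"
    show "min \<delta> 1 \<le> norm (k - a)"
    proof (cases "norm k \<le> norm a + 1")
      case True
      then show ?thesis using \<delta>(2)[of k] k by (simp add: dist_norm norm_minus_commute)
    next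
      case False
      then show ?thesis using norm_triangle_ineq2[of k a] by simp
    qed
  qed
qed

text \<open>Take \<open>f\<close> equal to a constant \<open>u\<close> on a subset \<open>A\<close> of a small ball and to \<open>1\<close> on the ball translated by
  \<open>2 \<pi> k\<close>. Only the shifts \<open>0\<close>, \<open>k\<close> and \<open>-k\<close> contribute, and the last two contribute
  \<open>u * Z1 + cnj u * Z2\<close>, where \<open>Z1\<close> is the integral of \<open>offdiag k\<close> over \<open>A\<close>. This vanishes for every
  \<open>u\<close>, hence \<open>Z1 = 0\<close>.\<close>

lemma offdiag_eq_0_if_frame:
  assumes frame: "frame_on_tests" and k: "k \<in> shift_set lam" "k \<noteq> 0"
  shows "AE x in lebesgue. offdiag k x = 0"
proof -
  define S where "S = {0, k, - k}"
  obtain \<delta>0 where \<delta>0: "\<delta>0 > 0" "\<And>k'. k' \<in> shift_set lam \<Longrightarrow> k' \<noteq> 0 \<Longrightarrow> \<delta>0 \<le> norm (k' - 0)"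
    using shift_set_gap[of 0] by blast
  obtain \<delta>1 where \<delta>1: "\<delta>1 > 0" "\<And>k'. k' \<in> shift_set lam \<Longrightarrow> k' \<noteq> k \<Longrightarrow> \<delta>1 \<le> norm (k' - k)"
    using shift_set_gap[of k] by blast
  obtain \<delta>2 where \<delta>2: "\<delta>2 > 0" "\<And>k'. k' \<in> shift_set lam \<Longrightarrow> k' \<noteq> - k \<Longrightarrow> \<delta>2 \<le> norm (k' - (- k))"
    using shift_set_gap[of "- k"] by blast
  \<comment> \<open>Points of the shift set within distance rho of 0, k or -k coincide with that point.\<close>
  define \<rho> where "\<rho> = min \<delta>0 (min \<delta>1 \<delta>2)"
  have \<rho>: "\<rho> > 0" "\<And>k' a. k' \<in> shift_set lam \<Longrightarrow> a \<in> S \<Longrightarrow> k' \<noteq> a \<Longrightarrow> \<rho> \<le> norm (k' - a)"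
  proof -
    have le: "\<rho> \<le> \<delta>0" "\<rho> \<le> \<delta>1" "\<rho> \<le> \<delta>2" by (simp_all add: \<rho>_def)
    show "\<rho> > 0" using \<delta>0(1) \<delta>1(1) \<delta>2(1) by (simp add: \<rho>_def)
    fix k' a assume k': "k' \<in> shift_set lam" and a: "a \<in> S" and ne: "k' \<noteq> a"
    from a consider "a = 0" | "a = k" | "a = - k" unfolding S_def by blast
    then show "\<rho> \<le> norm (k' - a)"
      by cases (use \<delta>0(2)[OF k'] \<delta>1(2)[OF k'] \<delta>2(2)[OF k'] ne le order_trans in metis)+
  qed
  have close: "k' = a" if "k' \<in> shift_set lam" "a \<in> S" "norm ((2*pi) *\<^sub>R k' - (2*pi) *\<^sub>R a) < 2 * \<rho>" for k' a
  proof (rule ccontr)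
    assume "k' \<noteq> a"
    then have "2*pi * \<rho> \<le> 2*pi * norm (k' - a)"
      using \<rho>(2)[OF that(1,2)] by (intro mult_left_mono) auto
    also have "\<dots> = norm ((2*pi) *\<^sub>R k' - (2*pi) *\<^sub>R a)"
      by (simp flip: scaleR_diff_right)
    also have "\<dots> < 2 * \<rho>" by fact
    finally have "pi * \<rho> < 1 * \<rho>" by simp
    then show False using \<rho>(1) pi_ge_two by (simp add: mult_less_cancel_right)
  qed
  define t where "t = (2*pi) *\<^sub>R k"
  have kmk: "k \<noteq> - k"
  proof
    assume "k = - k"
    then have "k + k = 0" by (metis add.right_inverse)
    then have "2 *\<^sub>R k = 0" by (simp add: scaleR_2)
    then show False using k by simp
  qed
  show ?thesis
  proof (rule AE_locally[OF \<rho>(1)])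
    fix p :: "real^2"
    define B where "B = ball p \<rho>"
    define B' where "B' = ball (p + t) \<rho>"
    have B: "B \<in> sets lebesgue" "B' \<in> sets lebesgue" by (simp_all add: B_def B'_def)
    define f where "f u A x = u * indicator A x + 1 * indicator B' x" for u :: complex and A x
    have f: "test_fun (f u A)" if "A \<in> sets lebesgue" "A \<subseteq> B" for u A
      unfolding f_def[abs_def] using that B by (intro test_fun_indicator_add[of A p \<rho> B' "p + t"]) (auto simp: B_def B'_def)
    have shiftB: "x + t \<in> B'" if "x \<in> B" for x
      using that by (simp add: B_def B'_def dist_norm)
    \<comment> \<open>A point of the shift set joining two points of the support of f is k, leading from B to B',
      or -k, leading back, or 0.\<close>
    have locate: "\<exists>a\<in>S. k' = a \<and> ((a = k \<and> x \<in> B \<and> x + (2*pi) *\<^sub>R k' \<in> B') \<or> (a = -k \<and> x \<in> B' \<and> x + (2*pi) *\<^sub>R k' \<in> B) \<or>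
         a = 0)"
      if k': "k' \<in> shift_set lam" and x: "x \<in> B \<union> B'" "x + (2*pi) *\<^sub>R k' \<in> B \<union> B'" for k' x
    proof -
      define y where "y = x + (2*pi) *\<^sub>R k'"
      have yx: "(2*pi) *\<^sub>R k' = y - x" by (simp add: y_def)
      have near: "norm ((y - b) - (x - a)) < 2 * \<rho>" if "x \<in> ball a \<rho>" "y \<in> ball b \<rho>" for a b
        using that norm_triangle_ineq4[of "y - b" "x - a"] by (simp add: dist_norm norm_minus_commute)
      consider "x \<in> B" "y \<in> B" | "x \<in> B" "y \<in> B'" | "x \<in> B'" "y \<in> B" | "x \<in> B'" "y \<in> B'"
        using x by (auto simp: y_def)
      then show ?thesis
      proof cases
        case 1
        have "norm ((2*pi) *\<^sub>R k' - (2*pi) *\<^sub>R 0) < 2 * \<rho>"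
          using near[of p p] 1 by (simp add: yx B_def)
        then show ?thesis using close[OF k', of 0] by (simp add: S_def)
      next
        case 2
        have "(2*pi) *\<^sub>R k' - (2*pi) *\<^sub>R k = (y - (p + t)) - (x - p)"
          unfolding yx t_def by simp
        then have "norm ((2*pi) *\<^sub>R k' - (2*pi) *\<^sub>R k) < 2 * \<rho>"
          using near[of p "p + t"] 2 by (simp add: B_def B'_def)
        then show ?thesis using close[OF k', of k] 2 by (auto simp: S_def y_def)
      next
        case 3
        have "(2*pi) *\<^sub>R k' - (2*pi) *\<^sub>R (- k) = (y - p) - (x - (p + t))"
          unfolding yx t_def by simp
        then have "norm ((2*pi) *\<^sub>R k' - (2*pi) *\<^sub>R (- k)) < 2 * \<rho>"
          using near[of "p + t" p] 3 by (simp add: B_def B'_def)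
        then show ?thesis using close[OF k', of "- k"] 3 by (auto simp: S_def y_def)
      next
        case 4
        have "norm ((2*pi) *\<^sub>R k' - (2*pi) *\<^sub>R 0) < 2 * \<rho>"
          using near[of "p + t" "p + t"] 4 by (simp add: yx B'_def)
        then show ?thesis using close[OF k', of 0] by (simp add: S_def)
      qed
    qed
    have supp: "x \<in> B \<union> B'" if "f u A x \<noteq> 0" "A \<subseteq> B" for u A x
      using that by (auto simp: f_def indicator_def split: if_splits)
    have negl: "negligible_shifts (f u A) S" if A: "A \<subseteq> B" for u A
      unfolding negligible_shifts_def
    proof (intro conjI ballI ext)
      fix k' x assume k': "k' \<in> shift_set lam - S"
      show "autocorr (f u A) k' x = 0"
        using locate[of k' x] supp[OF _ A, of u x] supp[OF _ A, of u "x + (2*pi) *\<^sub>R k'"] k'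
        by (auto simp: autocorr_def)
    qed (simp add: S_def)
    have disj: "x \<notin> B'" if "x \<in> B" for x
    proof
      assume "x \<in> B'"
      then have "norm t < 2 * \<rho>"
        using that norm_triangle_ineq4[of "x - p" "x - (p + t)"]
        by (simp add: B_def B'_def dist_norm norm_minus_commute)
      then show False using close[OF k(1), of 0] k by (simp add: S_def t_def)
    qed
    have ac_k: "autocorr (f u A) k x = u * indicator A x" if A: "A \<subseteq> B" for u A x
    proof (cases "x \<in> A")
      case True
      then have "x \<in> B" using A by auto
      then have "x + t \<in> B'" "x + t \<notin> A" "x \<notin> B'" using disj shiftB A by blast+
      then show ?thesis using True by (simp add: autocorr_def f_def t_def[symmetric])
    next
      case False
      have "f u A x = 0 \<or> f u A (x + t) = 0"
      proof (rule ccontr)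
        assume nz: "\<not> (f u A x = 0 \<or> f u A (x + t) = 0)"
        then have "x \<in> B" using locate[OF k(1), of x] supp[OF _ A] kmk k by (auto simp: t_def)
        then show False using nz False disj by (auto simp: f_def)
      qed
      then show ?thesis using False by (auto simp: autocorr_def t_def)
    qed
    have ac_mk: "autocorr (f u A) (- k) x = cnj u * indicator A (x - t)" if A: "A \<subseteq> B" for u A x
    proof -
      have "autocorr (f u A) (- k) x = cnj (autocorr (f u A) k (x - t))"
        by (simp add: autocorr_def t_def)
      then show ?thesis by (simp add: ac_k[OF A] indicator_def)
    qed
    have SO: "S - {0} = {k, - k}" "0 \<in> S" using k by (auto simp: S_def)
    have zero: "(LINT x|lebesgue. indicator A x * offdiag k x) = 0"
      if A: "A \<in> sets lebesgue" "A \<subseteq> B" for A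
    proof -
      define Z1 where "Z1 = (LINT x|lebesgue. indicator A x * offdiag k x)"
      define Z2 where "Z2 = (LINT x|lebesgue. indicator A (x - t) * offdiag (- k) x)"
      have "u * Z1 + cnj u * Z2 = 0" for u
      proof -
        have "0 = (LINT x|lebesgue. autocorr (f u A) k x * offdiag k x) +
            (LINT x|lebesgue. autocorr (f u A) (- k) x * offdiag (- k) x)"
          using offdiag_sum_eq_0_if_frame[OF frame f[OF A] negl[OF A(2)] SO(2), of u] kmk
          unfolding SO(1) by simp
        also have "\<dots> = u * Z1 + cnj u * Z2"
          unfolding ac_k[OF A(2)] ac_mk[OF A(2)] mult.assoc by (simp add: Z1_def Z2_def)
        finally show ?thesis by simp
      qed
      note eq = this
      \<comment> \<open>The factors 1 and i separate Z1 from Z2.\<close>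
      have "Z1 + Z2 = 0" using eq[of 1] by simp
      have "\<i> * (Z1 - Z2) = 0" using eq[of \<i>] by (simp add: right_diff_distrib)
      then have "Z1 = Z2" by simp
      then have "2 * Z1 = 0" using \<open>Z1 + Z2 = 0\<close> by (metis mult_2)
      then show ?thesis unfolding Z1_def[symmetric] by simp
    qed
    define M where "M = lebesgue_on B"
    have "B \<in> lmeasurable" by (simp add: B_def)
    then interpret M: finite_measure M
      unfolding M_def by (rule finite_measure_lebesgue_on)
    have int: "integrable lebesgue (\<lambda>x. indicator B x * offdiag k x)"
      using offdiag_integrable[OF f[OF B(1) subset_refl], of k 1] k ac_k[OF subset_refl, of 1] by simp
    have ind: "indicat_real A x *\<^sub>R z = indicator A x * z" for A :: "(real^2) set" and x and z :: complex
      by (simp add: indicator_def)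
    have "AE x in M. offdiag k x = 0"
    proof (rule M.density_zero)
      show "integrable M (offdiag k)"
        unfolding M_def using B int by (subst integrable_restrict_space) (simp_all add: ind)
      fix A assume "A \<in> sets M"
      then have A: "A \<in> sets lebesgue" "A \<subseteq> B"
        unfolding M_def using B by (simp_all add: sets_restrict_space_iff)
      have "set_lebesgue_integral M A (offdiag k) = (LINT x|lebesgue. indicator A x * offdiag k x)"
        unfolding M_def set_lebesgue_integral_def using B A(2)
        by (subst integral_restrict_space) (auto intro!: Bochner_Integration.integral_cong simp: indicator_def)
      then show "set_lebesgue_integral M A (offdiag k) = 0" using zero[OF A] by simp
    qed
    then show "AE x in lebesgue. x \<in> ball p \<rho> \<longrightarrow> offdiag k x = 0"
      unfolding M_def using B by (simp add: AE_restrict_space_iff B_def)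
  qed
qed

end

section \<open>From test functions to L2\<close>

text \<open>Test functions that converge to \<open>f\<close> pointwise and are dominated by \<open>f\<close>.\<close>

definition trunc :: "nat \<Rightarrow> (real^2 \<Rightarrow> complex) \<Rightarrow> real^2 \<Rightarrow> complex" where
  "trunc n f x = (if cmod (f x) \<le> real n \<and> norm x \<le> real n then f x else 0)"

lemma trunc_measurable:
  assumes "f \<in> borel_measurable lebesgue"
  shows "trunc n f \<in> borel_measurable lebesgue"
proof -
  have [measurable]: "f \<in> borel_measurable lebesgue" by fact
  have [measurable]: "(\<lambda>x :: real^2. norm x) \<in> borel_measurable lebesgue"
    by (rule borel_measurable_lebesgueI) measurable
  show ?thesis unfolding trunc_def[abs_def] by measurable
qed

lemma test_fun_trunc: "f \<in> borel_measurable lebesgue \<Longrightarrow> test_fun (trunc n f)"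
  unfolding test_fun_def using trunc_measurable[of f n]
  by (auto simp: trunc_def intro!: exI[of _ "real n"])

lemma norm_trunc_le: "cmod (trunc n f x) \<le> cmod (f x)"
  by (simp add: trunc_def)

lemma eventually_trunc: "eventually (\<lambda>n. trunc n f x = f x) sequentially"
proof -
  obtain m :: nat where m: "max (cmod (f x)) (norm x) \<le> real m" using real_arch_simple by blast
  show ?thesis
    unfolding eventually_sequentially
  proof (intro exI[of _ m] allI impI)
    fix n assume "m \<le> n"
    then have "real m \<le> real n" by simp
    then show "trunc n f x = f x" using m by (auto simp: trunc_def)
  qed
qed

lemma tendsto_trunc: "(\<lambda>n. trunc n f x) \<longlonglongrightarrow> f x"
  using eventually_trunc by (rule tendsto_eventually)

definition sqnorm :: "(real^2 \<Rightarrow> complex) \<Rightarrow> ennreal" where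
  "sqnorm f = (\<integral>\<^sup>+x. ennreal ((cmod (f x))\<^sup>2) \<partial>lebesgue)"

lemma sqnorm_finite: "L2_fun f \<Longrightarrow> sqnorm f < \<infinity>"
  by (simp add: L2_fun_def sqnorm_def integrable_iff_bounded)

lemma sqnorm_eq: "L2_fun f \<Longrightarrow> sqnorm f = ennreal (LINT x|lebesgue. (cmod (f x))\<^sup>2)"
  unfolding sqnorm_def L2_fun_def by (intro nn_integral_eq_integral) auto

lemma L2_fun_test: "test_fun f \<Longrightarrow> L2_fun f"
  using nn_integral_test_fun_finite[of f] by (auto simp: L2_fun_def integrable_iff_bounded test_fun_def)

lemma L2_fun_diff:
  assumes "L2_fun f" "L2_fun g"
  shows "L2_fun (\<lambda>x. f x - g x)"
  using assms square_integrable_add[of f lebesgue "\<lambda>x. - g x"] by (auto simp: L2_fun_def)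

lemma sqnorm_trunc_le: "sqnorm (trunc n f) \<le> sqnorm f"
  unfolding sqnorm_def by (intro nn_integral_mono ennreal_leI power_mono norm_trunc_le) simp

lemma sqnorm_le_liminf:
  assumes "f \<in> borel_measurable lebesgue"
  shows "sqnorm f \<le> liminf (\<lambda>n. sqnorm (trunc n f))"
proof -
  have [measurable]: "trunc n f \<in> borel_measurable lebesgue" for n by (rule trunc_measurable[OF assms])
  have "ennreal ((cmod (f x))\<^sup>2) = liminf (\<lambda>n. ennreal ((cmod (trunc n f x))\<^sup>2))" for x
    by (rule lim_imp_Liminf[symmetric])
      (auto intro!: tendsto_ennrealI tendsto_power tendsto_norm tendsto_trunc)
  then have "sqnorm f = (\<integral>\<^sup>+x. liminf (\<lambda>n. ennreal ((cmod (trunc n f x))\<^sup>2)) \<partial>lebesgue)"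
    by (simp add: sqnorm_def)
  also have "\<dots> \<le> liminf (\<lambda>n. sqnorm (trunc n f))"
    unfolding sqnorm_def by (rule nn_integral_liminf) measurable
  finally show ?thesis .
qed

lemma liminf_le_const:
  fixes X :: "nat \<Rightarrow> ennreal"
  assumes "\<And>n. X n \<le> c"
  shows "liminf X \<le> c"
  using Liminf_mono[of X "\<lambda>_. c" sequentially] assms by (simp add: Liminf_const)

lemma tendsto_sqnorm_trunc:
  assumes "L2_fun f"
  shows "(\<lambda>n. sqnorm (trunc n f)) \<longlonglongrightarrow> sqnorm f"
    and "(\<lambda>n. sqnorm (\<lambda>x. trunc n f x - f x)) \<longlonglongrightarrow> 0"
proof -
  have fm [measurable]: "f \<in> borel_measurable lebesgue" using assms by (simp add: L2_fun_def)
  have [measurable]: "trunc n f \<in> borel_measurable lebesgue" for n by (rule trunc_measurable[OF fm])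
  have fin: "(\<integral>\<^sup>+x. ennreal ((cmod (f x))\<^sup>2) \<partial>lebesgue) < \<infinity>"
    using sqnorm_finite[OF assms] by (simp add: sqnorm_def)
  show "(\<lambda>n. sqnorm (trunc n f)) \<longlonglongrightarrow> sqnorm f"
    unfolding sqnorm_def
  proof (rule nn_integral_dominated_convergence[OF _ _ _ _ fin])
    show "AE x in lebesgue. ennreal ((cmod (trunc n f x))\<^sup>2) \<le> ennreal ((cmod (f x))\<^sup>2)" for n
      by (intro AE_I2 ennreal_leI power_mono norm_trunc_le) simp
    show "AE x in lebesgue. (\<lambda>n. ennreal ((cmod (trunc n f x))\<^sup>2)) \<longlonglongrightarrow> ennreal ((cmod (f x))\<^sup>2)"
      by (intro AE_I2 tendsto_ennrealI tendsto_power tendsto_norm tendsto_trunc)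
  qed measurable
  have "(\<lambda>n. sqnorm (\<lambda>x. trunc n f x - f x)) \<longlonglongrightarrow> (\<integral>\<^sup>+(x::real^2). 0 \<partial>lebesgue)"
    unfolding sqnorm_def
  proof (rule nn_integral_dominated_convergence[OF _ _ _ _ fin])
    show "AE x in lebesgue. ennreal ((cmod (trunc n f x - f x))\<^sup>2) \<le> ennreal ((cmod (f x))\<^sup>2)" for n
      by (intro AE_I2) (simp add: trunc_def)
    show "AE x in lebesgue. (\<lambda>n. ennreal ((cmod (trunc n f x - f x))\<^sup>2)) \<longlonglongrightarrow> 0"
    proof (rule AE_I2)
      fix x
      have "eventually (\<lambda>n. ennreal ((cmod (trunc n f x - f x))\<^sup>2) = 0) sequentially"
        using eventually_trunc[of f x] by eventually_elim simp
      then show "(\<lambda>n. ennreal ((cmod (trunc n f x - f x))\<^sup>2)) \<longlonglongrightarrow> 0"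
        by (rule tendsto_eventually)
    qed
  qed measurable
  then show "(\<lambda>n. sqnorm (\<lambda>x. trunc n f x - f x)) \<longlonglongrightarrow> 0" by simp
qed

text \<open>Applied to a truncation of \<open>H\<close> itself, the functional returns the square norm of the truncation.\<close>

lemma square_integrable_if_bounded_functional:
  assumes H: "L2_loc H" and C: "C \<ge> 0"
    and bound: "\<And>f. test_fun f \<Longrightarrow> ennreal ((cmod (L2_inner f H))\<^sup>2) \<le> ennreal C * sqnorm f"
  shows "L2_fun H"
proof -
  have Hm: "H \<in> borel_measurable lebesgue" using H by (simp add: L2_loc_def)
  have le: "sqnorm (trunc n H) \<le> ennreal C" for n
  proof -
    define I where "I = (LINT x|lebesgue. (cmod (trunc n H x))\<^sup>2)"
    have t: "test_fun (trunc n H)" by (rule test_fun_trunc[OF Hm])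
    have I0: "0 \<le> I" unfolding I_def by (intro integral_nonneg_AE) simp
    have "trunc n H x * cnj (H x) = complex_of_real ((cmod (trunc n H x))\<^sup>2)" for x
    proof -
      have "trunc n H x * cnj (H x) = trunc n H x * cnj (trunc n H x)" by (simp add: trunc_def)
      then show ?thesis by (simp only: complex_norm_square)
    qed
    then have "L2_inner (trunc n H) H = complex_of_real I"
      unfolding L2_inner_def I_def by (simp only: integral_complex_of_real)
    moreover have sq: "sqnorm (trunc n H) = ennreal I"
      unfolding I_def by (rule sqnorm_eq[OF L2_fun_test[OF t]])
    ultimately have "ennreal (I\<^sup>2) \<le> ennreal (C * I)"
      using bound[OF t] C I0 by (simp add: ennreal_mult)
    then have "I * I \<le> C * I" using C I0 by (simp add: power2_eq_square ennreal_le_iff)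
    then have "I \<le> C" using I0 C by (cases "I = 0") auto
    then show ?thesis unfolding sq by (rule ennreal_leI)
  qed
  have "sqnorm H \<le> ennreal C"
    using sqnorm_le_liminf[OF Hm] liminf_le_const[OF le] by (rule order_trans)
  then have "sqnorm H < \<infinity>" by (simp add: le_less_trans)
  then show ?thesis using Hm by (simp add: L2_fun_def sqnorm_def integrable_iff_bounded)
qed

text \<open>The two properties of the squared norm of frame coefficients that allow passing from test functions to
  \<open>L\<^sub>2\<close>: lower semicontinuity along truncations, and a triangle inequality in a form free of square
  roots. Both are inherited by arbitrary sums of nonnegative terms, by Fatou's lemma and by monotonicity.\<close>

definition lsc_quadratic :: "((real^2 \<Rightarrow> complex) \<Rightarrow> ennreal) \<Rightarrow> bool" where
  "lsc_quadratic Q \<longleftrightarrow>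
     (\<forall>f. L2_fun f \<longrightarrow> Q f \<le> liminf (\<lambda>n. Q (trunc n f))) \<and>
     (\<forall>f g \<epsilon>. L2_fun f \<longrightarrow> L2_fun g \<longrightarrow> \<epsilon> > 0 \<longrightarrow>
        Q (\<lambda>x. f x + g x) \<le> ennreal (1 + \<epsilon>) * Q f + ennreal (1 + 1/\<epsilon>) * Q g)"

lemma lsc_quadratic_inner:
  assumes a: "L2_fun a"
  shows "lsc_quadratic (\<lambda>f. ennreal ((cmod (L2_inner f a))\<^sup>2))"
  unfolding lsc_quadratic_def
proof (intro conjI allI impI)
  have int: "integrable lebesgue (\<lambda>x. f x * cnj (a x))" if "L2_fun f" for f
    using that a by (intro integrable_mult_square_integrable) (auto simp: L2_fun_def)
  {
    fix f assume f: "L2_fun f"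
    have fm: "f \<in> borel_measurable lebesgue" using f by (simp add: L2_fun_def)
    have am [measurable]: "a \<in> borel_measurable lebesgue" using a by (simp add: L2_fun_def)
    note [measurable] = fm trunc_measurable[OF fm]
    have "(\<lambda>n. L2_inner (trunc n f) a) \<longlonglongrightarrow> L2_inner f a"
      unfolding L2_inner_def
    proof (rule integral_dominated_convergence[where w = "\<lambda>x. cmod (f x * cnj (a x))"])
      show "AE x in lebesgue. (\<lambda>n. trunc n f x * cnj (a x)) \<longlonglongrightarrow> f x * cnj (a x)"
        by (intro AE_I2 tendsto_mult tendsto_trunc tendsto_const)
      show "AE x in lebesgue. norm (trunc n f x * cnj (a x)) \<le> cmod (f x * cnj (a x))" for n
        by (intro AE_I2) (simp add: norm_mult mult_right_mono norm_trunc_le)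
      show "integrable lebesgue (\<lambda>x. cmod (f x * cnj (a x)))"
        using int[OF f] by (rule integrable_norm)
    qed measurable
    then have "(\<lambda>n. ennreal ((cmod (L2_inner (trunc n f) a))\<^sup>2)) \<longlonglongrightarrow> ennreal ((cmod (L2_inner f a))\<^sup>2)"
      by (intro tendsto_ennrealI tendsto_power tendsto_norm)
    then show "ennreal ((cmod (L2_inner f a))\<^sup>2) \<le> liminf (\<lambda>n. ennreal ((cmod (L2_inner (trunc n f) a))\<^sup>2))"
      by (subst lim_imp_Liminf) auto
  }
  fix f g :: "real^2 \<Rightarrow> complex" and \<epsilon> :: real
  assume f: "L2_fun f" and g: "L2_fun g" and \<epsilon>: "\<epsilon> > 0"
  define z where "z = L2_inner f a"
  define w where "w = L2_inner g a"
  have zw: "L2_inner (\<lambda>x. f x + g x) a = z + w"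
    unfolding z_def w_def L2_inner_def distrib_right
    by (rule Bochner_Integration.integral_add[OF int[OF f] int[OF g]])
  \<comment> \<open>Young's inequality for the mixed term of the square.\<close>
  have "0 \<le> (\<epsilon> * cmod z - cmod w)\<^sup>2 / \<epsilon>" using \<epsilon> by simp
  also have "\<dots> = \<epsilon> * (cmod z)\<^sup>2 + (cmod w)\<^sup>2 / \<epsilon> - 2 * cmod z * cmod w"
    using \<epsilon> by (simp add: power2_diff power_mult_distrib field_simps power2_eq_square)
  finally have "(cmod z + cmod w)\<^sup>2 \<le> (1 + \<epsilon>) * (cmod z)\<^sup>2 + (1 + 1/\<epsilon>) * (cmod w)\<^sup>2"
    by (simp add: power2_sum distrib_right)
  moreover have "(cmod (z + w))\<^sup>2 \<le> (cmod z + cmod w)\<^sup>2"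
    by (intro power_mono norm_triangle_ineq) simp
  ultimately have "ennreal ((cmod (z + w))\<^sup>2) \<le> ennreal ((1 + \<epsilon>) * (cmod z)\<^sup>2 + (1 + 1/\<epsilon>) * (cmod w)\<^sup>2)"
    by (intro ennreal_leI) linarith
  also have "\<dots> = ennreal (1 + \<epsilon>) * ennreal ((cmod z)\<^sup>2) + ennreal (1 + 1/\<epsilon>) * ennreal ((cmod w)\<^sup>2)"
    using \<epsilon> by (subst ennreal_plus) (simp_all only: ennreal_mult[symmetric] zero_le_power2 mult_nonneg_nonneg
        add_nonneg_nonneg zero_le_one less_imp_le zero_le_divide_1_iff)
  finally show "ennreal ((cmod (L2_inner (\<lambda>x. f x + g x) a))\<^sup>2)
      \<le> ennreal (1 + \<epsilon>) * ennreal ((cmod (L2_inner f a))\<^sup>2) + ennreal (1 + 1/\<epsilon>) * ennreal ((cmod (L2_inner g a))\<^sup>2)"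
    unfolding zw z_def w_def .
qed

lemma lsc_quadratic_nn_integral:
  assumes Q: "\<And>i. i \<in> I \<Longrightarrow> lsc_quadratic (Q i)"
  shows "lsc_quadratic (\<lambda>f. \<integral>\<^sup>+i. Q i f \<partial>count_space I)"
  unfolding lsc_quadratic_def
proof (intro conjI allI impI)
  fix f :: "real^2 \<Rightarrow> complex" assume f: "L2_fun f"
  have "(\<integral>\<^sup>+i. Q i f \<partial>count_space I) \<le> (\<integral>\<^sup>+i. liminf (\<lambda>n. Q i (trunc n f)) \<partial>count_space I)"
    using Q f by (intro nn_integral_mono) (simp add: lsc_quadratic_def)
  also have "\<dots> \<le> liminf (\<lambda>n. \<integral>\<^sup>+i. Q i (trunc n f) \<partial>count_space I)"
    by (rule nn_integral_liminf) simp
  finally show "(\<integral>\<^sup>+i. Q i f \<partial>count_space I) \<le> liminf (\<lambda>n. \<integral>\<^sup>+i. Q i (trunc n f) \<partial>count_space I)" .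
next
  fix f g :: "real^2 \<Rightarrow> complex" and \<epsilon> :: real
  assume "L2_fun f" "L2_fun g" "\<epsilon> > 0"
  then have "(\<integral>\<^sup>+i. Q i (\<lambda>x. f x + g x) \<partial>count_space I) \<le>
     (\<integral>\<^sup>+i. ennreal (1 + \<epsilon>) * Q i f + ennreal (1 + 1/\<epsilon>) * Q i g \<partial>count_space I)"
    using Q by (intro nn_integral_mono) (simp add: lsc_quadratic_def)
  also have "\<dots> = ennreal (1 + \<epsilon>) * (\<integral>\<^sup>+i. Q i f \<partial>count_space I) + ennreal (1 + 1/\<epsilon>) * (\<integral>\<^sup>+i. Q i g \<partial>count_space I)"
    by (simp add: nn_integral_add nn_integral_cmult)
  finally show "(\<integral>\<^sup>+i. Q i (\<lambda>x. f x + g x) \<partial>count_space I) \<le>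
     ennreal (1 + \<epsilon>) * (\<integral>\<^sup>+i. Q i f \<partial>count_space I) + ennreal (1 + 1/\<epsilon>) * (\<integral>\<^sup>+i. Q i g \<partial>count_space I)" .
qed

lemma lsc_quadratic_sum:
  assumes "finite I" "\<And>i. i \<in> I \<Longrightarrow> lsc_quadratic (Q i)"
  shows "lsc_quadratic (\<lambda>f. \<Sum>i\<in>I. Q i f)"
  using lsc_quadratic_nn_integral[of I Q] assms by (simp add: nn_integral_count_space_finite)

lemma lsc_quadratic_add:
  assumes "lsc_quadratic Q" "lsc_quadratic Q'"
  shows "lsc_quadratic (\<lambda>f. Q f + Q' f)"
  using lsc_quadratic_sum[of UNIV "\<lambda>b. if b then Q' else Q"] assms by (simp add: UNIV_bool)

lemma lsc_quadratic_suminf: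
  assumes "\<And>j::nat. lsc_quadratic (Q j)"
  shows "lsc_quadratic (\<lambda>f. \<Sum>j. Q j f)"
  using lsc_quadratic_nn_integral[of UNIV Q] assms by (simp add: nn_integral_count_space_nat)

lemma lsc_quadratic_infsum_lattice:
  assumes "\<And>k. k \<in> int_lattice \<Longrightarrow> lsc_quadratic (Q k)"
  shows "lsc_quadratic (\<lambda>f. \<Sum>\<^sub>\<infinity>k\<in>int_lattice. Q k f)"
  using lsc_quadratic_nn_integral[of int_lattice Q] assms
  by (simp add: infsum_ennreal_conv_nn_integral countable_int_lattice)

text \<open>Lower semicontinuity gives the upper bound for every \<open>L\<^sub>2\<close> function. For the lower bound, a
  truncation is the sum of \<open>f\<close> and an error whose value under \<open>Q\<close> tends to \<open>0\<close> by the upper bound.\<close>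

proposition lsc_quadratic_determined_by_tests:
  assumes Q: "lsc_quadratic Q" and P: "P \<ge> 0"
    and tests: "\<And>f. test_fun f \<Longrightarrow> Q f = ennreal P * sqnorm f"
    and f: "L2_fun f"
  shows "Q f = ennreal P * sqnorm f"
proof (rule antisym)
  have Bessel: "Q g \<le> ennreal P * sqnorm g" if g: "L2_fun g" for g
  proof -
    have gm: "g \<in> borel_measurable lebesgue" using g by (simp add: L2_fun_def)
    have "Q (trunc n g) \<le> ennreal P * sqnorm g" for n
      unfolding tests[OF test_fun_trunc[OF gm]] by (intro mult_left_mono sqnorm_trunc_le) simp
    then have "liminf (\<lambda>n. Q (trunc n g)) \<le> ennreal P * sqnorm g" by (rule liminf_le_const)
    moreover have "Q g \<le> liminf (\<lambda>n. Q (trunc n g))" using Q g by (simp add: lsc_quadratic_def)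
    ultimately show ?thesis by (rule order_trans[rotated])
  qed
  show "Q f \<le> ennreal P * sqnorm f" by (rule Bessel[OF f])
  have fm: "f \<in> borel_measurable lebesgue" using f by (simp add: L2_fun_def)
  have approx: "ennreal P * sqnorm f \<le> ennreal (1 + \<epsilon>) * Q f" if \<epsilon>: "\<epsilon> > 0" for \<epsilon>
  proof (rule LIMSEQ_le)
    show "(\<lambda>n. ennreal P * sqnorm (trunc n f)) \<longlonglongrightarrow> ennreal P * sqnorm f"
      by (intro ennreal_tendsto_cmult tendsto_sqnorm_trunc(1)[OF f]) simp
    have "(\<lambda>n. ennreal (1 + \<epsilon>) * Q f + ennreal (1 + 1/\<epsilon>) * (ennreal P * sqnorm (\<lambda>x. trunc n f x - f x)))
        \<longlonglongrightarrow> ennreal (1 + \<epsilon>) * Q f + ennreal (1 + 1/\<epsilon>) * (ennreal P * 0)"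
      by (intro tendsto_add tendsto_const ennreal_tendsto_cmult tendsto_sqnorm_trunc(2)[OF f]) simp_all
    then show "(\<lambda>n. ennreal (1 + \<epsilon>) * Q f + ennreal (1 + 1/\<epsilon>) * (ennreal P * sqnorm (\<lambda>x. trunc n f x - f x)))
        \<longlonglongrightarrow> ennreal (1 + \<epsilon>) * Q f" by simp
    show "\<exists>N. \<forall>n\<ge>N. ennreal P * sqnorm (trunc n f) \<le>
        ennreal (1 + \<epsilon>) * Q f + ennreal (1 + 1/\<epsilon>) * (ennreal P * sqnorm (\<lambda>x. trunc n f x - f x))"
    proof (intro exI allI impI)
      fix n
      have t: "test_fun (trunc n f)" by (rule test_fun_trunc[OF fm])
      have d: "L2_fun (\<lambda>x. trunc n f x - f x)" by (rule L2_fun_diff[OF L2_fun_test[OF t] f])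
      have "ennreal P * sqnorm (trunc n f) = Q (\<lambda>x. f x + (trunc n f x - f x))"
        using tests[OF t] by (simp add: fun_eq_iff)
      also have "\<dots> \<le> ennreal (1 + \<epsilon>) * Q f + ennreal (1 + 1/\<epsilon>) * Q (\<lambda>x. trunc n f x - f x)"
        using Q f d \<epsilon> unfolding lsc_quadratic_def by blast
      also have "\<dots> \<le> ennreal (1 + \<epsilon>) * Q f + ennreal (1 + 1/\<epsilon>) * (ennreal P * sqnorm (\<lambda>x. trunc n f x - f x))"
        by (intro add_left_mono mult_left_mono Bessel[OF d]) simp
      finally show "ennreal P * sqnorm (trunc n f) \<le>
        ennreal (1 + \<epsilon>) * Q f + ennreal (1 + 1/\<epsilon>) * (ennreal P * sqnorm (\<lambda>x. trunc n f x - f x))" .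
    qed
  qed
  have fin: "ennreal P * sqnorm f < \<infinity>" using sqnorm_finite[OF f] by (simp add: ennreal_mult_less_top)
  obtain a where a: "ennreal P * sqnorm f = ennreal a" "a \<ge> 0" using fin by (cases "ennreal P * sqnorm f") auto
  have "Q f < \<infinity>" using Bessel[OF f] fin by (rule le_less_trans)
  then obtain b where b: "Q f = ennreal b" "b \<ge> 0" by (cases "Q f") auto
  have "a \<le> b"
  proof (rule field_le_epsilon)
    fix e :: real assume e: "e > 0"
    define \<epsilon> where "\<epsilon> = e / (b + 1)"
    have \<epsilon>: "\<epsilon> > 0" using e b by (simp add: \<epsilon>_def)
    have "ennreal a \<le> ennreal ((1 + \<epsilon>) * b)"
      using approx[OF \<epsilon>] a b \<epsilon> by (simp add: ennreal_mult)
    then have "a \<le> (1 + \<epsilon>) * b" using b \<epsilon> by (simp add: ennreal_le_iff)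
    also have "\<epsilon> * b \<le> e" using e b by (simp add: \<epsilon>_def field_simps)
    then have "(1 + \<epsilon>) * b \<le> b + e" by (simp add: distrib_right)
    finally show "a \<le> b + e" .
  qed
  then show "ennreal P * sqnorm f \<le> Q f" unfolding a b by (rule ennreal_leI)
qed

lemma infsum_ge_term:
  fixes f :: "'a \<Rightarrow> ennreal"
  assumes "k \<in> A"
  shows "f k \<le> infsum f A"
proof -
  have "infsum f A = (SUP F\<in>{F. finite F \<and> F \<subseteq> A}. sum f F)"
    by (rule nonneg_infsum_complete) simp
  moreover have "sum f {k} \<le> (SUP F\<in>{F. finite F \<and> F \<subseteq> A}. sum f F)"
    using assms by (intro SUP_upper) auto
  ultimately show ?thesis by simp
qed

lemma dil_mod_0: "dil_mod h U 0 = (\<lambda>x. complex_of_real (sqrt \<bar>det U\<bar>) * h (U *v x))"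
  by (simp add: dil_mod_def)

lemma L2_loc_scale: "L2_loc h \<Longrightarrow> L2_loc (\<lambda>x. c * h x)"
  by (auto simp: L2_loc_def norm_mult power_mult_distrib intro: set_integrable_mult_right)

lemma L2_fun_dil_mod:
  assumes U: "det U \<noteq> 0" and h: "L2_fun h"
  shows "L2_fun (dil_mod h U k)"
proof -
  have hm: "h \<in> borel_measurable lebesgue" and hi: "integrable lebesgue (\<lambda>x. (cmod (h x))\<^sup>2)"
    using h by (simp_all add: L2_fun_def)
  have hU: "(\<lambda>x. h (U *v x)) \<in> borel_measurable lebesgue"
    using borel_measurable_matrix_affine[OF U hm, of 0] by simp
  have e: "(\<lambda>x. exp (- (\<i> * complex_of_real (k \<bullet> (U *v x))))) \<in> borel_measurable lebesgue"
    by (intro borel_measurable_lebesgueI borel_measurable_continuous_onI continuous_intros linear_continuous_on) simp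
  have "dil_mod h U k \<in> borel_measurable lebesgue"
    unfolding dil_mod_def using hU e by measurable
  moreover have "integrable lebesgue (\<lambda>x. (cmod (dil_mod h U k x))\<^sup>2)"
  proof -
    have "integrable lebesgue (\<lambda>x. (cmod (h (0 + U *v x)))\<^sup>2)"
      using integrable_matrix_affine_iff[OF U, of "\<lambda>x. (cmod (h x))\<^sup>2" 0] hm hi by simp
    then have "integrable lebesgue (\<lambda>x. \<bar>det U\<bar> * (cmod (h (U *v x)))\<^sup>2)" by simp
    also have "(\<lambda>x. \<bar>det U\<bar> * (cmod (h (U *v x)))\<^sup>2) = (\<lambda>x. (cmod (dil_mod h U k x))\<^sup>2)"
      by (simp add: dil_mod_def norm_mult power_mult_distrib norm_exp_eq_Re fun_eq_iff)
    finally show ?thesis .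
  qed
  ultimately show ?thesis by (simp add: L2_fun_def)
qed

lemma L2_fun_from_dil_mod:
  assumes U: "det U \<noteq> 0" and h: "L2_loc h" and d: "L2_fun (dil_mod h U 0)"
  shows "L2_fun h"
proof -
  have hm: "h \<in> borel_measurable lebesgue" using h by (simp add: L2_loc_def)
  have "integrable lebesgue (\<lambda>x. (cmod (dil_mod h U 0 x))\<^sup>2)" using d by (simp add: L2_fun_def)
  also have "(\<lambda>x. (cmod (dil_mod h U 0 x))\<^sup>2) = (\<lambda>x. \<bar>det U\<bar> * (cmod (h (U *v x)))\<^sup>2)"
    by (simp add: dil_mod_0 norm_mult power_mult_distrib)
  finally have "integrable lebesgue (\<lambda>x. inverse \<bar>det U\<bar> * (\<bar>det U\<bar> * (cmod (h (U *v x)))\<^sup>2))"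
    by (rule integrable_mult_right)
  then have "integrable lebesgue (\<lambda>x. (cmod (h (0 + U *v x)))\<^sup>2)" using U by (simp add: mult.assoc[symmetric])
  then have "integrable lebesgue (\<lambda>x. (cmod (h x))\<^sup>2)"
    using integrable_matrix_affine_iff[OF U, of "\<lambda>x. (cmod (h x))\<^sup>2" 0] hm by simp
  then show ?thesis using hm by (simp add: L2_fun_def)
qed

context shear_system
begin

text \<open>A bounded set meets its translates by \<open>2 \<pi> k\<close> for finitely many points \<open>k\<close> of the shift set only.\<close>

lemma frame_on_tests_if_identities:
  assumes d: "AE x in lebesgue. diag x = 1"
    and o: "\<And>k. k \<in> shift_set lam - {0} \<Longrightarrow> AE x in lebesgue. offdiag k x = 0"
  shows frame_on_tests
  unfolding frame_on_tests_def
proof (intro allI impI)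
  fix f assume f: "test_fun f"
  obtain R where R: "\<And>x. f x \<noteq> 0 \<Longrightarrow> norm x \<le> R" using f by (auto simp: test_fun_def)
  define K where "K = shift_set lam \<inter> cball 0 \<bar>R\<bar>"
  have "0 \<in> shift_set lam"
    by (rule scale_mat_lattice_imp_shift_set[of 0 False]) (simp add: int_lattice_0)
  then have K0: "0 \<in> K" by (simp add: K_def)
  have K: "negligible_shifts f K"
    unfolding negligible_shifts_def
  proof (intro conjI ballI ext)
    show "finite K" unfolding K_def by (rule finite_shift_set_cball)
    fix k x assume k: "k \<in> shift_set lam - K"
    have "f x = 0 \<or> f (x + (2*pi) *\<^sub>R k) = 0"
    proof (rule ccontr)
      assume "\<not> (f x = 0 \<or> f (x + (2*pi) *\<^sub>R k) = 0)"
      then have "norm x \<le> R" "norm (x + (2*pi) *\<^sub>R k) \<le> R" using R by auto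
      then have "norm ((2*pi) *\<^sub>R k) \<le> 2 * R"
        using norm_triangle_ineq4[of "x + (2*pi) *\<^sub>R k" x] by simp
      moreover have "norm k * 1 \<le> norm k * pi" using pi_ge_two by (intro mult_left_mono) auto
      ultimately have "norm k \<le> R" by (simp add: mult.commute)
      then show False using k by (auto simp: K_def)
    qed
    then show "autocorr f k x = 0" by (auto simp: autocorr_def)
  qed
  obtain c where c: "(\<Sum>k\<in>K - {0}. LINT x|lebesgue. autocorr f k x * offdiag k x) = complex_of_real c"
      "frame_sum f + ennreal ((2*pi)\<^sup>2 * (- c)) =
       ennreal ((2*pi)\<^sup>2) * (\<integral>\<^sup>+x. ennreal ((cmod (f x))\<^sup>2) * diag x \<partial>lebesgue) + ennreal ((2*pi)\<^sup>2 * c)"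
    by (rule frame_sum_identity[OF f K K0])
  have "(\<Sum>k\<in>K - {0}. LINT x|lebesgue. autocorr f k x * offdiag k x) = 0"
  proof (rule sum.neutral, rule ballI)
    fix k assume "k \<in> K - {0}"
    then have "AE x in lebesgue. offdiag k x = 0" using o by (simp add: K_def)
    then have "AE x in lebesgue. autocorr f k x * offdiag k x = 0" by eventually_elim simp
    then show "(LINT x|lebesgue. autocorr f k x * offdiag k x) = 0" by (rule integral_eq_zero_AE)
  qed
  then have "c = 0" using c(1) by simp
  moreover have "(\<integral>\<^sup>+x. ennreal ((cmod (f x))\<^sup>2) * diag x \<partial>lebesgue) = (\<integral>\<^sup>+x. ennreal ((cmod (f x))\<^sup>2) \<partial>lebesgue)"
    using d by (intro nn_integral_cong_AE) (auto elim: eventually_mono)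
  ultimately show "frame_sum f = ennreal ((2*pi)\<^sup>2) * (\<integral>\<^sup>+x. ennreal ((cmod (f x))\<^sup>2) \<partial>lebesgue)"
    using c(2) by simp
qed

lemma phi_sum_ge: "ennreal ((cmod (L2_inner f (dil_mod \<phi> (mat 1) 0)))\<^sup>2) \<le> frame_sum f"
proof -
  have "ennreal ((cmod (L2_inner f (dil_mod \<phi> (mat 1) 0)))\<^sup>2) \<le> phi_sum f"
    unfolding phi_sum_def by (rule infsum_ge_term[OF int_lattice_0])
  then show ?thesis unfolding frame_sum_def by (simp add: add_increasing2)
qed

lemma scale_sum_ge:
  assumes l: "l \<in> shears j"
  shows "ennreal ((cmod (L2_inner f (dil_mod (gen j l) (scale_mat j False) 0)))\<^sup>2) \<le> frame_sum f"
proof -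
  let ?S = "\<lambda>l b. \<Sum>\<^sub>\<infinity>k\<in>int_lattice. ennreal ((cmod (L2_inner f (dil_mod (gen j l) (scale_mat j b) k)))\<^sup>2)"
  have "ennreal ((cmod (L2_inner f (dil_mod (gen j l) (scale_mat j False) 0)))\<^sup>2) \<le> ?S l False"
    by (rule infsum_ge_term[OF int_lattice_0])
  also have "\<dots> \<le> ?S l False + ?S l True" by simp
  also have "\<dots> \<le> scale_sum f j"
    unfolding scale_sum_eq by (rule member_le_sum[OF l]) auto
  also have "\<dots> \<le> (\<Sum>j. scale_sum f j)"
    using sum_le_suminf[of "scale_sum f" "{j}"] by simp
  also have "\<dots> \<le> frame_sum f" unfolding frame_sum_def by (simp add: add_increasing)
  finally show ?thesis .
qed

text \<open>The coefficient with \<open>k = 0\<close> alone is bounded by the frame sum, hence by a multiple of the norm of \<open>f\<close>.\<close>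

lemma generators_L2_if_frame_on_tests:
  assumes frame: frame_on_tests
  shows "L2_fun \<phi>" and "\<And>j l. l \<in> shears j \<Longrightarrow> L2_fun (gen j l)"
proof -
  have L2: "L2_fun h"
    if U: "det U \<noteq> 0" and h: "L2_loc h"
      and le: "\<And>f. ennreal ((cmod (L2_inner f (dil_mod h U 0)))\<^sup>2) \<le> frame_sum f" for h U
  proof (rule L2_fun_from_dil_mod[OF U h])
    show "L2_fun (dil_mod h U 0)"
    proof (rule square_integrable_if_bounded_functional[where C = "(2*pi)\<^sup>2"])
      show "L2_loc (dil_mod h U 0)"
        unfolding dil_mod_0 by (intro L2_loc_scale L2_loc_linear U h)
      fix f assume "test_fun f"
      then show "ennreal ((cmod (L2_inner f (dil_mod h U 0)))\<^sup>2) \<le> ennreal ((2*pi)\<^sup>2) * sqnorm f"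
        using le[of f] frame_on_testsD[OF frame] by (simp only: sqnorm_def)
    qed simp
  qed
  show "L2_fun \<phi>"
    by (rule L2[OF _ phi_loc phi_sum_ge]) simp
  show "L2_fun (gen j l)" if l: "l \<in> shears j" for j l
    by (rule L2[OF det_scale_mat gen_loc[OF l] scale_sum_ge[OF l]])
qed

lemma lsc_quadratic_frame_sum:
  assumes phi: "L2_fun \<phi>" and gen: "\<And>j l. l \<in> shears j \<Longrightarrow> L2_fun (gen j l)"
  shows "lsc_quadratic frame_sum"
  unfolding frame_sum_def[abs_def] phi_sum_def scale_sum_eq
  by (intro lsc_quadratic_add lsc_quadratic_suminf lsc_quadratic_sum lsc_quadratic_infsum_lattice
      lsc_quadratic_inner L2_fun_dil_mod det_scale_mat phi gen) simp_all

proposition FAS_tight_frame_iff_frame_on_tests: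
  "FAS_tight_frame lam r s \<phi> \<psi> \<psi>' \<longleftrightarrow> frame_on_tests"
proof
  assume "FAS_tight_frame lam r s \<phi> \<psi> \<psi>'"
  then have *: "ennreal ((2*pi)\<^sup>2 * (LINT x|lebesgue. (cmod (f x))\<^sup>2)) = frame_sum f" if "L2_fun f" for f
    using that by (simp only: FAS_tight_frame_iff)
  show frame_on_tests
    unfolding frame_on_tests_def
  proof (intro allI impI)
    fix f assume "test_fun f"
    then have f: "L2_fun f" by (rule L2_fun_test)
    have "frame_sum f = ennreal ((2*pi)\<^sup>2) * ennreal (LINT x|lebesgue. (cmod (f x))\<^sup>2)"
      unfolding *[OF f, symmetric] by (rule ennreal_mult') simp
    then show "frame_sum f = ennreal ((2*pi)\<^sup>2) * (\<integral>\<^sup>+x. ennreal ((cmod (f x))\<^sup>2) \<partial>lebesgue)"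
      using sqnorm_eq[OF f] by (simp only: sqnorm_def)
  qed
next
  assume frame: frame_on_tests
  note gens = generators_L2_if_frame_on_tests[OF frame]
  have "ennreal ((2*pi)\<^sup>2 * (LINT x|lebesgue. (cmod (f x))\<^sup>2)) = frame_sum f" if f: "L2_fun f" for f
  proof -
    have "frame_sum f = ennreal ((2*pi)\<^sup>2) * sqnorm f"
      by (rule lsc_quadratic_determined_by_tests[OF lsc_quadratic_frame_sum _ _ f])
        (use gens frame_on_testsD[OF frame] in \<open>simp_all add: sqnorm_def\<close>)
    also have "\<dots> = ennreal ((2*pi)\<^sup>2 * (LINT x|lebesgue. (cmod (f x))\<^sup>2))"
      unfolding sqnorm_eq[OF f] by (rule ennreal_mult'[symmetric]) simp
    finally show ?thesis ..
  qed
  then show "FAS_tight_frame lam r s \<phi> \<psi> \<psi>'" unfolding FAS_tight_frame_iff using gens by blast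
qed

proposition frame_on_tests_iff:
  "frame_on_tests \<longleftrightarrow> (AE x in lebesgue. diag x = 1) \<and>
     (\<forall>k\<in>shift_set lam - {0}. AE x in lebesgue. offdiag k x = 0)"
  using frame_on_tests_if_identities diag_eq_1_if_frame offdiag_eq_0_if_frame by blast

end

theorem theorem1:
  fixes lam :: real
    and r s :: "nat \<Rightarrow> nat"
    and \<phi> \<psi> :: "real^2 \<Rightarrow> complex"
    and \<psi>' :: "nat \<Rightarrow> int \<Rightarrow> real^2 \<Rightarrow> complex"
  assumes "lam > 1"
    and "\<And>j. r j \<le> s j"
    and "L2_loc \<phi>"
    and "\<And>j l. l \<in> {- int (s j)..int (s j)} \<Longrightarrow> L2_loc (shear_gen r \<psi> \<psi>' j l)"
  shows "(\<forall>k \<in> shift_set lam - {0}. AE \<xi> in lebesgue.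
            finite {j. I_bracket lam r s \<psi> \<psi>' k \<xi> j \<noteq> 0}) \<and>
         (FAS_tight_frame lam r s \<phi> \<psi> \<psi>' \<longleftrightarrow>
           (AE \<xi> in lebesgue.
              summable (\<lambda>j. norm (I_bracket lam r s \<psi> \<psi>' 0 \<xi> j)) \<and>
              I_phi \<phi> 0 \<xi> + (\<Sum>j. I_bracket lam r s \<psi> \<psi>' 0 \<xi> j) = 1) \<and>
           (\<forall>k \<in> shift_set lam - {0}. AE \<xi> in lebesgue.
              I_phi \<phi> k \<xi> + (\<Sum>j. I_bracket lam r s \<psi> \<psi>' k \<xi> j) = 0))"
proof -
  interpret shear_system lam r s \<phi> \<psi> \<psi>'
    by unfold_locales (fact assms(1,3,4))+
  show ?thesis
    unfolding FAS_tight_frame_iff_frame_on_tests frame_on_tests_iff diag_eq_1_iff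
    unfolding offdiag_def[symmetric]
    using finite_bracket_nonzero by simp
qed

end
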